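(* Let $\gamma$ be a simple closed smooth curve in the Euclidean plane. If the Birkhoff billiard inside $\gamma$ is integrable with an integral which is polynomial in $v$, then $\tilde\gamma$ does not have two real algebraic ovals having a common tangent line.
   Context: Birkhoff billiard: let $\Omega$ be the domain bounded by $\gamma$. The billiard flow $g^t$ transports a tangent vector $v\in T_q\Omega$ parallel along the straight line in the direction of $v$ until collision with $\gamma$, where it is reflected by $v_+=v_--2n\langle v_-,n\rangle$, with $n$ the unit outward normal to $\gamma$. Integrable with an integral polynomial in $v$ means: there is a function $\Phi(q,v)$, $q\in\Omega$, polynomial in the components $(v_x,v_y)$ of $v$ (with coefficients depending on $q$), non-constant on the energy level $\{|v|=1\}$, with $\Phi\circ g^t=\Phi$ on $\{|v|=1\}$. Under this hypothesis $\gamma$ is contained in an algebraic curve (theorem of Bolotin); $\tilde\gamma$ denotes the irreducible complex projective algebraic curve in $\mathbb{C}P^2$ containing $\gamma$, where the Euclidean plane with coordinates $(x,y)$ is embedded in $\mathbb{C}P^2$ by $(x,y)\mapsto(x:y:1)$. A real algebraic oval of $\tilde\gamma$ is a smooth simple closed curve in the Euclidean plane contained in the real part of $\tilde\gamma$; the two ovals in the claim are distinct. *)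

theory Defs
  imports
    "HOL-Analysis.Analysis"
    "HOL-Library.Poly_Mapping"
    "HOL-Computational_Algebra.Factorial_Ring"
begin

section \<open>Smooth closed curves in the Euclidean plane\<close>

definition smooth_curve :: "(real \<Rightarrow> real^2) \<Rightarrow> bool" where
  "smooth_curve \<gamma> \<longleftrightarrow>
     (\<exists>D :: nat \<Rightarrow> real \<Rightarrow> real^2.
        D 0 = \<gamma> \<and> (\<forall>k t. (D k has_vector_derivative D (Suc k) t) (at t)))"

text \<open>
  A closed curve is a 1-periodic map, so that smoothness also holds at the closing point.
  The curve as a set of points is \<open>path_image \<gamma>\<close>, which equals \<open>range \<gamma>\<close> by periodicity.
  ``Smooth'' means \<open>C\<^sup>\<infinity>\<close> with nowhere vanishing velocity.
\<close>

definition smooth_simple_closed_curve :: "(real \<Rightarrow> real^2) \<Rightarrow> bool" where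
  "smooth_simple_closed_curve \<gamma> \<longleftrightarrow>
     (\<forall>t. \<gamma> (t + 1) = \<gamma> t) \<and> simple_path \<gamma> \<and> smooth_curve \<gamma> \<and>
     (\<forall>t. vector_derivative \<gamma> (at t) \<noteq> 0)"

definition tangent_line :: "(real \<Rightarrow> real^2) \<Rightarrow> (real^2) set \<Rightarrow> bool" where
  "tangent_line \<gamma> L \<longleftrightarrow>
     (\<exists>t. L = range (\<lambda>s. \<gamma> t + s *\<^sub>R vector_derivative \<gamma> (at t)))"

section \<open>Birkhoff billiards\<close>

definition billiard_domain :: "(real \<Rightarrow> real^2) \<Rightarrow> (real^2) set" where
  "billiard_domain \<gamma> = inside (path_image \<gamma>)"

definition outward_unit_normal :: "(real \<Rightarrow> real^2) \<Rightarrow> real^2 \<Rightarrow> real^2 \<Rightarrow> bool" where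
  "outward_unit_normal \<gamma> p n \<longleftrightarrow>
     norm n = 1 \<and> (\<exists>t. \<gamma> t = p \<and> n \<bullet> vector_derivative \<gamma> (at t) = 0) \<and>
     (\<forall>\<^sub>F \<epsilon> in at_right 0. p + \<epsilon> *\<^sub>R n \<in> outside (path_image \<gamma>))"

text \<open>
  \<open>billiard_flow \<gamma> t z z'\<close> says that \<open>g\<^sup>t z\<close> is defined (for a time \<open>t \<ge> 0\<close>) and equal to
  \<open>z'\<close>. The flow is only partially defined: in a non-convex domain a trajectory may arrive
  tangentially at a boundary point from which it cannot be continued inside the domain, and
  collisions may accumulate in finite time. At a tangential collision the reflection law
  gives \<open>v\<^sub>+ = v\<^sub>-\<close>, so such a collision needs no rule of its own. At a transversal collision
  time the state is present twice, with the incoming and with the outgoing velocity.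
\<close>

inductive billiard_flow ::
    "(real \<Rightarrow> real^2) \<Rightarrow> real \<Rightarrow> (real^2) \<times> (real^2) \<Rightarrow> (real^2) \<times> (real^2) \<Rightarrow> bool"
  for \<gamma> where
  start: "billiard_flow \<gamma> 0 z z"
| move: "\<lbrakk>billiard_flow \<gamma> t z (q, v); 0 \<le> s;
          \<forall>r\<in>{0<..<s}. q + r *\<^sub>R v \<in> billiard_domain \<gamma>\<rbrakk>
         \<Longrightarrow> billiard_flow \<gamma> (t + s) z (q + s *\<^sub>R v, v)"
| reflect: "\<lbrakk>billiard_flow \<gamma> t z (q, v); outward_unit_normal \<gamma> q n; v \<bullet> n > 0\<rbrakk>
            \<Longrightarrow> billiard_flow \<gamma> t z (q, v - (2 * (v \<bullet> n)) *\<^sub>R n)"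

definition polynomial_in_velocity ::
    "(real^2) set \<Rightarrow> (real^2 \<Rightarrow> real^2 \<Rightarrow> real) \<Rightarrow> bool" where
  "polynomial_in_velocity \<Omega> \<Phi> \<longleftrightarrow>
     (\<exists>(N::nat) (a :: nat \<Rightarrow> nat \<Rightarrow> real^2 \<Rightarrow> real). \<forall>q\<in>\<Omega>. \<forall>v.
        \<Phi> q v = (\<Sum>i\<le>N. \<Sum>j\<le>N. a i j q * (v $ 1) ^ i * (v $ 2) ^ j))"

text \<open>
  No regularity of the coefficients is required. Invariance along free motion says that
  \<open>\<Phi>\<close> is constant along line segments in the domain; since the degree in the velocity is
  bounded uniformly in \<open>q\<close>, the coefficients of the homogeneous even and odd parts of \<open>\<Phi>\<close>
  on unit velocities are obtained from finitely many pencils of lines by solving a linear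
  system, and are therefore locally rational functions of \<open>q\<close>.
\<close>

definition polynomially_integrable_billiard :: "(real \<Rightarrow> real^2) \<Rightarrow> bool" where
  "polynomially_integrable_billiard \<gamma> \<longleftrightarrow>
     (\<exists>\<Phi>. polynomial_in_velocity (billiard_domain \<gamma>) \<Phi> \<and>
          \<not> (\<exists>c. \<forall>q\<in>billiard_domain \<gamma>. \<forall>v. norm v = 1 \<longrightarrow> \<Phi> q v = c) \<and>
          (\<forall>t q v q' v'. q \<in> billiard_domain \<gamma> \<longrightarrow> q' \<in> billiard_domain \<gamma> \<longrightarrow> norm v = 1 \<longrightarrow>
             billiard_flow \<gamma> t (q, v) (q', v') \<longrightarrow> \<Phi> q' v' = \<Phi> q v))"

section \<open>Plane projective curves\<close>

quotient_type complex_projective_plane =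
  "complex^3" / partial: "\<lambda>x y. x \<noteq> 0 \<and> y \<noteq> 0 \<and> (\<exists>c. c \<noteq> 0 \<and> y = c *s x)"
proof (intro part_equivpI sympI transpI)
  show "\<exists>x::complex^3. x \<noteq> 0 \<and> x \<noteq> 0 \<and> (\<exists>c. c \<noteq> 0 \<and> x = c *s x)"
    by (intro exI[of _ "axis 1 1"] conjI exI[of _ 1]) (simp_all add: axis_eq_0_iff)
next
  fix x y :: "complex^3"
  assume "x \<noteq> 0 \<and> y \<noteq> 0 \<and> (\<exists>c. c \<noteq> 0 \<and> y = c *s x)"
  then obtain c where "x \<noteq> 0" "y \<noteq> 0" "c \<noteq> 0" "y = c *s x" by blast
  then show "y \<noteq> 0 \<and> x \<noteq> 0 \<and> (\<exists>c. c \<noteq> 0 \<and> x = c *s y)"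
    by (intro conjI exI[of _ "inverse c"]) (simp_all add: vector_smult_assoc)
next
  fix x y z :: "complex^3"
  assume "x \<noteq> 0 \<and> y \<noteq> 0 \<and> (\<exists>c. c \<noteq> 0 \<and> y = c *s x)"
    and "y \<noteq> 0 \<and> z \<noteq> 0 \<and> (\<exists>c. c \<noteq> 0 \<and> z = c *s y)"
  then obtain c d where "x \<noteq> 0" "z \<noteq> 0" "c \<noteq> 0" "y = c *s x" "d \<noteq> 0" "z = d *s y" by blast
  then show "x \<noteq> 0 \<and> z \<noteq> 0 \<and> (\<exists>c. c \<noteq> 0 \<and> z = c *s x)"
    by (intro conjI exI[of _ "d * c"]) (simp_all add: vector_smult_assoc)
qed

text \<open>\<open>proj_point x\<close> is the point with homogeneous coordinates \<open>x\<close>; it is junk for \<open>x = 0\<close>.\<close>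

definition proj_point :: "complex^3 \<Rightarrow> complex_projective_plane" where
  "proj_point x = abs_complex_projective_plane x"

definition plane_embedding :: "real^2 \<Rightarrow> complex_projective_plane" where
  "plane_embedding p = proj_point (vector [of_real (p $ 1), of_real (p $ 2), 1])"

text \<open>Polynomials in three variables; a monomial \<open>3 \<Rightarrow>\<^sub>0 nat\<close> is its family of exponents.\<close>

type_synonym poly3 = "(3 \<Rightarrow>\<^sub>0 nat) \<Rightarrow>\<^sub>0 complex"

definition eval_poly3 :: "poly3 \<Rightarrow> complex^3 \<Rightarrow> complex" where
  "eval_poly3 F x =
     (\<Sum>m\<in>Poly_Mapping.keys F. Poly_Mapping.lookup F m * (\<Prod>i\<in>UNIV. (x $ i) ^ Poly_Mapping.lookup m i))"

definition homogeneous_poly3 :: "nat \<Rightarrow> poly3 \<Rightarrow> bool" where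
  "homogeneous_poly3 d F \<longleftrightarrow> (\<forall>m\<in>Poly_Mapping.keys F. (\<Sum>i\<in>UNIV. Poly_Mapping.lookup m i) = d)"

definition projective_zero_set :: "poly3 \<Rightarrow> complex_projective_plane set" where
  "projective_zero_set F = {proj_point x | x. x \<noteq> 0 \<and> eval_poly3 F x = 0}"

definition irreducible_projective_curve :: "complex_projective_plane set \<Rightarrow> bool" where
  "irreducible_projective_curve C \<longleftrightarrow>
     (\<exists>d F. homogeneous_poly3 d F \<and> irreducible F \<and> C = projective_zero_set F)"

definition real_oval :: "complex_projective_plane set \<Rightarrow> (real \<Rightarrow> real^2) \<Rightarrow> bool" where
  "real_oval C \<alpha> \<longleftrightarrow>
     smooth_simple_closed_curve \<alpha> \<and> plane_embedding ` path_image \<alpha> \<subseteq> C"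

lemma proj_point_eq_iff:
  assumes "x \<noteq> 0" "y \<noteq> 0"
  shows "proj_point x = proj_point y \<longleftrightarrow> (\<exists>c. c \<noteq> 0 \<and> y = c *s x)"
proof -
  have refl: "z \<noteq> 0 \<and> z \<noteq> 0 \<and> (\<exists>c. c \<noteq> 0 \<and> z = c *s z)" if "z \<noteq> 0" for z :: "complex^3"
    using that by (intro conjI exI[of _ 1]) simp_all
  show ?thesis
    using Quotient3_rel[OF Quotient3_complex_projective_plane, of x y]
      refl[OF assms(1)] refl[OF assms(2)] assms
    unfolding proj_point_def by blast
qed

lemma eval_poly3_scale:
  assumes "homogeneous_poly3 d F"
  shows "eval_poly3 F (c *s x) = c ^ d * eval_poly3 F x"
  unfolding eval_poly3_def sum_distrib_left
proof (rule sum.cong[OF refl])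
  fix m assume "m \<in> Poly_Mapping.keys F"
  then have "(\<Prod>i\<in>UNIV. c ^ Poly_Mapping.lookup m i) = c ^ d"
    using assms by (simp add: homogeneous_poly3_def flip: power_sum)
  then show "Poly_Mapping.lookup F m * (\<Prod>i\<in>UNIV. ((c *s x) $ i) ^ Poly_Mapping.lookup m i) =
      c ^ d * (Poly_Mapping.lookup F m * (\<Prod>i\<in>UNIV. (x $ i) ^ Poly_Mapping.lookup m i))"
    by (simp add: power_mult_distrib prod.distrib)
qed

lemma proj_point_in_zero_set_iff:
  assumes "homogeneous_poly3 d F" "x \<noteq> 0"
  shows "proj_point x \<in> projective_zero_set F \<longleftrightarrow> eval_poly3 F x = 0"
proof
  assume "proj_point x \<in> projective_zero_set F"
  then obtain y where y: "proj_point x = proj_point y" "y \<noteq> 0" "eval_poly3 F y = 0"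
    unfolding projective_zero_set_def by blast
  then obtain c where "c \<noteq> 0" "y = c *s x"
    using proj_point_eq_iff[OF assms(2) y(2)] by blast
  with y show "eval_poly3 F x = 0"
    using eval_poly3_scale[OF assms(1), of c x] by simp
qed (use assms in \<open>auto simp: projective_zero_set_def\<close>)

end

theory Submission
  imports Defs "HOL-Computational_Algebra.Polynomial_Factorial" "HOL-Computational_Algebra.Field_as_Ring"
begin

text \<open>
  An integral that is polynomial in the velocity is a polynomial function of the line of motion. In
  the coordinates \<open>(m, b)\<close> of the line \<open>y = m x + b\<close> it becomes, after symmetrization in \<open>v\<close>,
  \<open>e (m, b) / (1 + m\<^sup>2) ^ N\<close> with \<open>e\<close> a polynomial, and the reflection law says that on the pencil of
  a point of \<open>\<gamma>\<close> it is even about the tangent. Evenness to first order makes it constant along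
  the dual curve, so \<open>E = e - c (1 + m\<^sup>2) ^ N\<close> factors as \<open>f ^ k g\<close> with \<open>f = 0\<close> an irreducible equation
  of the dual curve. Evenness to third order shows that
  \<open>g\<^sup>3 H ^ k (1 + m\<^sup>2) ^ (3 k - 3 N)\<close> is a nonzero constant on the dual curve, where
  \<open>H = f_mm f_b\<^sup>2 - 2 f_mb f_m f_b + f_bb f_m\<^sup>2\<close>. Hence \<open>H\<close> has no zero on \<open>f = 0\<close>, and so \<open>f = 0\<close> has
  no real singular point.

  By irreducibility of the curve the tangent lines of all its real ovals satisfy \<open>f = 0\<close>. Near a
  common tangent line \<open>f = 0\<close> is a smooth arc, which both ovals have as dual arc: the points of
  tangency coincide, and neighbouring tangent lines are again common. The set of parameters with a
  common tangent line is thus open and closed, and the two ovals coincide.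
\<close>

section \<open>Polynomials in two and three variables\<close>

text \<open>The billiard law holds only at tangents of \<open>\<gamma>\<close>, while the two ovals
  may lie far from it. The bridge is divisibility: constancy of
  \<open>g^3 H^k (1 + m^2)^(3k - 3N)\<close> along one arc is a congruence modulo \<open>f\<close>,
  hence it persists at every real zero of \<open>f\<close>, whichever oval that line touches.
  Reality matters exactly there, since \<open>1 + m^2\<close> has no real zero. The exponents are
  not guessed: divided by \<open>g\<close> and by the second derivative of \<open>f\<close> along
  the pencil, the third order relation becomes a logarithmic derivative with coefficients
  \<open>3\<close> and \<open>k\<close>.

  Passing to unoriented lines could destroy the integral. Two symmetrizations are therefore kept in
  play, \<open>\<Phi>(v) + \<Phi>(-v)\<close> and \<open>(\<Phi>(v) - \<Phi>(-v))^2\<close>, of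
  which at least one remains nonconstant.

  The coordinates \<open>(m, b)\<close> miss the vertical lines. Every construction is made for an
  arbitrary order \<open>(i, j)\<close> of the two coordinates, and the order is chosen anew at each
  common tangent; the polynomial \<open>f\<close> may then change, but the conclusion drawn from it
  is local.\<close>

definition bieval :: "'a::comm_ring_1 poly poly \<Rightarrow> 'a \<Rightarrow> 'a \<Rightarrow> 'a" where
  "bieval p x y = poly (poly p [:y:]) x"

lemma bieval_simps [simp]:
  "bieval 0 x y = 0" "bieval 1 x y = 1"
  "bieval (p + q) x y = bieval p x y + bieval q x y"
  "bieval (p - q) x y = bieval p x y - bieval q x y"
  "bieval (- p) x y = - bieval p x y"
  "bieval (p * q) x y = bieval p x y * bieval q x y"
  "bieval (p ^ n) x y = bieval p x y ^ n"
  "bieval (pCons c p) x y = poly c x + y * bieval p x y"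
  by (simp_all add: bieval_def)

text \<open>A substitute for the resultant. Take \<open>d\<close> of minimal degree among the
  nonzero elements of the ideal of \<open>p\<close> and \<open>q\<close>; pseudo-division makes it
  divide a scalar multiple of every element. If \<open>d\<close> is not a scalar, primality of
  \<open>p\<close> turns \<open>d dvd a p\<close> into \<open>p dvd d\<close>, and then
  \<open>p\<close> divides a scalar multiple of \<open>q\<close>, hence \<open>q\<close>.\<close>

lemma elimination:
  fixes p q :: "'a::{factorial_ring_gcd,semiring_gcd_mult_normalize} poly"
  assumes irr: "irreducible p" and ndvd: "\<not> p dvd q"
  obtains u v r where "r \<noteq> 0" "u * p + v * q = [:r:]"
proof (cases "degree p = 0")
  case True
  then obtain a where a: "p = [:a:]" by (metis degree_eq_zeroE)
  with irr have "a \<noteq> 0" by (auto simp: irreducible_def)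
  then show thesis using that[of a 1 0] a by simp
next
  case False
  have prime: "prime_elem p" using irr by (simp add: irreducible_imp_prime_elem)
  define I where "I = {d. d \<noteq> 0 \<and> (\<exists>u v. d = u * p + v * q)}"
  have "p = 1 * p + 0 * q" by simp
  then have "p \<in> I" using irr unfolding I_def irreducible_def by blast
  then obtain d where d: "d \<in> I" and dmin: "\<And>e. e \<in> I \<Longrightarrow> degree d \<le> degree e"
    using ex_has_least_nat[of "\<lambda>d. d \<in> I" p degree] by blast
  then obtain u v where uv: "d = u * p + v * q" and d0: "d \<noteq> 0" by (auto simp: I_def)
  have div: "\<exists>a k. a \<noteq> 0 \<and> smult a f = d * k" if f: "\<exists>u v. f = u * p + v * q" for f
  proof -
    obtain a k where ak: "a \<noteq> 0" "smult a f = d * k + pseudo_mod f d"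
      using pseudo_mod(1)[OF d0, of f] by blast
    obtain u' v' where f: "f = u' * p + v' * q" using f by blast
    have "pseudo_mod f d = smult a f - d * k" using ak by simp
    also have "\<dots> = (smult a u' - u * k) * p + (smult a v' - v * k) * q"
      by (simp add: f uv algebra_simps smult_add_right)
    finally have "pseudo_mod f d = 0 \<or> pseudo_mod f d \<in> I" by (auto simp: I_def)
    with pseudo_mod(2)[OF d0, of f] dmin[of "pseudo_mod f d"] have "pseudo_mod f d = 0" by auto
    with ak show ?thesis by auto
  qed
  have ndvd_const: "\<not> p dvd [:a:]" if "a \<noteq> 0" for a
    using False that dvd_imp_degree_le[of p "[:a:]"] by auto
  show thesis
  proof (cases "degree d = 0")
    case True
    then obtain r where "d = [:r:]" by (metis degree_eq_zeroE)
    then show thesis using that[of r u v] uv d0 by auto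
  next
    case ddeg: False
    have "\<not> d dvd [:a:]" if "a \<noteq> 0" for a
      using ddeg that dvd_imp_degree_le[of d "[:a:]"] by auto
    obtain a k where ak: "a \<noteq> 0" "smult a p = d * k"
      using div[of p] by (metis add.right_neutral mult_1 mult_zero_left)
    have "p dvd d * k" by (metis ak(2) dvd_smult dvd_refl)
    then have "p dvd d \<or> p dvd k" using prime by (simp add: prime_elem_dvd_mult_iff)
    then have pd: "p dvd d"
    proof
      assume "p dvd k"
      then obtain k' where "k = p * k'" by blast
      with ak have "p * [:a:] = p * (d * k')" by (simp add: algebra_simps)
      with irr have "[:a:] = d * k'" by (metis mult_left_cancel irreducible_def)
      with \<open>a \<noteq> 0\<close> \<open>\<And>a. a \<noteq> 0 \<Longrightarrow> \<not> d dvd [:a:]\<close> show ?thesis by (metis dvd_triv_left)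
    qed
    obtain b l where bl: "b \<noteq> 0" "smult b q = d * l"
      using div[of q] by (metis add_0 mult_1 mult_zero_left)
    have "p dvd [:b:] * q" using pd bl by (simp add: dvd_mult2)
    then have False using prime_elem_dvd_multD[OF prime] ndvd ndvd_const[OF \<open>b \<noteq> 0\<close>] by blast
    then show thesis ..
  qed
qed

lemma bieval_eq_0_imp:
  fixes p :: "'a::idom poly poly"
  assumes "infinite Y" and "\<And>y. y \<in> Y \<Longrightarrow> infinite {x. bieval p x y = 0}"
  shows "p = 0"
proof (rule ccontr)
  assume "p \<noteq> 0"
  have "poly p [:y:] = 0" if "y \<in> Y" for y
    using assms(2)[OF that] poly_roots_finite[of "poly p [:y:]"] by (auto simp: bieval_def)
  then have "(\<lambda>y. [:y:]) ` Y \<subseteq> {z. poly p z = 0}" by auto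
  then have "finite ((\<lambda>y. [:y:]) ` Y)" using poly_roots_finite[OF \<open>p \<noteq> 0\<close>] finite_subset by blast
  then have "finite Y" by (rule finite_imageD) (auto simp: inj_on_def)
  with assms(1) show False by simp
qed

section \<open>Recognizing polynomial functions from their expressions\<close>

definition subalg :: "('b \<Rightarrow> 'a::comm_ring_1) set \<Rightarrow> bool" where
  "subalg A \<longleftrightarrow> (\<forall>c. (\<lambda>_. c) \<in> A) \<and>
     (\<forall>f\<in>A. \<forall>g\<in>A. (\<lambda>z. f z + g z) \<in> A \<and> (\<lambda>z. f z * g z) \<in> A)"

lemma subalg_const: "subalg A \<Longrightarrow> (\<lambda>_. c) \<in> A"
  and subalg_add: "subalg A \<Longrightarrow> f \<in> A \<Longrightarrow> g \<in> A \<Longrightarrow> (\<lambda>z. f z + g z) \<in> A"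
  and subalg_mult: "subalg A \<Longrightarrow> f \<in> A \<Longrightarrow> g \<in> A \<Longrightarrow> (\<lambda>z. f z * g z) \<in> A"
  by (auto simp: subalg_def)

lemma subalg_diff: "subalg A \<Longrightarrow> f \<in> A \<Longrightarrow> g \<in> A \<Longrightarrow> (\<lambda>z. f z - g z) \<in> A"
  using subalg_add[of A f "\<lambda>z. -1 * g z"] subalg_mult[of A "\<lambda>_. -1" g] subalg_const[of A "-1"] by simp

lemma subalg_power: "subalg A \<Longrightarrow> f \<in> A \<Longrightarrow> (\<lambda>z. f z ^ n) \<in> A"
  by (induction n) (auto intro: subalg_const subalg_mult)

lemma subalg_sum: "subalg A \<Longrightarrow> (\<And>k. k \<in> K \<Longrightarrow> f k \<in> A) \<Longrightarrow> (\<lambda>z. \<Sum>k\<in>K. f k z) \<in> A"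
  by (induction K rule: infinite_finite_induct) (auto intro: subalg_const subalg_add)

lemma subalg_prod: "subalg A \<Longrightarrow> (\<And>k. k \<in> K \<Longrightarrow> f k \<in> A) \<Longrightarrow> (\<lambda>z. \<Prod>k\<in>K. f k z) \<in> A"
  by (induction K rule: infinite_finite_induct) (auto intro: subalg_const subalg_mult)

lemma subalg_poly: "subalg A \<Longrightarrow> f \<in> A \<Longrightarrow> (\<lambda>z. poly p (f z)) \<in> A"
  by (induction p) (auto intro: subalg_const subalg_mult subalg_add)

lemma subalg_bieval: "subalg A \<Longrightarrow> f \<in> A \<Longrightarrow> g \<in> A \<Longrightarrow> (\<lambda>z. bieval p (f z) (g z)) \<in> A"
  by (induction p) (auto intro: subalg_const subalg_mult subalg_add subalg_poly)

lemmas subalg_intros = subalg_const subalg_add subalg_mult subalg_diff subalg_power subalg_sum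
  subalg_prod subalg_poly subalg_bieval

text \<open>Clears denominators after the substitution of \<open>u / w\<close> and
  \<open>v / w\<close>, without naming the resulting polynomial. It serves to homogenize an affine
  equation, and to turn a relation between slope and intercept into one between points.\<close>

lemma subalg_homogenize:
  fixes A :: "('b \<Rightarrow> 'a::field) set"
  assumes A: "subalg A" and uvw: "u \<in> A" "v \<in> A" "w \<in> A"
  shows "\<exists>d. \<exists>h\<in>A. \<forall>z. w z \<noteq> 0 \<longrightarrow> h z = w z ^ d * bieval p (u z / w z) (v z / w z)"
proof (induction p)
  case 0
  show ?case using subalg_const[OF A, of 0] by auto
next
  case (pCons c p)
  have "\<exists>d. \<exists>h\<in>A. \<forall>z. w z \<noteq> 0 \<longrightarrow> h z = w z ^ d * poly c (u z / w z)"
  proof (induction c)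
    case 0
    show ?case using subalg_const[OF A, of 0] by auto
  next
    case (pCons a c)
    then obtain d h where h: "h \<in> A" "\<And>z. w z \<noteq> 0 \<Longrightarrow> h z = w z ^ d * poly c (u z / w z)" by blast
    have "(\<lambda>z. w z ^ Suc d * a + u z * h z) \<in> A" using A h uvw by (auto intro!: subalg_intros simp del: power_Suc)
    then show ?case using h
      by (intro exI[of _ "Suc d"] bexI[of _ "\<lambda>z. w z ^ Suc d * a + u z * h z"])
         (auto simp: field_simps)
  qed
  then obtain d h where h: "h \<in> A" "\<And>z. w z \<noteq> 0 \<Longrightarrow> h z = w z ^ d * poly c (u z / w z)" by blast
  obtain d' h' where h': "h' \<in> A" "\<And>z. w z \<noteq> 0 \<Longrightarrow> h' z = w z ^ d' * bieval p (u z / w z) (v z / w z)"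
    using pCons by blast
  have "(\<lambda>z. w z ^ Suc d' * h z + w z ^ d * (v z * h' z)) \<in> A"
    using A h h' uvw by (auto intro!: subalg_intros simp del: power_Suc)
  then show ?case using h h'
    by (intro exI[of _ "Suc d' + d"] bexI[of _ "\<lambda>z. w z ^ Suc d' * h z + w z ^ d * (v z * h' z)"])
       (auto simp: field_simps power_add)
qed

definition bipolys :: "('a::comm_ring_1 \<times> 'a \<Rightarrow> 'a) set" where
  "bipolys = {h. \<exists>p. \<forall>x y. h (x, y) = bieval p x y}"

lemma subalg_bipolys: "subalg bipolys"
  unfolding subalg_def bipolys_def
  apply (intro conjI ballI allI; clarsimp)
  subgoal for c by (rule exI[of _ "[:[:c:]:]"]) simp
  subgoal for f g p q by (rule exI[of _ "p + q"]) simp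
  subgoal for f g p q by (rule exI[of _ "p * q"]) simp
  done

lemma bipolys_fst: "fst \<in> bipolys" and bipolys_snd: "snd \<in> bipolys"
  unfolding bipolys_def
  by (clarsimp, rule exI[of _ "[:[:0,1:]:]"], simp) (clarsimp, rule exI[of _ "[:0,1:]"], simp)

lemma bipolysE:
  assumes "h \<in> bipolys" obtains p where "\<And>x y. h (x, y) = bieval p x y"
  using assms by (auto simp: bipolys_def)

text \<open>The third argument belongs to the outermost variable, which is the one that
  \<open>elimination\<close> removes.\<close>

definition trieval :: "'a::comm_ring_1 poly poly poly \<Rightarrow> 'a \<Rightarrow> 'a \<Rightarrow> 'a \<Rightarrow> 'a" where
  "trieval p x y z = bieval (poly p [:[:z:]:]) x y"

lemma trieval_simps [simp]:
  "trieval 0 x y z = 0" "trieval 1 x y z = 1"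
  "trieval (p + q) x y z = trieval p x y z + trieval q x y z"
  "trieval (p * q) x y z = trieval p x y z * trieval q x y z"
  "trieval (pCons c p) x y z = bieval c x y + z * trieval p x y z"
  by (simp_all add: trieval_def) (simp add: bieval_def)

definition tripolys :: "('a::comm_ring_1 \<times> 'a \<times> 'a \<Rightarrow> 'a) set" where
  "tripolys = {h. \<exists>p. \<forall>x y z. h (x, y, z) = trieval p x y z}"

lemma subalg_tripolys: "subalg tripolys"
  unfolding subalg_def tripolys_def
  apply (intro conjI ballI allI; clarsimp)
  subgoal for c by (rule exI[of _ "[:[:[:c:]:]:]"]) simp
  subgoal for f g p q by (rule exI[of _ "p + q"]) simp
  subgoal for f g p q by (rule exI[of _ "p * q"]) simp
  done

lemma tripolys_coords:
  "(\<lambda>(x, y, z). x) \<in> tripolys" "(\<lambda>(x, y, z). y) \<in> tripolys" "(\<lambda>(x, y, z). z) \<in> tripolys"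
  unfolding tripolys_def
    apply (auto intro!: exI[of _ "[:[:[:0,1:]:]:]"])[1]
   apply (auto intro!: exI[of _ "[:[:0,1:]:]"])[1]
  apply (auto intro!: exI[of _ "[:0,1:]"])[1]
  done

section \<open>Irreducible projective curves\<close>

lemma eval_poly3_superset:
  assumes "finite S" "Poly_Mapping.keys F \<subseteq> S"
  shows "eval_poly3 F x =
     (\<Sum>m\<in>S. Poly_Mapping.lookup F m * (\<Prod>i\<in>UNIV. (x $ i) ^ Poly_Mapping.lookup m i))"
  unfolding eval_poly3_def
  by (rule sum.mono_neutral_left) (use assms in \<open>auto simp: not_in_keys_iff_lookup_eq_zero\<close>)

lemma eval_poly3_0 [simp]: "eval_poly3 0 x = 0"
  by (simp add: eval_poly3_def)

lemma eval_poly3_add [simp]: "eval_poly3 (F + G) x = eval_poly3 F x + eval_poly3 G x"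
proof -
  let ?S = "Poly_Mapping.keys F \<union> Poly_Mapping.keys G"
  have S: "finite ?S" by simp
  show ?thesis
    unfolding eval_poly3_superset[OF S Poly_Mapping.keys_add] eval_poly3_superset[OF S Un_upper1]
      eval_poly3_superset[OF S Un_upper2]
    by (simp add: lookup_add algebra_simps sum.distrib)
qed

lemma eval_poly3_sum [simp]: "eval_poly3 (\<Sum>k\<in>K. f k) x = (\<Sum>k\<in>K. eval_poly3 (f k) x)"
  by (induction K rule: infinite_finite_induct) auto

lemma eval_poly3_single:
  "eval_poly3 (Poly_Mapping.single m c) x = c * (\<Prod>i\<in>UNIV. (x $ i) ^ Poly_Mapping.lookup m i)"
  by (subst eval_poly3_superset[of "{m}"]) auto

lemma poly_mapping_eq_sum_single:
  "F = (\<Sum>m\<in>Poly_Mapping.keys F. Poly_Mapping.single m (Poly_Mapping.lookup F m))"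
proof (rule poly_mapping_eqI)
  fix k
  show "Poly_Mapping.lookup F k =
    Poly_Mapping.lookup (\<Sum>m\<in>Poly_Mapping.keys F. Poly_Mapping.single m (Poly_Mapping.lookup F m)) k"
    by (cases "k \<in> Poly_Mapping.keys F")
       (auto simp: lookup_sum lookup_single when_def not_in_keys_iff_lookup_eq_zero)
qed

lemma eval_poly3_mult [simp]: "eval_poly3 (F * G) x = eval_poly3 F x * eval_poly3 G x"
proof -
  have single: "eval_poly3 (Poly_Mapping.single m c * Poly_Mapping.single n d) x =
      eval_poly3 (Poly_Mapping.single m c) x * eval_poly3 (Poly_Mapping.single n d) x" for m n c d
    by (simp add: mult_single eval_poly3_single lookup_add power_add prod.distrib)
  define f where "f m = Poly_Mapping.single m (Poly_Mapping.lookup F m)" for m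
  define g where "g m = Poly_Mapping.single m (Poly_Mapping.lookup G m)" for m
  have fg: "F = sum f (Poly_Mapping.keys F)" "G = sum g (Poly_Mapping.keys G)"
    unfolding f_def g_def by (rule poly_mapping_eq_sum_single)+
  have "eval_poly3 (sum f A * sum g B) x = eval_poly3 (sum f A) x * eval_poly3 (sum g B) x" for A B
    by (simp add: sum_product) (simp add: f_def g_def single)
  then show ?thesis using fg by metis
qed

section \<open>Homogeneous coordinates and nested polynomials\<close>

definition poly_hom :: "('a::comm_ring_1 \<Rightarrow> 'b::comm_ring_1) \<Rightarrow> 'b \<Rightarrow> 'a poly \<Rightarrow> 'b" where
  "poly_hom \<phi> X p = poly (map_poly \<phi> p) X"

definition is_ring_hom :: "('a::comm_ring_1 \<Rightarrow> 'b::comm_ring_1) \<Rightarrow> bool" where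
  "is_ring_hom \<phi> \<longleftrightarrow> \<phi> 0 = 0 \<and> \<phi> 1 = 1 \<and> (\<forall>a b. \<phi> (a + b) = \<phi> a + \<phi> b \<and> \<phi> (a * b) = \<phi> a * \<phi> b)"

lemma poly_hom_0 [simp]: "poly_hom \<phi> X 0 = 0"
  by (simp add: poly_hom_def)

lemma poly_hom_pCons: "\<phi> 0 = 0 \<Longrightarrow> poly_hom \<phi> X (pCons a p) = \<phi> a + X * poly_hom \<phi> X p"
  by (simp add: poly_hom_def map_poly_pCons)

lemma is_ring_hom_poly_hom:
  assumes "is_ring_hom \<phi>"
  shows "is_ring_hom (poly_hom \<phi> X)"
proof -
  note h = assms[unfolded is_ring_hom_def]
  have p: "poly_hom \<phi> X (pCons a p) = \<phi> a + X * poly_hom \<phi> X p" for a p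
    using h by (simp add: poly_hom_pCons)
  have add: "poly_hom \<phi> X (p + q) = poly_hom \<phi> X p + poly_hom \<phi> X q" for p q
  proof (induction p arbitrary: q)
    case (pCons a p)
    note IH = pCons.IH
    show ?case
    proof (cases q)
      case (pCons b q')
      then show ?thesis using h by (simp add: p IH) (simp add: algebra_simps)
    qed
  qed auto
  have smult: "poly_hom \<phi> X (smult a q) = \<phi> a * poly_hom \<phi> X q" for a q
    by (induction q) (use h in \<open>auto simp: p algebra_simps\<close>)
  have mult: "poly_hom \<phi> X (p * q) = poly_hom \<phi> X p * poly_hom \<phi> X q" for p q
    by (induction p) (use h in \<open>auto simp: p add smult algebra_simps\<close>)
  have "poly_hom \<phi> X 1 = 1" using h p[of 1 0] by (simp add: one_pCons)
  with add mult show ?thesis by (simp add: is_ring_hom_def)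
qed

definition poly3_var :: "3 \<Rightarrow> poly3" where
  "poly3_var i = Poly_Mapping.single (Poly_Mapping.single i 1) 1"

text \<open>The order of \<open>a\<close>, \<open>b\<close>, \<open>c\<close> decides which
  homogeneous coordinate becomes the outermost variable; each of the two affine coordinates will be
  eliminated in turn.\<close>

definition to_poly3 :: "3 \<Rightarrow> 3 \<Rightarrow> 3 \<Rightarrow> complex poly poly poly \<Rightarrow> poly3" where
  "to_poly3 a b c = poly_hom (poly_hom (poly_hom (Poly_Mapping.single 0) (poly3_var a)) (poly3_var b)) (poly3_var c)"

lemma is_ring_hom_single0: "is_ring_hom (Poly_Mapping.single 0 :: complex \<Rightarrow> poly3)"
  by (simp add: is_ring_hom_def single_add mult_single single_one)

lemma is_ring_hom_to_poly3: "is_ring_hom (to_poly3 a b c)"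
  unfolding to_poly3_def by (intro is_ring_hom_poly_hom is_ring_hom_single0)

lemma eval_poly3_var: "eval_poly3 (poly3_var i) x = x $ i"
proof -
  have "(\<Prod>j\<in>UNIV. (x $ j) ^ Poly_Mapping.lookup (Poly_Mapping.single i 1) j) =
      (\<Prod>j\<in>UNIV. if j = i then x $ i else 1)"
    by (rule prod.cong) (auto simp: lookup_single when_def)
  then show ?thesis by (simp add: poly3_var_def eval_poly3_single)
qed

lemma eval_to_poly3: "eval_poly3 (to_poly3 a b c p) x = trieval p (x $ a) (x $ b) (x $ c)"
proof -
  have 0: "eval_poly3 (Poly_Mapping.single 0 k) x = k" for k
    by (simp add: eval_poly3_single)
  have 1: "eval_poly3 (poly_hom (Poly_Mapping.single 0) (poly3_var a) r) x = poly r (x $ a)" for r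
    by (induction r) (auto simp: poly_hom_pCons 0 eval_poly3_var)
  have 2: "eval_poly3 (poly_hom (poly_hom (Poly_Mapping.single 0) (poly3_var a)) (poly3_var b) q) x
      = bieval q (x $ a) (x $ b)" for q
    by (induction q) (auto simp: poly_hom_pCons 1 eval_poly3_var)
  show ?thesis
    unfolding to_poly3_def
    by (induction p) (auto simp: poly_hom_pCons 2 eval_poly3_var)
qed

lemma trieval_eq_0_imp:
  fixes p :: "complex poly poly poly"
  assumes "\<And>x y z. trieval p x y z = 0"
  shows "p = 0"
proof (rule ccontr)
  assume "p \<noteq> 0"
  have "poly p [:[:z:]:] = 0" for z
    by (rule bieval_eq_0_imp[of UNIV])
       (use assms in \<open>auto simp: trieval_def infinite_UNIV_char_0\<close>)
  then have "range (\<lambda>z. [:[:z:]:]) \<subseteq> {t. poly p t = 0}" by auto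
  then have "finite (range (\<lambda>z::complex. [:[:z:]:]))"
    using poly_roots_finite[OF \<open>p \<noteq> 0\<close>] finite_subset by blast
  then have "finite (UNIV :: complex set)" by (rule finite_imageD) (auto simp: inj_on_def)
  then show False by (simp add: infinite_UNIV_char_0)
qed

text \<open>Injective because a polynomial over an infinite field is determined by its values,
  surjective because every monomial is reached. This carries irreducibility over to nested
  polynomials, where \<open>elimination\<close> applies.\<close>

lemma to_poly3_bij:
  assumes "distinct [a, b, c]" and abc: "UNIV = {a, b, c}"
  shows "bij (to_poly3 a b c)"
proof (rule bijI)
  note h = is_ring_hom_to_poly3[of a b c, unfolded is_ring_hom_def]
  have ne: "b \<noteq> a" "c \<noteq> a" "c \<noteq> b" "a \<noteq> b" "a \<noteq> c" "b \<noteq> c" using assms(1) by auto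
  show "inj (to_poly3 a b c)"
  proof (rule injI)
    fix p q assume eq: "to_poly3 a b c p = to_poly3 a b c q"
    have "trieval p u v w = trieval q u v w" for u v w
      using eval_to_poly3[of a b c p "\<chi> i. if i = a then u else if i = b then v else w"]
        eval_to_poly3[of a b c q "\<chi> i. if i = a then u else if i = b then v else w"] eq ne
      by simp
    then have "trieval (p - q) u v w = 0" for u v w
      by (simp add: trieval_def)
    then have "p - q = 0" by (rule trieval_eq_0_imp)
    then show "p = q" by simp
  qed
  have sum: "(\<Sum>k\<in>K. f k) \<in> range (to_poly3 a b c)"
    if "\<And>k. k \<in> K \<Longrightarrow> f k \<in> range (to_poly3 a b c)" for K :: "'k set" and f
    using that
  proof (induction K rule: infinite_finite_induct)
    case (insert k K)
    obtain p where p: "f k = to_poly3 a b c p" using insert.prems[of k] by blast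
    obtain q where q: "sum f K = to_poly3 a b c q" using insert by blast
    have "sum f (insert k K) = f k + sum f K" using insert.hyps by simp
    also have "\<dots> = to_poly3 a b c (p + q)" unfolding p q using h by metis
    finally show ?case by (metis rangeI)
  next
    case empty
    have "sum f {} = to_poly3 a b c 0" using h by simp
    then show ?case by (metis rangeI)
  next
    case (infinite K)
    then have "sum f K = to_poly3 a b c 0" using h by simp
    then show ?case by (metis rangeI)
  qed
  have pow: "poly3_var i ^ n = Poly_Mapping.single (Poly_Mapping.single i n) 1" for i n
    by (induction n) (auto simp: poly3_var_def mult_single simp flip: single_add)
  have hc: "to_poly3 a b c [:[:[:k:]:]:] = Poly_Mapping.single 0 k"
    "to_poly3 a b c [:[:[:0,1:]:]:] = poly3_var a"
    "to_poly3 a b c [:[:0,1:]:] = poly3_var b" "to_poly3 a b c [:0,1:] = poly3_var c" for k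
    by (simp_all add: to_poly3_def poly_hom_pCons one_pCons)
  have hp: "to_poly3 a b c (p ^ n) = to_poly3 a b c p ^ n" for p n
    by (induction n) (use h in auto)
  have single: "Poly_Mapping.single m k \<in> range (to_poly3 a b c)" for m k
  proof -
    have m: "m = Poly_Mapping.single a (Poly_Mapping.lookup m a) + (Poly_Mapping.single b (Poly_Mapping.lookup m b)
        + Poly_Mapping.single c (Poly_Mapping.lookup m c))"
    proof (rule poly_mapping_eqI)
      fix i
      have "i = a \<or> i = b \<or> i = c" using abc by auto
      then show "Poly_Mapping.lookup m i = Poly_Mapping.lookup (Poly_Mapping.single a (Poly_Mapping.lookup m a)
        + (Poly_Mapping.single b (Poly_Mapping.lookup m b) + Poly_Mapping.single c (Poly_Mapping.lookup m c))) i"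
        using ne by (auto simp: lookup_add lookup_single when_def)
    qed
    have "to_poly3 a b c ([:[:[:k:]:]:] * ([:[:[:0,1:]:]:] ^ Poly_Mapping.lookup m a *
        ([:[:0,1:]:] ^ Poly_Mapping.lookup m b * [:0,1:] ^ Poly_Mapping.lookup m c)))
      = Poly_Mapping.single 0 k * (poly3_var a ^ Poly_Mapping.lookup m a *
         (poly3_var b ^ Poly_Mapping.lookup m b * poly3_var c ^ Poly_Mapping.lookup m c))"
      using h by (simp only: hp hc)
    also have "\<dots> = Poly_Mapping.single (Poly_Mapping.single a (Poly_Mapping.lookup m a) +
        (Poly_Mapping.single b (Poly_Mapping.lookup m b) + Poly_Mapping.single c (Poly_Mapping.lookup m c))) k"
      by (simp add: pow mult_single)
    also have "\<dots> = Poly_Mapping.single m k" by (simp only: m[symmetric])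
    finally show ?thesis by (metis rangeI)
  qed
  have "F \<in> range (to_poly3 a b c)" for F
    by (rule ssubst[where P = "\<lambda>G. G \<in> range (to_poly3 a b c)", OF poly_mapping_eq_sum_single[of F]])
       (rule sum, rule single)
  then show "surj (to_poly3 a b c)" by auto
qed

lemma irreducible_ring_iso:
  fixes \<phi> :: "'a::comm_ring_1 \<Rightarrow> 'b::comm_ring_1"
  assumes h: "is_ring_hom \<phi>" and b: "bij \<phi>" and irr: "irreducible (\<phi> p)"
  shows "irreducible p"
proof -
  note h = h[unfolded is_ring_hom_def]
  have unit: "u dvd 1" if "\<phi> u dvd 1" for u
  proof -
    from that obtain w where "\<phi> u * w = 1" by (metis dvdE)
    then have "\<phi> (u * inv \<phi> w) = \<phi> 1" using h b by (simp add: bij_is_surj surj_f_inv_f)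
    then have "u * inv \<phi> w = 1" using b by (metis bij_is_inj inv_f_f)
    then show ?thesis by (metis dvd_triv_left)
  qed
  have unit': "\<phi> u dvd 1" if "u dvd 1" for u
    using that h by (metis dvd_def)
  show ?thesis
  proof (rule irreducibleI)
    show "p \<noteq> 0" using irr h by (auto simp: irreducible_def)
    show "\<not> p dvd 1" using irr unit' by (auto simp: irreducible_def)
    fix u v assume "p = u * v"
    then have "\<phi> p = \<phi> u * \<phi> v" using h by simp
    then show "u dvd 1 \<or> v dvd 1" using irr unit by (auto simp: irreducible_def)
  qed
qed

text \<open>Eliminating the third variable leaves \<open>r \<noteq> 0\<close> in two variables with
  \<open>r (l y, l) = 0\<close> for all \<open>y\<close> in \<open>T\<close> and all
  \<open>l \<noteq> 0\<close>. The free scaling \<open>l\<close> supplies infinitely many second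
  coordinates, so an infinite \<open>T\<close> would force \<open>r = 0\<close>.\<close>

lemma finite_common_zero_directions:
  fixes p q :: "complex poly poly poly"
  assumes "irreducible p" "\<not> p dvd q"
    and T: "\<And>y l. y \<in> T \<Longrightarrow> l \<noteq> 0 \<Longrightarrow> \<exists>x. trieval p (l * y) l x = 0 \<and> trieval q (l * y) l x = 0"
  shows "finite T"
proof (rule ccontr)
  assume inf: "infinite T"
  obtain r u v where r: "r \<noteq> 0" "u * p + v * q = [:r:]"
    by (rule elimination[OF assms(1,2)])
  have *: "bieval r (l * y) l = 0" if y: "y \<in> T" and l: "l \<noteq> 0" for y l
  proof -
    obtain x where x: "trieval p (l * y) l x = 0" "trieval q (l * y) l x = 0"
      using T[OF y l] by blast
    have "trieval (u * p + v * q) (l * y) l x = 0" using x by simp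
    then show ?thesis unfolding r(2) by simp
  qed
  have "r = 0"
  proof (rule bieval_eq_0_imp[of "- {0}"])
    show "infinite (- {0::complex})" by (simp add: infinite_UNIV_char_0 Compl_eq_Diff_UNIV)
    fix l :: complex assume "l \<in> - {0}"
    then have "(\<lambda>y. l * y) ` T \<subseteq> {x. bieval r x l = 0}" "inj_on (\<lambda>y. l * y) T"
      using * by (auto simp: inj_on_def)
    then show "infinite {x. bieval r x l = 0}"
      using inf finite_imageD finite_subset by metis
  qed
  with r show False by simp
qed

text \<open>If \<open>F\<close> did not divide the homogenized \<open>Q\<close>, eliminating
  \<open>x\<close> would leave finitely many values of \<open>y\<close> at common zeros, and
  eliminating \<open>y\<close> finitely many values of \<open>x\<close>, so there would be finitely
  many common zeros. Divisibility in either arrangement of the variables gives the claim at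
  \<open>z = 1\<close>.\<close>

lemma irreducible_curve_zariski:
  assumes F: "homogeneous_poly3 d F" "irreducible F"
    and inf: "infinite {(x, y). eval_poly3 F (vector [x, y, 1]) = 0 \<and> bieval Q x y = 0}"
    and zero: "eval_poly3 F (vector [x0, y0, 1]) = 0"
  shows "bieval Q x0 y0 = 0"
proof -
  define S where "S = {(x, y). eval_poly3 F (vector [x, y, 1]) = 0 \<and> bieval Q x y = 0}"
  have abc: "distinct [2, 3, 1::3]" "UNIV = {2, 3, 1::3}" "distinct [1, 3, 2::3]" "UNIV = {1, 3, 2::3}"
    using UNIV_3 by auto
  obtain p where p: "to_poly3 2 3 1 p = F"
    using to_poly3_bij[OF abc(1,2)] by (metis bij_pointE)
  obtain p' where p': "to_poly3 1 3 2 p' = F"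
    using to_poly3_bij[OF abc(3,4)] by (metis bij_pointE)
  have irr: "irreducible p" "irreducible p'"
    using irreducible_ring_iso[OF is_ring_hom_to_poly3 to_poly3_bij[OF abc(1,2)], of p]
      irreducible_ring_iso[OF is_ring_hom_to_poly3 to_poly3_bij[OF abc(3,4)], of p'] p p' F by auto
  have ev: "trieval p y z x = eval_poly3 F (vector [x, y, z])"
     "trieval p' x z y = eval_poly3 F (vector [x, y, z])" for x y z
    using eval_to_poly3[of 2 3 1 p "vector [x, y, z]"] eval_to_poly3[of 1 3 2 p' "vector [x, y, z]"]
    by (simp_all add: p p')
  have scale: "eval_poly3 F (vector [l * x, l * y, l]) = 0"
    if "eval_poly3 F (vector [x, y, 1]) = 0" for x y l
  proof -
    have "vector [l * x, l * y, l] = l *s (vector [x, y, 1] :: complex^3)"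
      by (simp add: vec_eq_iff forall_3)
    then show ?thesis using eval_poly3_scale[OF F(1), of l "vector [x, y, 1]"] that by simp
  qed
  \<comment> \<open>\<open>q\<close> homogenizes \<open>Q\<close> with \<open>x\<close> as outermost
    variable; \<open>q'\<close> below does the same with \<open>y\<close> outermost.\<close>
  obtain e q where q: "\<And>x y z. z \<noteq> 0 \<Longrightarrow> trieval q y z x = z ^ e * bieval Q (x / z) (y / z)"
  proof -
    obtain e h where "h \<in> tripolys"
      and h: "\<And>t. (\<lambda>(y, z, x). z) t \<noteq> 0 \<Longrightarrow> h t = (\<lambda>(y, z, x). z) t ^ e *
        bieval Q ((\<lambda>(y, z, x). x) t / (\<lambda>(y, z, x). z) t) ((\<lambda>(y, z, x). y) t / (\<lambda>(y, z, x). z) t)"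
      using subalg_homogenize[OF subalg_tripolys tripolys_coords(3) tripolys_coords(1) tripolys_coords(2), of Q]
      by blast
    then obtain q where "\<And>y z x. h (y, z, x) = trieval q y z x" by (auto simp: tripolys_def)
    then show thesis using h[of "(y, z, x)" for y z x] that[of q e] by simp
  qed
  obtain e' q' where q': "\<And>x y z. z \<noteq> 0 \<Longrightarrow> trieval q' x z y = z ^ e' * bieval Q (x / z) (y / z)"
  proof -
    obtain e h where "h \<in> tripolys"
      and h: "\<And>t. (\<lambda>(x, z, y). z) t \<noteq> 0 \<Longrightarrow> h t = (\<lambda>(x, z, y). z) t ^ e *
        bieval Q ((\<lambda>(x, z, y). x) t / (\<lambda>(x, z, y). z) t) ((\<lambda>(x, z, y). y) t / (\<lambda>(x, z, y). z) t)"
      using subalg_homogenize[OF subalg_tripolys tripolys_coords(1) tripolys_coords(3) tripolys_coords(2), of Q]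
      by blast
    then obtain q where "\<And>x z y. h (x, z, y) = trieval q x z y" by (auto simp: tripolys_def)
    then show thesis using h[of "(x, z, y)" for x y z] that[of q e] by simp
  qed
  have "p dvd q \<or> p' dvd q'"
  proof (rule ccontr)
    assume n: "\<not> (p dvd q \<or> p' dvd q')"
    have "finite (snd ` S)"
    proof (rule finite_common_zero_directions[OF irr(1)])
      fix y l :: complex assume "y \<in> snd ` S" "l \<noteq> 0"
      then obtain x where "eval_poly3 F (vector [x, y, 1]) = 0" "bieval Q x y = 0" by (auto simp: S_def)
      then show "\<exists>x. trieval p (l * y) l x = 0 \<and> trieval q (l * y) l x = 0"
        using \<open>l \<noteq> 0\<close> scale q by (intro exI[of _ "l * x"]) (simp add: ev)
    qed (use n in simp)
    moreover have "finite (fst ` S)"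
    proof (rule finite_common_zero_directions[OF irr(2)])
      fix x l :: complex assume "x \<in> fst ` S" "l \<noteq> 0"
      then obtain y where "eval_poly3 F (vector [x, y, 1]) = 0" "bieval Q x y = 0" by (auto simp: S_def)
      then show "\<exists>y. trieval p' (l * x) l y = 0 \<and> trieval q' (l * x) l y = 0"
        using \<open>l \<noteq> 0\<close> scale q' by (intro exI[of _ "l * y"]) (simp add: ev)
    qed (use n in simp)
    moreover have "S \<subseteq> fst ` S \<times> snd ` S" by force
    ultimately have "finite S" by (meson finite_SigmaI finite_subset)
    with inf show False by (simp add: S_def)
  qed
  then show ?thesis
  proof
    assume "p dvd q"
    then have "trieval q y0 1 x0 = 0" using zero by (auto simp: ev elim!: dvdE)
    then show ?thesis using q by simp
  next
    assume "p' dvd q'"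
    then have "trieval q' x0 1 y0 = 0" using zero by (auto simp: ev elim!: dvdE)
    then show ?thesis using q' by simp
  qed
qed

text \<open>On nested polynomials \<open>pderiv\<close> differentiates in the outer, second
  variable; this is the partial derivative in the inner, first one.\<close>

definition dfst :: "'a::idom poly poly \<Rightarrow> 'a poly poly" where
  "dfst p = map_poly pderiv p"

lemma dfst_simps [simp]: "dfst 0 = 0" "dfst (pCons c p) = pCons (pderiv c) (dfst p)"
  by (simp_all add: dfst_def map_poly_pCons)

lemma bieval_pderiv_pCons: "bieval (pderiv (pCons c p)) x y = bieval p x y + y * bieval (pderiv p) x y"
  by (simp add: pderiv_pCons)

lemma DERIV_bieval:
  assumes "(u has_real_derivative u') (at t)" "(v has_real_derivative v') (at t)"
  shows "((\<lambda>t. bieval p (u t) (v t)) has_real_derivative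
     (bieval (dfst p) (u t) (v t) * u' + bieval (pderiv p) (u t) (v t) * v')) (at t)"
proof (induction p)
  case (pCons c p)
  have "((\<lambda>t. poly c (u t)) has_real_derivative poly (pderiv c) (u t) * u') (at t)"
    by (rule DERIV_chain'[OF assms(1) poly_DERIV])
  from DERIV_add[OF this DERIV_mult[OF assms(2) pCons.IH]]
  show ?case by (simp add: bieval_pderiv_pCons algebra_simps)
qed simp

lemma bipoly_Re_Im:
  fixes P :: "complex poly poly"
  obtains R I :: "real poly poly" where
    "\<And>x y. bieval P (of_real x) (of_real y) = Complex (bieval R x y) (bieval I x y)"
proof -
  have poly: "poly c (of_real x) = Complex (poly (map_poly Re c) x) (poly (map_poly Im c) x)" for c x
    by (induction c) (auto simp: map_poly_pCons complex_eq_iff)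
  have "bieval P (of_real x) (of_real y) =
     Complex (bieval (map_poly (map_poly Re) P) x y) (bieval (map_poly (map_poly Im) P) x y)" for x y
    by (induction P) (auto simp: map_poly_pCons complex_eq_iff poly)
  then show thesis by (rule that)
qed

lemma bipoly_of_real:
  fixes Q :: "real poly poly"
  obtains P :: "complex poly poly" where
    "\<And>x y. bieval P (of_real x) (of_real y) = of_real (bieval Q x y)"
proof -
  have poly: "poly (map_poly of_real c) (of_real x :: complex) = of_real (poly c x)" for c x
    by (induction c) (auto simp: map_poly_pCons)
  have "bieval (map_poly (map_poly of_real) Q) (of_real x :: complex) (of_real y) = of_real (bieval Q x y)" for x y
    by (induction Q) (auto simp: map_poly_pCons poly)
  then show thesis by (rule that)
qed

lemma bipoly_swap:
  obtains P where "\<And>x y. bieval P x y = bieval Q y x"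
proof -
  have "(\<lambda>z. bieval Q (snd z) (fst z)) \<in> bipolys"
    by (intro subalg_bieval subalg_bipolys bipolys_fst bipolys_snd)
  then show thesis by (rule bipolysE) (use that in auto)
qed

text \<open>The indices allow either order of the coordinates, so that tangents parallel to an axis
  can be treated after a swap.\<close>

definition real_points :: "complex_projective_plane set \<Rightarrow> 2 \<Rightarrow> 2 \<Rightarrow> (real \<times> real) set" where
  "real_points C i j = {(q $ i, q $ j) | q. plane_embedding q \<in> C}"

text \<open>What is used of irreducibility, in terms of real polynomials: an infinite intersection
  with an algebraic set is everything, and the set itself lies in a proper algebraic set.\<close>

definition zariski_irreducible :: "(real \<times> real) set \<Rightarrow> bool" where
  "zariski_irreducible Z \<longleftrightarrow>
     (\<forall>Q. infinite {z\<in>Z. bieval Q (fst z) (snd z) = 0} \<longrightarrow> (\<forall>z\<in>Z. bieval Q (fst z) (snd z) = 0)) \<and>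
     (\<exists>A. A \<noteq> 0 \<and> (\<forall>z\<in>Z. bieval A (fst z) (snd z) = 0))"

lemma plane_embedding_in_zero_set_iff:
  assumes "homogeneous_poly3 d F"
  shows "plane_embedding q \<in> projective_zero_set F \<longleftrightarrow>
    eval_poly3 F (vector [of_real (q $ 1), of_real (q $ 2), 1]) = 0"
proof -
  have "(vector [of_real (q $ 1), of_real (q $ 2), 1] :: complex^3) \<noteq> 0"
    by (auto simp: vec_eq_iff forall_3)
  then show ?thesis
    unfolding plane_embedding_def using proj_point_in_zero_set_iff[OF assms] by blast
qed

lemma zariski_irreducible_real_points:
  assumes C: "irreducible_projective_curve C" and ij: "i \<noteq> j"
  shows "zariski_irreducible (real_points C i j)"
proof -
  obtain d F where F: "homogeneous_poly3 d F" "irreducible F" and CF: "C = projective_zero_set F"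
    using C unfolding irreducible_projective_curve_def by blast
  define Z where "Z = {(x, y). eval_poly3 F (vector [x, y, 1]) = 0}"
  have cases: "i = 1 \<and> j = 2 \<or> i = 2 \<and> j = 1"
    using ij exhaust_2[of i] exhaust_2[of j] by auto
  have zar: "bieval Q x y = 0" if "infinite {z\<in>Z. bieval Q (fst z) (snd z) = 0}" "(x, y) \<in> Z" for Q x y
  proof (rule irreducible_curve_zariski[OF F])
    have "{z\<in>Z. bieval Q (fst z) (snd z) = 0} = {(x, y). eval_poly3 F (vector [x, y, 1]) = 0 \<and> bieval Q x y = 0}"
      by (auto simp: Z_def)
    then show "infinite {(x, y). eval_poly3 F (vector [x, y, 1]) = 0 \<and> bieval Q x y = 0}"
      using that by simp
  qed (use that in \<open>auto simp: Z_def\<close>)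
  have "distinct [1, 2, 3::3]" "UNIV = {1, 2, 3::3}" using UNIV_3 by auto
  then obtain p where p: "to_poly3 1 2 3 p = F"
    using to_poly3_bij by (metis bij_pointE)
  define Fb where "Fb = poly p [:[:1:]:]"
  have Fb: "bieval Fb x y = eval_poly3 F (vector [x, y, 1])" for x y
    using eval_to_poly3[of 1 2 3 p "vector [x, y, 1]"] by (simp add: p trieval_def Fb_def)
  \<comment> \<open>Otherwise every affine point would lie on the curve, and the infinitely many
    points with \<open>x = 0\<close> would force \<open>x = 0\<close> everywhere.\<close>
  have "Fb \<noteq> 0"
  proof
    assume "Fb = 0"
    then have Z: "Z = UNIV" using Fb by (auto simp: Z_def)
    have "range (\<lambda>y. (0::complex, y::complex)) \<subseteq> {z\<in>Z. bieval [:[:0, 1:]:] (fst z) (snd z) = 0}"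
      by (auto simp: Z)
    moreover have "infinite (range (\<lambda>y. (0::complex, y::complex)))"
      by (simp add: finite_image_iff inj_on_def infinite_UNIV_char_0)
    ultimately have "bieval [:[:0, 1:]:] 1 0 = (0::complex)"
      using zar[of "[:[:0, 1:]:]" 1 0] Z finite_subset by blast
    then show False by simp
  qed
  have emb: "plane_embedding q \<in> C \<longleftrightarrow> (of_real (q $ 1), of_real (q $ 2)) \<in> Z" for q
    using plane_embedding_in_zero_set_iff[OF F(1)] by (simp add: CF Z_def)
  have mem: "(x, y) \<in> real_points C i j \<longleftrightarrow>
      (if i = 1 then (of_real x, of_real y) \<in> Z else (of_real y, of_real x) \<in> Z)" for x y
  proof
    assume "(x, y) \<in> real_points C i j"
    then show "if i = 1 then (of_real x, of_real y) \<in> Z else (of_real y, of_real x) \<in> Z"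
      using cases emb by (auto simp: real_points_def)
  next
    assume h: "if i = 1 then (of_real x, of_real y) \<in> Z else (of_real y, of_real x) \<in> Z"
    then show "(x, y) \<in> real_points C i j"
      unfolding real_points_def emb
      using cases by (auto intro!: exI[of _ "if i = 1 then vector [x, y] else vector [y, x]"])
  qed
  have zar_real: "bieval Q (fst z) (snd z) = 0"
    if inf: "infinite {z \<in> real_points C i j. bieval Q (fst z) (snd z) = 0}"
      and z: "z \<in> real_points C i j" for Q z
  proof -
    obtain Q' where Q': "\<And>x y. bieval Q' x y = bieval Q y x" using bipoly_swap[of Q] by blast
    obtain P where P: "\<And>x y. bieval P (of_real x) (of_real y) = complex_of_real (bieval (if i = 1 then Q else Q') x y)"
      using bipoly_of_real[of "if i = 1 then Q else Q'"] by blast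
    define g where "g z = (if i = 1 then (complex_of_real (fst z), complex_of_real (snd z))
       else (complex_of_real (snd z), complex_of_real (fst z)))" for z
    have "inj g" by (auto simp: g_def inj_on_def split: if_splits)
    have Pg: "bieval P (fst (g z)) (snd (g z)) = of_real (bieval Q (fst z) (snd z))" for z
      by (simp add: g_def P Q')
    have gZ: "g z \<in> Z" if "z \<in> real_points C i j" for z
      using that mem[of "fst z" "snd z"] by (simp add: g_def)
    have "g ` {z \<in> real_points C i j. bieval Q (fst z) (snd z) = 0} \<subseteq> {z\<in>Z. bieval P (fst z) (snd z) = 0}"
      using gZ Pg by auto
    moreover have "infinite (g ` {z \<in> real_points C i j. bieval Q (fst z) (snd z) = 0})"
      using inf \<open>inj g\<close> by (meson finite_imageD inj_on_subset subset_UNIV)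
    ultimately have "infinite {z\<in>Z. bieval P (fst z) (snd z) = 0}" using finite_subset by blast
    then have "bieval P (fst (g z)) (snd (g z)) = 0" using zar[of P "fst (g z)" "snd (g z)"] gZ[OF z] by simp
    then show ?thesis by (simp add: Pg)
  qed
  have "\<exists>A. A \<noteq> 0 \<and> (\<forall>z\<in>real_points C i j. bieval A (fst z) (snd z) = 0)"
  proof -
    obtain Fs where Fs: "\<And>x y. bieval Fs x y = bieval Fb y x" using bipoly_swap[of Fb] by blast
    obtain R I where RI: "\<And>x y. bieval (if i = 1 then Fb else Fs) (of_real x) (of_real y) =
        Complex (bieval R x y) (bieval I x y)" using bipoly_Re_Im[of "if i = 1 then Fb else Fs"] by blast
    have "(if i = 1 then Fb else Fs) \<noteq> 0"
    proof
      assume "(if i = 1 then Fb else Fs) = 0"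
      then have "bieval Fb x y = 0" for x y using Fs[of y x] by (auto split: if_splits)
      then have "Fb = 0" by (intro bieval_eq_0_imp[of UNIV]) (auto simp: infinite_UNIV_char_0)
      with \<open>Fb \<noteq> 0\<close> show False by simp
    qed
    \<comment> \<open>The equation of the curve may have nonreal coefficients. Its real and
      imaginary parts both vanish at real points, and one of them is a nonzero real
      polynomial.\<close>
    have "R \<noteq> 0 \<or> I \<noteq> 0"
    proof (rule ccontr)
      assume "\<not> (R \<noteq> 0 \<or> I \<noteq> 0)"
      then have "bieval (if i = 1 then Fb else Fs) (of_real x) (of_real y) = 0" for x y
        using RI[of x y] by (simp add: complex_eq_iff)
      then have sub: "range complex_of_real \<subseteq> {x. bieval (if i = 1 then Fb else Fs) x (of_real y) = 0}" for y
        by auto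
      have inf: "infinite (range complex_of_real)"
        by (simp add: finite_image_iff inj_on_def infinite_UNIV_char_0)
      have "(if i = 1 then Fb else Fs) = 0"
      proof (rule bieval_eq_0_imp[OF inf])
        fix y assume "y \<in> range complex_of_real"
        then show "infinite {x. bieval (if i = 1 then Fb else Fs) x y = 0}"
          using sub finite_subset inf by blast
      qed
      with \<open>(if i = 1 then Fb else Fs) \<noteq> 0\<close> show False by simp
    qed
    moreover have "bieval R (fst z) (snd z) = 0 \<and> bieval I (fst z) (snd z) = 0"
      if z: "z \<in> real_points C i j" for z
    proof -
      have "bieval (if i = 1 then Fb else Fs) (of_real (fst z)) (of_real (snd z)) = 0"
        using z mem[of "fst z" "snd z"] by (auto simp: Fs Fb Z_def)
      then show ?thesis using RI[of "fst z" "snd z"] by (simp add: complex_eq_iff)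
    qed
    ultimately show ?thesis by blast
  qed
  with zar_real show ?thesis unfolding zariski_irreducible_def by blast
qed

text \<open>Implicit differentiation of an equation \<open>A = 0\<close> of \<open>Z\<close>: the
  slope is \<open>- A_x / A_y\<close>. Choosing \<open>A\<close> of minimal degree in
  \<open>y\<close> keeps \<open>A_y\<close> from vanishing on all of \<open>Z\<close>, hence it
  vanishes at finitely many points only. The infinite projection excludes an \<open>A\<close> that
  depends on \<open>x\<close> alone.\<close>

lemma slope_polynomials:
  assumes Z: "zariski_irreducible Z" and inf: "infinite (fst ` Z)"
  obtains u w where "finite {z\<in>Z. bieval w (fst z) (snd z) = 0}"
    and "\<And>x y x' y' t. \<lbrakk>(x has_real_derivative x') (at t); (y has_real_derivative y') (at t);
          \<And>s. (x s, y s) \<in> Z\<rbrakk> \<Longrightarrow> bieval w (x t) (y t) * y' = bieval u (x t) (y t) * x'"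
proof -
  define V where "V A \<longleftrightarrow> A \<noteq> 0 \<and> (\<forall>z\<in>Z. bieval A (fst z) (snd z) = 0)" for A
  obtain A0 where A0: "V A0" using Z unfolding V_def zariski_irreducible_def by metis
  then obtain A where A: "V A" and min: "\<And>B. V B \<Longrightarrow> degree A \<le> degree B"
    using ex_has_least_nat[of V A0 degree, OF A0] by metis
  have deg: "degree A \<noteq> 0"
  proof
    assume "degree A = 0"
    then obtain a where a: "A = [:a:]" by (metis degree_eq_zeroE)
    with A have "a \<noteq> 0" "fst ` Z \<subseteq> {x. poly a x = 0}" by (auto simp: V_def)
    then show False using inf poly_roots_finite finite_subset by blast
  qed
  have fin: "finite {z\<in>Z. bieval (pderiv A) (fst z) (snd z) = 0}"
  proof (rule ccontr)
    assume "infinite {z\<in>Z. bieval (pderiv A) (fst z) (snd z) = 0}"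
    then have "\<forall>z\<in>Z. bieval (pderiv A) (fst z) (snd z) = 0"
      using Z unfolding zariski_irreducible_def by blast
    moreover have "pderiv A \<noteq> 0" using deg by (simp add: pderiv_eq_0_iff)
    ultimately have "V (pderiv A)" by (simp add: V_def)
    from min[OF this] deg show False by (simp add: degree_pderiv)
  qed
  have "bieval (pderiv A) (x t) (y t) * y' = bieval (- dfst A) (x t) (y t) * x'"
    if d: "(x has_real_derivative x') (at t)" "(y has_real_derivative y') (at t)" and z: "\<And>s. (x s, y s) \<in> Z"
    for x y x' y' t
  proof -
    have "bieval A (x s) (y s) = 0" for s using A z[of s] by (auto simp: V_def)
    then have "((\<lambda>s. bieval A (x s) (y s)) has_real_derivative 0) (at t)" by simp
    from DERIV_unique[OF this DERIV_bieval[OF d]] show ?thesis by simp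
  qed
  with fin show thesis by (rule that)
qed

section \<open>The dual curve and the reflection law\<close>

lemma dfst_add [simp]: "dfst (p + q) = dfst p + dfst q"
  by (rule poly_eqI) (simp add: dfst_def coeff_map_poly pderiv_add)

lemma dfst_diff [simp]: "dfst (p - q) = dfst p - dfst q"
  by (rule poly_eqI) (simp add: dfst_def coeff_map_poly pderiv_diff)

lemma dfst_smult: "dfst (smult a p) = smult (pderiv a) p + smult a (dfst p)"
  by (rule poly_eqI) (simp add: dfst_def coeff_map_poly pderiv_mult)

lemma dfst_mult: "dfst (p * q) = dfst p * q + p * dfst q"
  by (induction p) (simp_all add: dfst_smult algebra_simps)

lemma dfst_pderiv: "dfst (pderiv p) = pderiv (dfst p)"
  by (rule poly_eqI) (simp add: dfst_def coeff_map_poly coeff_pderiv pderiv_mult pderiv_smult pderiv_of_nat flip: of_nat_Suc)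

section \<open>Tangent lines as points of the dual plane\<close>

locale plane_curve =
  fixes x y x1 y1 x2 y2 :: "real \<Rightarrow> real"
  assumes DERIV_x: "(x has_real_derivative x1 t) (at t)"
    and DERIV_y: "(y has_real_derivative y1 t) (at t)"
    and DERIV_x1: "(x1 has_real_derivative x2 t) (at t)"
    and DERIV_y1: "(y1 has_real_derivative y2 t) (at t)"
begin

definition m :: "real \<Rightarrow> real" where "m t = y1 t / x1 t"
definition b :: "real \<Rightarrow> real" where "b t = y t - m t * x t"
definition m1 :: "real \<Rightarrow> real" where "m1 t = (y2 t * x1 t - y1 t * x2 t) / (x1 t)\<^sup>2"

lemma DERIV_m: "x1 t \<noteq> 0 \<Longrightarrow> (m has_real_derivative m1 t) (at t)"
  unfolding m_def[abs_def] m1_def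
  by (rule DERIV_cong[OF DERIV_divide[OF DERIV_y1 DERIV_x1]]) (auto simp: power2_eq_square)

text \<open>Duality: the term \<open>y1 - m x1\<close> cancels. The point \<open>(m, b)\<close>
  therefore moves in the direction \<open>(1, - x)\<close>, which is that of the pencil of the point
  of tangency.\<close>

lemma DERIV_b: "x1 t \<noteq> 0 \<Longrightarrow> (b has_real_derivative - x t * m1 t) (at t)"
  unfolding b_def[abs_def]
  by (rule DERIV_cong[OF DERIV_diff[OF DERIV_y DERIV_mult[OF DERIV_m DERIV_x]]]) (auto simp: m_def)

lemma eventually_x1: "x1 t \<noteq> 0 \<Longrightarrow> \<forall>\<^sub>F s in nhds t. x1 s \<noteq> 0"
proof -
  assume *: "x1 t \<noteq> 0"
  have "(x1 \<longlongrightarrow> x1 t) (at t)" using DERIV_isCont[OF DERIV_x1] by (simp add: isCont_def)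
  then have "\<forall>\<^sub>F s in at t. x1 s \<noteq> 0" using * by (rule tendsto_imp_eventually_ne)
  with * show ?thesis by (simp add: eventually_nhds_conv_at)
qed

lemma eventually_x_neq: "x1 t \<noteq> 0 \<Longrightarrow> \<forall>\<^sub>F s in at t. x s \<noteq> c"
proof (cases "x t = c")
  case False
  have "(x \<longlongrightarrow> x t) (at t)" using DERIV_isCont[OF DERIV_x] by (simp add: isCont_def)
  then show ?thesis using False by (rule tendsto_imp_eventually_ne)
next
  case True
  assume "x1 t \<noteq> 0"
  moreover have "((\<lambda>s. (x s - x t) / (s - t)) \<longlongrightarrow> x1 t) (at t)"
    using DERIV_x[of t] by (simp add: has_field_derivative_iff)
  ultimately have "\<forall>\<^sub>F s in at t. (x s - x t) / (s - t) \<noteq> 0"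
    by (intro tendsto_imp_eventually_ne)
  then show ?thesis by eventually_elim (use True in auto)
qed

lemma eventually_notin:
  assumes "x1 t \<noteq> 0" "finite S"
  shows "\<forall>\<^sub>F s in at t. (x s, y s) \<notin> S"
proof -
  have "\<forall>\<^sub>F s in at t. \<forall>z\<in>S. x s \<noteq> fst z"
    using assms eventually_x_neq by (simp add: eventually_ball_finite_distrib)
  then show ?thesis by eventually_elim force
qed

lemma isCont_bieval: "x1 t \<noteq> 0 \<Longrightarrow> isCont (\<lambda>t. bieval f (m t) (b t)) t"
  by (rule DERIV_isCont[OF DERIV_bieval[OF DERIV_m DERIV_b]])

end

text \<open>
  The slope of a tangent line is a rational function of the point of tangency, so a relation between
  tangent lines is a polynomial relation between points of \<open>Z\<close>.
\<close>

lemma tangent_relation_transfer: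
  assumes Z: "zariski_irreducible Z" "infinite (fst ` Z)"
    and c: "plane_curve x y x1 y1 x2 y2" "\<And>s. (x s, y s) \<in> Z"
    and inf: "infinite {(x t, y t) | t. x1 t \<noteq> 0 \<and> bieval f (plane_curve.m x1 y1 t) (plane_curve.b x y x1 y1 t) = 0}"
    and c': "plane_curve x' y' x1' y1' x2' y2'" "\<And>s. (x' s, y' s) \<in> Z" and x1': "x1' t \<noteq> 0"
  shows "bieval f (plane_curve.m x1' y1' t) (plane_curve.b x' y' x1' y1' t) = 0"
proof (rule slope_polynomials[OF Z])
  interpret c: plane_curve x y x1 y1 x2 y2 by fact
  interpret c': plane_curve x' y' x1' y1' x2' y2' by fact
  fix u w assume fin: "finite {z\<in>Z. bieval w (fst z) (snd z) = 0}"
    and uw: "\<And>x y x' y' t. \<lbrakk>(x has_real_derivative x') (at t); (y has_real_derivative y') (at t);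
          \<And>s. (x s, y s) \<in> Z\<rbrakk> \<Longrightarrow> bieval w (x t) (y t) * y' = bieval u (x t) (y t) * x'"
  define U where "U z = bieval u (fst z) (snd z)" for z :: "real \<times> real"
  define W where "W z = bieval w (fst z) (snd z)" for z :: "real \<times> real"
  \<comment> \<open>With slope \<open>U / W\<close> the intercept is \<open>y - (U / W) x\<close>,
    here brought over the denominator \<open>W\<close>.\<close>
  define V where "V z = snd z * W z - U z * fst z" for z :: "real \<times> real"
  have UW: "U \<in> bipolys" "W \<in> bipolys"
    unfolding U_def[abs_def] W_def[abs_def] by (intro subalg_bieval subalg_bipolys bipolys_fst bipolys_snd)+
  have "V \<in> bipolys" unfolding V_def[abs_def]
    by (intro subalg_diff subalg_mult subalg_bipolys bipolys_fst bipolys_snd UW)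
  from subalg_homogenize[OF subalg_bipolys UW(1) this UW(2), of f]
  obtain d h where "h \<in> bipolys" and h: "\<And>z. W z \<noteq> 0 \<Longrightarrow> h z = W z ^ d * bieval f (U z / W z) (V z / W z)"
    by metis
  obtain Q where Q0: "\<And>x y. h (x, y) = bieval Q x y" using \<open>h \<in> bipolys\<close> by (rule bipolysE) metis
  have Q: "bieval Q (x t) (y t) = 0 \<longleftrightarrow> bieval f (y1 t / x1 t) (y t - y1 t / x1 t * x t) = 0"
    if c: "plane_curve x y x1 y1 x2 y2" and Z: "\<And>s. (x s, y s) \<in> Z" and x1: "x1 t \<noteq> 0"
      and w: "bieval w (x t) (y t) \<noteq> 0" for x y x1 y1 x2 y2 t
  proof -
    have s: "U (x t, y t) / W (x t, y t) = y1 t / x1 t"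
      using uw[OF plane_curve.DERIV_x[OF c] plane_curve.DERIV_y[OF c] Z, of t] x1 w
      by (simp add: U_def W_def field_simps)
    have w': "W (x t, y t) \<noteq> 0" using w by (simp add: W_def)
    then have v: "V (x t, y t) / W (x t, y t) = y t - y1 t / x1 t * x t"
      unfolding s[symmetric] by (simp add: V_def field_simps)
    have "bieval Q (x t) (y t) = W (x t, y t) ^ d * bieval f (y1 t / x1 t) (y t - y1 t / x1 t * x t)"
      using h[OF w'] unfolding s v Q0 .
    then show ?thesis using w' by simp
  qed
  define S where "S = {z\<in>Z. bieval w (fst z) (snd z) = 0}"
  define I where "I = {(x t, y t) | t. x1 t \<noteq> 0 \<and> bieval f (c.m t) (c.b t) = 0}"
  have "infinite (I - S)" using inf fin by (simp add: I_def S_def)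
  moreover have "I - S \<subseteq> {z\<in>Z. bieval Q (fst z) (snd z) = 0}"
    using Q[OF c] c(2) by (auto simp: I_def S_def c.m_def c.b_def)
  ultimately have "infinite {z\<in>Z. bieval Q (fst z) (snd z) = 0}" using finite_subset by blast
  then have Q0: "\<forall>z\<in>Z. bieval Q (fst z) (snd z) = 0" using Z(1) unfolding zariski_irreducible_def by blast
  have "\<forall>\<^sub>F s in at t. (x' s, y' s) \<notin> S" using x1' fin by (intro c'.eventually_notin) (auto simp: S_def)
  moreover have "\<forall>\<^sub>F s in at t. x1' s \<noteq> 0"
    using c'.eventually_x1[OF x1'] by (simp add: eventually_nhds_conv_at)
  ultimately have "\<forall>\<^sub>F s in at t. bieval f (c'.m s) (c'.b s) = 0"
  proof eventually_elim
    case (elim s)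
    then show ?case using Q[OF c', of s] Q0 c'(2)[of s] by (force simp: S_def c'.m_def c'.b_def)
  qed
  \<comment> \<open>The polynomial relation says nothing where \<open>w\<close> vanishes. Those
    points are finitely many, so they are avoided in a punctured neighbourhood and recovered as a
    limit.\<close>
  then have "((\<lambda>s. bieval f (c'.m s) (c'.b s)) \<longlongrightarrow> 0) (at t)" by (rule tendsto_eventually)
  moreover have "((\<lambda>s. bieval f (c'.m s) (c'.b s)) \<longlongrightarrow> bieval f (c'.m t) (c'.b t)) (at t)"
    using c'.isCont_bieval[OF x1'] by (simp add: isCont_def)
  ultimately show ?thesis using tendsto_unique[OF at_neq_bot] by blast
qed

text \<open>
  In the coordinates \<open>(m, b)\<close> of the line \<open>y = m x + b\<close> the pencil of a point with abscissa \<open>x\<close> is a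
  line with direction \<open>(1, - x)\<close>.
\<close>

definition ddir :: "real \<Rightarrow> real poly poly \<Rightarrow> real poly poly" where
  "ddir x p = dfst p - [:[:x:]:] * pderiv p"

lemma bieval_smult [simp]: "bieval (smult c p) u v = poly c u * bieval p u v"
  by (simp add: bieval_def)

lemma bieval_ddir: "bieval (ddir x p) u v = bieval (dfst p) u v - x * bieval (pderiv p) u v"
  by (simp add: ddir_def)

lemma DERIV_bieval_line:
  "((\<lambda>d. bieval p (u + d) (v - x * d)) has_real_derivative bieval (ddir x p) (u + d) (v - x * d)) (at d)"
proof -
  have "((\<lambda>d. u + d) has_real_derivative 1) (at d)" "((\<lambda>d. v - x * d) has_real_derivative - x) (at d)"
    by (auto intro!: derivative_eq_intros)
  from DERIV_bieval[OF this, of p] show ?thesis by (simp add: bieval_ddir mult.commute)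
qed

text \<open>On a pencil the iterated directional derivatives are ordinary derivatives of one
  univariate polynomial, from which a double root can be split off.\<close>

lemma line_polynomial:
  obtains W where "\<And>d. poly W d = bieval p (u + d) (v - x * d)"
    and "\<And>d. poly (pderiv W) d = bieval (ddir x p) (u + d) (v - x * d)"
    and "\<And>d. poly (pderiv (pderiv W)) d = bieval (ddir x (ddir x p)) (u + d) (v - x * d)"
    and "\<And>d. poly (pderiv (pderiv (pderiv W))) d = bieval (ddir x (ddir x (ddir x p))) (u + d) (v - x * d)"
proof -
  have "subalg {h. \<exists>W. \<forall>d::real. h d = poly W d}"
    unfolding subalg_def
    apply (intro conjI ballI allI; clarsimp)
    subgoal for c by (rule exI[of _ "[:c:]"]) simp
    subgoal for f g p q by (rule exI[of _ "p + q"]) simp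
    subgoal for f g p q by (rule exI[of _ "p * q"]) simp
    done
  then have "(\<lambda>d. bieval p (u + d) (v - x * d)) \<in> {h. \<exists>W. \<forall>d::real. h d = poly W d}"
    by (rule subalg_bieval) (auto intro: exI[of _ "[:u, 1:]"] exI[of _ "[:v, - x:]"])
  then obtain W where W: "\<And>d. poly W d = bieval p (u + d) (v - x * d)" by fastforce
  have step: "poly (pderiv Q) d = bieval (ddir x q) (u + d) (v - x * d)"
    if "\<And>d. poly Q d = bieval q (u + d) (v - x * d)" for Q q d
    using DERIV_unique[OF poly_DERIV[of Q d]] DERIV_bieval_line[of q u v x d] that by presburger
  show thesis
    by (rule that[OF W]) (intro step W)+
qed

section \<open>Consequences of evenness about the tangent\<close>

lemma even_DERIV_0:
  fixes S :: "real \<Rightarrow> real"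
  assumes "\<forall>\<^sub>F t in nhds 0. S (- t) = S t" "(S has_real_derivative D) (at 0)"
  shows "D = 0"
proof -
  have "((\<lambda>t. S (- t)) has_real_derivative - D) (at 0)"
    using assms(2) DERIV_mirror[where f = S and x = 0 and y = D] by simp
  moreover have "((\<lambda>t. S (- t)) has_real_derivative D) (at 0)"
    using DERIV_cong_ev[OF refl assms(1) refl] assms(2) by blast
  ultimately have "- D = D" by (rule DERIV_unique)
  then show ?thesis by simp
qed

text \<open>
  \<open>pencil_fun e N m0 x0 y0 t\<close> is the value of the integral on the line through \<open>(x0, y0)\<close> with
  direction \<open>(1 - m0 t, m0 + t) = (1, m0) + t (- m0, 1)\<close>, so that reflection in the
  tangent of slope \<open>m0\<close> is \<open>t \<mapsto> - t\<close>.
\<close>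

definition pencil_fun :: "real poly poly \<Rightarrow> nat \<Rightarrow> real \<Rightarrow> real \<Rightarrow> real \<Rightarrow> real \<Rightarrow> real" where
  "pencil_fun e N m0 x0 y0 t =
     (1 - m0 * t) ^ (2 * N) * bieval e ((m0 + t) / (1 - m0 * t)) (y0 - x0 * ((m0 + t) / (1 - m0 * t)))"

definition reflection_invariant :: "real poly poly \<Rightarrow> nat \<Rightarrow> real \<Rightarrow> real \<Rightarrow> real \<Rightarrow> bool" where
  "reflection_invariant e N m0 x0 y0 \<longleftrightarrow>
     (\<forall>t. \<bar>m0 * t\<bar> < 1 \<longrightarrow> pencil_fun e N m0 x0 y0 (- t) = pencil_fun e N m0 x0 y0 t)"

lemma eventually_small: "\<forall>\<^sub>F t in nhds (0::real). \<bar>c * t\<bar> < 1"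
proof -
  have "((\<lambda>t. \<bar>c * t\<bar>) \<longlongrightarrow> \<bar>c * 0\<bar>) (nhds 0)" by (intro tendsto_intros filterlim_ident)
  then show ?thesis by (intro order_tendstoD(2)) auto
qed

text \<open>The derivative of \<open>pencil_fun\<close> at \<open>0\<close> vanishes. The slope,
  given by the addition formula of the tangent function, contributes \<open>1 + m0\<^sup>2\<close>;
  the factor that clears denominators contributes \<open>- 2 N m0\<close>.\<close>

lemma reflection_invariant_first_order:
  assumes "reflection_invariant e N m0 x0 y0"
  shows "(1 + m0\<^sup>2) * bieval (ddir x0 e) m0 (y0 - m0 * x0) = 2 * real N * m0 * bieval e m0 (y0 - m0 * x0)"
proof -
  let ?\<mu> = "\<lambda>t. (m0 + t) / (1 - m0 * t)"
  have ev: "\<forall>\<^sub>F t in nhds 0. pencil_fun e N m0 x0 y0 (- t) = pencil_fun e N m0 x0 y0 t"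
    using eventually_small[of m0] assms by (auto simp: reflection_invariant_def elim: eventually_mono)
  have mu: "(?\<mu> has_real_derivative 1 + m0\<^sup>2) (at 0)"
    by (auto intro!: derivative_eq_intros simp: power2_eq_square)
  have "((\<lambda>t. y0 - x0 * ?\<mu> t) has_real_derivative - x0 * (1 + m0\<^sup>2)) (at 0)"
    by (rule derivative_eq_intros mu refl | simp)+
  from DERIV_bieval[OF mu this, of e]
  have d: "((\<lambda>t. bieval e (?\<mu> t) (y0 - x0 * ?\<mu> t)) has_real_derivative
      (1 + m0\<^sup>2) * bieval (ddir x0 e) m0 (y0 - m0 * x0)) (at 0)"
    by (simp add: bieval_ddir algebra_simps)
  have "((\<lambda>t. (1 - m0 * t) ^ (2 * N)) has_real_derivative - (2 * real N * m0)) (at 0)"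
    by (auto intro!: derivative_eq_intros)
  from DERIV_mult[OF this d]
  have "(pencil_fun e N m0 x0 y0 has_real_derivative - (2 * real N * m0) * bieval e m0 (y0 - m0 * x0)
     + (1 + m0\<^sup>2) * bieval (ddir x0 e) m0 (y0 - m0 * x0)) (at 0)"
    by (simp add: pencil_fun_def[abs_def] algebra_simps)
  from even_DERIV_0[OF ev this] show ?thesis by simp
qed

text \<open>On the pencil \<open>f\<close> has a double zero at the tangent, so
  \<open>f = d^2 V\<close> and the integral carries a factor \<open>d^(2k)\<close>. Up to powers of
  \<open>1 - m0 t\<close> this factor is even in \<open>t\<close>; after division the remaining
  function \<open>S\<close> is again even, and its vanishing derivative is the relation. Third
  derivatives of \<open>f\<close> enter because \<open>V'(0)\<close> is a sixth of one.\<close>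

lemma reflection_invariant_third_order:
  assumes r: "reflection_invariant (f ^ k * g) N m0 x0 y0" and b0: "b0 = y0 - m0 * x0"
    and f: "bieval f m0 b0 = 0" "bieval (ddir x0 f) m0 b0 = 0" and w: "bieval (ddir x0 (ddir x0 f)) m0 b0 \<noteq> 0"
  shows "(1 + m0\<^sup>2) * (real k * bieval (ddir x0 (ddir x0 (ddir x0 f))) m0 b0 * bieval g m0 b0 +
      3 * bieval (ddir x0 (ddir x0 f)) m0 b0 * bieval (ddir x0 g) m0 b0) =
     6 * (real N - real k) * m0 * bieval (ddir x0 (ddir x0 f)) m0 b0 * bieval g m0 b0"
proof -
  obtain W where W: "\<And>d. poly W d = bieval f (m0 + d) (b0 - x0 * d)"
    "\<And>d. poly (pderiv W) d = bieval (ddir x0 f) (m0 + d) (b0 - x0 * d)"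
    "\<And>d. poly (pderiv (pderiv W)) d = bieval (ddir x0 (ddir x0 f)) (m0 + d) (b0 - x0 * d)"
    "\<And>d. poly (pderiv (pderiv (pderiv W))) d = bieval (ddir x0 (ddir x0 (ddir x0 f))) (m0 + d) (b0 - x0 * d)"
    using line_polynomial[where p = f and u = m0 and v = b0 and x = x0] by metis
  obtain G where G: "\<And>d. poly G d = bieval g (m0 + d) (b0 - x0 * d)"
    "\<And>d. poly (pderiv G) d = bieval (ddir x0 g) (m0 + d) (b0 - x0 * d)"
    using line_polynomial[where p = g and u = m0 and v = b0 and x = x0] by metis
  obtain w0 w1 V where W012: "W = pCons w0 (pCons w1 V)" by (metis pCons_cases)
  have "w0 = 0" using W(1)[of 0] f W012 by simp
  moreover have "w1 = 0" using W(2)[of 0] f W012 by (simp add: pderiv_pCons)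
  ultimately have WV: "W = pCons 0 (pCons 0 V)" using W012 by simp
  have V0: "2 * poly V 0 = bieval (ddir x0 (ddir x0 f)) m0 b0"
    using W(3)[of 0] by (simp add: WV pderiv_pCons pderiv_add)
  have p2: "pderiv (2::real poly) = 0" by (metis of_nat_numeral pderiv_of_nat)
  have V1: "6 * poly (pderiv V) 0 = bieval (ddir x0 (ddir x0 (ddir x0 f))) m0 b0"
    using W(4)[of 0] by (simp add: WV pderiv_pCons pderiv_add pderiv_mult p2)
  let ?\<delta> = "\<lambda>t. t * (1 + m0\<^sup>2) / (1 - m0 * t)"
  \<comment> \<open>The quotient by \<open>(t * (1 + m0^2)) ^ (2 * k)\<close>; the denominators of
    \<open>?\<delta>\<close> account for the power of \<open>1 - m0 * t\<close> below.\<close>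
  define S where "S t = (1 - m0 * t) ^ (2 * N) / (1 - m0 * t) ^ (2 * k) * poly (V ^ k * G) (?\<delta> t)" for t
  have pf: "pencil_fun (f ^ k * g) N m0 x0 y0 t = (t * (1 + m0\<^sup>2)) ^ (2 * k) * S t" if t: "\<bar>m0 * t\<bar> < 1" for t
  proof -
    have nz: "1 - m0 * t \<noteq> 0" using t by auto
    have mu: "(m0 + t) / (1 - m0 * t) = m0 + ?\<delta> t" using nz by (simp add: field_simps power2_eq_square)
    have y: "y0 - x0 * (m0 + ?\<delta> t) = b0 - x0 * ?\<delta> t" by (simp add: b0 algebra_simps)
    have "bieval (f ^ k * g) (m0 + ?\<delta> t) (b0 - x0 * ?\<delta> t) = poly W (?\<delta> t) ^ k * poly G (?\<delta> t)"
      by (simp add: W G)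
    also have "poly W (?\<delta> t) = (?\<delta> t)\<^sup>2 * poly V (?\<delta> t)" by (simp add: WV power2_eq_square)
    finally have "bieval (f ^ k * g) (m0 + ?\<delta> t) (b0 - x0 * ?\<delta> t) = (?\<delta> t) ^ (2 * k) * poly (V ^ k * G) (?\<delta> t)"
      by (simp add: power_mult_distrib power_mult)
    moreover have "(?\<delta> t) ^ (2 * k) = (t * (1 + m0\<^sup>2)) ^ (2 * k) / (1 - m0 * t) ^ (2 * k)"
      by (rule power_divide)
    ultimately show ?thesis unfolding pencil_fun_def mu y by (simp add: S_def)
  qed
  have "\<forall>\<^sub>F t in nhds 0. S (- t) = S t"
    using eventually_small[of m0]
  proof eventually_elim
    case (elim t)
    have e: "(- t * (1 + m0\<^sup>2)) ^ (2 * k) = (t * (1 + m0\<^sup>2)) ^ (2 * k)"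
      by (simp add: power_mult power_mult_distrib)
    have "1 + m0\<^sup>2 \<noteq> 0" by (metis add_pos_nonneg less_irrefl zero_le_power2 zero_less_one)
    moreover have "(- t * (1 + m0\<^sup>2)) ^ (2 * k) * S (- t) = (t * (1 + m0\<^sup>2)) ^ (2 * k) * S t"
      using pf[of t] pf[of "- t"] r elim unfolding reflection_invariant_def by (metis abs_minus_cancel mult_minus_right)
    ultimately show ?case unfolding e by (cases "t = 0") auto
  qed
  moreover have "(S has_real_derivative (2 * real k - 2 * real N) * m0 * poly (V ^ k * G) 0
      + (1 + m0\<^sup>2) * poly (pderiv (V ^ k * G)) 0) (at 0)"
  proof -
    have d: "(?\<delta> has_real_derivative 1 + m0\<^sup>2) (at 0)"
      by (auto intro!: derivative_eq_intros simp: power2_eq_square)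
    have d1: "((\<lambda>t. poly p (?\<delta> t)) has_real_derivative poly (pderiv p) 0 * (1 + m0\<^sup>2)) (at 0)" for p
      using DERIV_chain'[OF d poly_DERIV] by simp
    have d2: "((\<lambda>t. (1 - m0 * t) ^ (2 * N) / (1 - m0 * t) ^ (2 * k)) has_real_derivative
        (2 * real k - 2 * real N) * m0) (at 0)"
      by (auto intro!: derivative_eq_intros simp: algebra_simps)
    show ?thesis unfolding S_def[abs_def]
      by (rule DERIV_cong[OF DERIV_mult[OF d2 d1]]) (simp add: algebra_simps)
  qed
  ultimately have e1: "(2 * real k - 2 * real N) * m0 * poly (V ^ k * G) 0
      + (1 + m0\<^sup>2) * poly (pderiv (V ^ k * G)) 0 = 0" by (rule even_DERIV_0)
  \<comment> \<open>Multiplied by \<open>V(0)\<close> so that the exponent \<open>k - 1\<close> does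
    not occur and \<open>k = 0\<close> is covered.\<close>
  have e2: "poly (pderiv (V ^ k * G)) 0 * poly V 0 =
     poly V 0 ^ k * (real k * poly (pderiv V) 0 * poly G 0 + poly V 0 * poly (pderiv G) 0)"
  proof (cases k)
    case (Suc n)
    show ?thesis unfolding Suc pderiv_mult pderiv_power_Suc
      by (simp add: algebra_simps del: of_nat_Suc)
  qed (simp add: algebra_simps)
  have comb: "vk * (a * g0 * v0 + c * X) = 0" if "a * (vk * g0) + c * D = 0" "D * v0 = vk * X"
    for a c D X vk g0 v0 :: real
  proof -
    have "vk * (a * g0 * v0 + c * X) = (a * (vk * g0) + c * D) * v0 + c * (vk * X - D * v0)"
      by (simp add: algebra_simps)
    then show ?thesis using that by simp
  qed
  have "poly V 0 ^ k * ((2 * real k - 2 * real N) * m0 * poly G 0 * poly V 0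
      + (1 + m0\<^sup>2) * (real k * poly (pderiv V) 0 * poly G 0 + poly V 0 * poly (pderiv G) 0)) = 0"
    by (rule comb[OF _ e2]) (use e1 in simp)
  moreover have "poly V 0 \<noteq> 0" using V0 w by auto
  ultimately have *: "(2 * real k - 2 * real N) * m0 * poly G 0 * poly V 0
      + (1 + m0\<^sup>2) * (real k * poly (pderiv V) 0 * poly G 0 + poly V 0 * poly (pderiv G) 0) = 0"
    by simp
  have "poly G 0 = bieval g m0 b0" "poly (pderiv G) 0 = bieval (ddir x0 g) m0 b0"
    using G[of 0] by simp_all
  with * show ?thesis unfolding V0[symmetric] V1[symmetric] by algebra
qed

section \<open>The bordered Hessian and divisibility along the dual curve\<close>

lemma bieval_numeral [simp]: "bieval (numeral n) u v = numeral n"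
  by (simp add: bieval_def)

text \<open>The second derivative of \<open>f\<close> in the direction \<open>(f_b, - f_m)\<close>
  tangent to its level curve. Unlike \<open>ddir\<close> it does not refer to a point of tangency,
  so it is a polynomial on the whole dual plane; it vanishes at every singular point of
  \<open>f = 0\<close>.\<close>

definition hess :: "real poly poly \<Rightarrow> real poly poly" where
  "hess f = dfst (dfst f) * (pderiv f * pderiv f) - [:[:2:]:] * (pderiv (dfst f) * (dfst f * pderiv f)) +
     pderiv (pderiv f) * (dfst f * dfst f)"

lemma bieval_hess:
  assumes "bieval (dfst f) u v = x * bieval (pderiv f) u v"
  shows "bieval (hess f) u v = bieval (ddir x (ddir x f)) u v * (bieval (pderiv f) u v)\<^sup>2"
  by (simp add: hess_def ddir_def dfst_smult dfst_pderiv pderiv_diff pderiv_smult assms)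
     (simp add: algebra_simps power2_eq_square)

text \<open>By hypothesis the tangent direction \<open>(f_b, - f_m)\<close> is
  \<open>f_b (1, - x)\<close>. Differentiating this direction inside the Hessian, with
  \<open>D\<close> the derivative along \<open>(1, - x)\<close>, contributes
  \<open>2 f_b (D f_b D f_m - D f_m D f_b) = 0\<close>, so only the third derivative of
  \<open>f\<close> survives.\<close>

lemma bieval_ddir_hess:
  assumes "bieval (dfst f) u v = x * bieval (pderiv f) u v"
  shows "bieval (ddir x (hess f)) u v = bieval (ddir x (ddir x (ddir x f))) u v * (bieval (pderiv f) u v)\<^sup>2"
  by (simp add: hess_def ddir_def dfst_smult dfst_mult dfst_pderiv pderiv_diff pderiv_add pderiv_smult pderiv_mult assms)
     (simp add: algebra_simps power2_eq_square)

lemma inj_on_DERIV_nonzero: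
  fixes f :: "real \<Rightarrow> real"
  assumes "\<And>t. t \<in> {a<..<c} \<Longrightarrow> (f has_real_derivative f' t) (at t)" "\<And>t. t \<in> {a<..<c} \<Longrightarrow> f' t \<noteq> 0"
  shows "inj_on f {a<..<c}"
proof -
  have "f s \<noteq> f t" if st: "s \<in> {a<..<c}" "t \<in> {a<..<c}" "s < t" for s t
  proof
    assume eq: "f s = f t"
    have sub: "r \<in> {a<..<c}" if "s \<le> r" "r \<le> t" for r using that st by auto
    obtain z where z: "s < z" "z < t" "DERIV f z :> 0"
    proof -
      have "continuous_on {s..t} f"
        using assms(1)[OF sub] by (intro continuous_at_imp_continuous_on ballI DERIV_isCont) auto
      moreover have "f differentiable (at r)" if "s < r" "r < t" for r
        using assms(1)[OF sub[of r]] that by (auto simp: real_differentiable_def)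
      ultimately show thesis using Rolle[OF \<open>s < t\<close> eq] that by blast
    qed
    have "f' z = 0" using DERIV_unique[OF assms(1)[OF sub] z(3)] z by auto
    with assms(2)[OF sub[of z]] z show False by auto
  qed
  then show ?thesis by (auto simp: inj_on_def) (metis greaterThanLessThan_iff linorder_neqE_linordered_idom)
qed

lemma eventually_nhds_interval:
  fixes t :: real
  assumes "\<forall>\<^sub>F s in nhds t. P s"
  obtains d where "d > 0" "\<And>s. s \<in> {t - d<..<t + d} \<Longrightarrow> P s"
proof -
  obtain d where "d > 0" "\<And>s. dist s t < d \<Longrightarrow> P s"
    using assms by (auto simp: eventually_nhds_metric)
  then show thesis by (intro that[of d]) (auto simp: dist_real_def abs_less_iff)
qed

text \<open>Elimination of the second variable would leave a nonzero univariate polynomial with the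
  infinitely many roots \<open>\<mu> t\<close>.\<close>

lemma irreducible_dvd_of_common_zeros:
  fixes f q :: "real poly poly"
  assumes "irreducible f" and inf: "infinite T" "inj_on \<mu> T"
    and zero: "\<And>t. t \<in> T \<Longrightarrow> bieval f (\<mu> t) (\<beta> t) = 0 \<and> bieval q (\<mu> t) (\<beta> t) = 0"
  shows "f dvd q"
proof (rule ccontr)
  assume "\<not> f dvd q"
  then obtain r U V where r: "r \<noteq> 0" "U * f + V * q = [:r:]"
    by (rule elimination[OF assms(1)])
  have "\<mu> ` T \<subseteq> {x. poly r x = 0}"
  proof (clarsimp)
    fix t assume t: "t \<in> T"
    have "bieval (U * f + V * q) (\<mu> t) (\<beta> t) = 0" using zero[OF t] by simp
    then show "poly r (\<mu> t) = 0" unfolding r(2) by simp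
  qed
  then have "finite (\<mu> ` T)" using poly_roots_finite[OF r(1)] finite_subset by blast
  then show False using inf finite_imageD by blast
qed

lemma exists_irreducible_factor:
  fixes E :: "real poly poly"
  assumes "E \<noteq> 0" "infinite {t\<in>T. bieval E (\<mu> t) (\<beta> t) = 0}"
  shows "\<exists>f. irreducible f \<and> f dvd E \<and> infinite {t\<in>T. bieval f (\<mu> t) (\<beta> t) = 0}"
  using assms
proof (induction E rule: prime_divisors_induct)
  case (unit E)
  obtain U where U: "1 = E * U" using unit by blast
  have "bieval E (\<mu> t) (\<beta> t) \<noteq> 0" for t
    using bieval_simps(6)[of E U "\<mu> t" "\<beta> t"] by (auto simp flip: U)
  with unit show ?case by simp
next
  case (factor p E)
  have "{t\<in>T. bieval (p * E) (\<mu> t) (\<beta> t) = 0} =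
      {t\<in>T. bieval p (\<mu> t) (\<beta> t) = 0} \<union> {t\<in>T. bieval E (\<mu> t) (\<beta> t) = 0}" by auto
  with factor.prems consider "infinite {t\<in>T. bieval p (\<mu> t) (\<beta> t) = 0}"
    | "infinite {t\<in>T. bieval E (\<mu> t) (\<beta> t) = 0}" by fastforce
  then show ?case
  proof cases
    case 1
    then show ?thesis using factor.hyps by (intro exI[of _ p]) (auto intro: prime_elem_imp_irreducible)
  next
    case 2
    then obtain f where "irreducible f" "f dvd E" "infinite {t\<in>T. bieval f (\<mu> t) (\<beta> t) = 0}"
      using factor by auto
    then show ?thesis by (intro exI[of _ f]) auto
  qed
qed simp

definition unit_poly :: "real poly poly" where
  "unit_poly = [:[:1, 0, 1:]:]"

lemma bieval_unit_poly [simp]: "bieval unit_poly u v = 1 + u\<^sup>2"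
  by (simp add: unit_poly_def power2_eq_square)

lemma one_plus_square_pos: "1 + (u::real)\<^sup>2 > 0"
  by (simp add: add_pos_nonneg)

text \<open>The squared length of the direction \<open>(1 - m0 t, m0 + t)\<close> is
  \<open>(1 + m0^2) (1 + t^2)\<close>. Being even in \<open>t\<close>, it allows a constant to be
  subtracted from the integral without losing reflection invariance.\<close>

lemma unit_direction_square:
  assumes "1 - m0 * t \<noteq> (0::real)"
  shows "(1 - m0 * t) ^ (2 * N) * (1 + ((m0 + t) / (1 - m0 * t))\<^sup>2) ^ N = ((1 + m0\<^sup>2) * (1 + t\<^sup>2)) ^ N"
proof -
  have "(1 - m0 * t)\<^sup>2 * (1 + ((m0 + t) / (1 - m0 * t))\<^sup>2) = (1 - m0 * t)\<^sup>2 + (m0 + t)\<^sup>2"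
    using assms by (simp add: power_divide distrib_left)
  also have "\<dots> = (1 + m0\<^sup>2) * (1 + t\<^sup>2)" by (simp add: power2_eq_square algebra_simps)
  finally show ?thesis unfolding power_mult power_mult_distrib[symmetric] by simp
qed

lemma reflection_invariant_diff:
  assumes "reflection_invariant e N m0 x0 y0"
  shows "reflection_invariant (e - [:[:K:]:] * unit_poly ^ N) N m0 x0 y0"
proof -
  have *: "pencil_fun (e - [:[:K:]:] * unit_poly ^ N) N m0 x0 y0 t =
      pencil_fun e N m0 x0 y0 t - K * ((1 + m0\<^sup>2) * (1 + t\<^sup>2)) ^ N" if "\<bar>m0 * t\<bar> < 1" for t
  proof -
    have "1 - m0 * t \<noteq> 0" using that by auto
    from unit_direction_square[OF this, of N]
    show ?thesis by (simp add: pencil_fun_def right_diff_distrib)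
  qed
  show ?thesis unfolding reflection_invariant_def
  proof (intro allI impI)
    fix t assume t: "\<bar>m0 * t\<bar> < 1"
    then have t': "\<bar>m0 * - t\<bar> < 1" by simp
    show "pencil_fun (e - [:[:K:]:] * unit_poly ^ N) N m0 x0 y0 (- t) =
        pencil_fun (e - [:[:K:]:] * unit_poly ^ N) N m0 x0 y0 t"
      unfolding *[OF t] *[OF t'] using assms t unfolding reflection_invariant_def by simp
  qed
qed

section \<open>Nondegeneracy of the dual curve\<close>

context plane_curve
begin

lemma dual_first_order:
  assumes "\<forall>\<^sub>F s in nhds t. bieval f (m s) (b s) = 0" "x1 t \<noteq> 0" "m1 t \<noteq> 0"
  shows "bieval (dfst f) (m t) (b t) = x t * bieval (pderiv f) (m t) (b t)"
proof -
  have "((\<lambda>s. bieval f (m s) (b s)) has_real_derivative 0) (at t)"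
    using DERIV_cong_ev[OF refl assms(1) refl, of 0] by simp
  from DERIV_unique[OF this DERIV_bieval[OF DERIV_m DERIV_b]] assms
  have "m1 t * (bieval (dfst f) (m t) (b t) - x t * bieval (pderiv f) (m t) (b t)) = 0"
    by (simp add: algebra_simps)
  with assms show ?thesis by simp
qed

text \<open>The first order relation is differentiated once more; the extra term
  \<open>x1 f_b\<close> arises because the direction \<open>(1, - x)\<close> of the pencil turns
  with the point. The identity ties \<open>f_b \<noteq> 0\<close> to a nonzero second derivative and
  to \<open>m1 \<noteq> 0\<close>.\<close>

lemma dual_second_order:
  assumes "\<forall>\<^sub>F s in nhds t. bieval (dfst f) (m s) (b s) = x s * bieval (pderiv f) (m s) (b s)" "x1 t \<noteq> 0"
  shows "bieval (ddir (x t) (ddir (x t) f)) (m t) (b t) * m1 t = x1 t * bieval (pderiv f) (m t) (b t)"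
proof -
  have "\<forall>\<^sub>F s in nhds t. bieval (dfst f) (m s) (b s) - x s * bieval (pderiv f) (m s) (b s) = 0"
    using assms(1) by eventually_elim simp
  then have "((\<lambda>s. bieval (dfst f) (m s) (b s) - x s * bieval (pderiv f) (m s) (b s)) has_real_derivative 0) (at t)"
    using DERIV_cong_ev[OF refl _ refl, of _ "\<lambda>_. 0" t 0] by simp
  from DERIV_unique[OF this DERIV_diff[OF DERIV_bieval[OF DERIV_m DERIV_b] DERIV_mult[OF DERIV_x DERIV_bieval[OF DERIV_m DERIV_b]]]]
    assms(2)
  show ?thesis by (simp add: ddir_def dfst_smult dfst_pderiv pderiv_diff pderiv_smult algebra_simps)
qed

lemma DERIV_bieval_dual:
  "x1 t \<noteq> 0 \<Longrightarrow> ((\<lambda>t. bieval p (m t) (b t)) has_real_derivative m1 t * bieval (ddir (x t) p) (m t) (b t)) (at t)"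
  by (rule DERIV_cong[OF DERIV_bieval[OF DERIV_m DERIV_b]]) (auto simp: bieval_ddir algebra_simps)

lemma DERIV_unit_power:
  assumes "x1 t \<noteq> 0"
  shows "((\<lambda>s. (1 + (m s)\<^sup>2) ^ n) has_real_derivative
     2 * real n * m t * m1 t * (1 + (m t)\<^sup>2) ^ n / (1 + (m t)\<^sup>2)) (at t)"
proof -
  have d: "((\<lambda>s. 1 + (m s)\<^sup>2) has_real_derivative 2 * m t * m1 t) (at t)"
    by (auto intro!: derivative_eq_intros DERIV_m assms)
  have "real n * (2 * m t * m1 t * P ^ (n - Suc 0)) = 2 * real n * m t * m1 t * P ^ n / P"
    if "P \<noteq> 0" for P using that by (cases n) auto
  then have "real n * (2 * m t * m1 t * (1 + (m t)\<^sup>2) ^ (n - Suc 0)) =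
      2 * real n * m t * m1 t * (1 + (m t)\<^sup>2) ^ n / (1 + (m t)\<^sup>2)"
    using one_plus_square_pos[of "m t"] by (metis less_numeral_extra(3))
  then show ?thesis using DERIV_power[OF d, of n] by simp
qed

theorem dual_nondegenerate:
  assumes ac: "a < c"
    and arc: "\<And>t. t \<in> {a<..<c} \<Longrightarrow> x1 t \<noteq> 0 \<and> m1 t \<noteq> 0 \<and> reflection_invariant e N (m t) (x t) (y t)"
    and nonconst: "\<And>K. \<exists>u v. bieval e u v \<noteq> K * (1 + u\<^sup>2) ^ N"
    and transfer: "\<And>f t. infinite {(x t, y t) | t. x1 t \<noteq> 0 \<and> bieval f (m t) (b t) = 0} \<Longrightarrow> x1 t \<noteq> 0 \<Longrightarrow>
         bieval f (m t) (b t) = 0"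
  shows "\<exists>f. infinite {(x t, y t) | t. x1 t \<noteq> 0 \<and> bieval f (m t) (b t) = 0} \<and>
     (\<forall>u v. bieval f u v = 0 \<longrightarrow> bieval (hess f) u v \<noteq> 0)"
proof -
  let ?A = "{a<..<c}"
  have inj: "inj_on x ?A" "inj_on m ?A"
    using inj_on_DERIV_nonzero[OF DERIV_x, of a c] inj_on_DERIV_nonzero[OF DERIV_m, of a c] arc by auto
  have infA: "infinite ?A" using ac by simp
  \<comment> \<open>The dual curve moves along the pencils, so the first order relation is precisely
    the vanishing of this derivative.\<close>
  have "((\<lambda>s. bieval e (m s) (b s) / (1 + (m s)\<^sup>2) ^ N) has_real_derivative 0) (at t)" if t: "t \<in> ?A" for t
  proof -
    have x1: "x1 t \<noteq> 0" and r: "reflection_invariant e N (m t) (x t) (y t)" using arc[OF t] by auto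
    have P: "1 + (m t)\<^sup>2 \<noteq> 0" using one_plus_square_pos[of "m t"] by simp
    have *: "(1 + (m t)\<^sup>2) * bieval (ddir (x t) e) (m t) (b t) = 2 * real N * m t * bieval e (m t) (b t)"
      using reflection_invariant_first_order[OF r] by (simp add: b_def)
    then have D: "bieval (ddir (x t) e) (m t) (b t) = 2 * real N * m t * bieval e (m t) (b t) / (1 + (m t)\<^sup>2)"
      using P by (metis nonzero_mult_div_cancel_left)
    note d = DERIV_unit_power[OF x1, of N]
    show ?thesis
    proof (rule DERIV_cong[OF DERIV_divide[OF DERIV_bieval_dual[OF x1] d]])
      have "m1 t * bieval (ddir (x t) e) (m t) (b t) * (1 + (m t)\<^sup>2) ^ N =
         bieval e (m t) (b t) * (2 * real N * m t * m1 t * (1 + (m t)\<^sup>2) ^ N / (1 + (m t)\<^sup>2))"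
        unfolding D by simp
      then show "(m1 t * bieval (ddir (x t) e) (m t) (b t) * (1 + (m t)\<^sup>2) ^ N -
         bieval e (m t) (b t) * (2 * real N * m t * m1 t * (1 + (m t)\<^sup>2) ^ N / (1 + (m t)\<^sup>2))) /
         ((1 + (m t)\<^sup>2) ^ N * (1 + (m t)\<^sup>2) ^ N) = 0" by simp
    qed (use P in simp)
  qed
  then have const: "bieval e (m s) (b s) / (1 + (m s)\<^sup>2) ^ N = bieval e (m t) (b t) / (1 + (m t)\<^sup>2) ^ N"
    if "s \<in> ?A" "t \<in> ?A" for s t
    using DERIV_isconst3[OF ac that, of "\<lambda>s. bieval e (m s) (b s) / (1 + (m s)\<^sup>2) ^ N"] by blast
  define K0 where "K0 = bieval e (m ((a+c)/2)) (b ((a+c)/2)) / (1 + (m ((a+c)/2))\<^sup>2) ^ N"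
  define E where "E = e - [:[:K0:]:] * unit_poly ^ N"
  have E_arc: "bieval E (m t) (b t) = 0" if "t \<in> ?A" for t
  proof -
    have "bieval e (m t) (b t) / (1 + (m t)\<^sup>2) ^ N = K0"
      using const[OF that, of "(a+c)/2"] ac by (simp add: K0_def)
    moreover have "(1 + (m t)\<^sup>2) ^ N \<noteq> 0" using one_plus_square_pos[of "m t"] by simp
    ultimately show ?thesis by (simp add: E_def field_simps)
  qed
  have "E \<noteq> 0"
  proof
    assume "E = 0"
    then have "bieval E u v = 0" for u v by simp
    then have "bieval e u v = K0 * (1 + u\<^sup>2) ^ N" for u v by (simp add: E_def)
    with nonconst[of K0] show False by blast
  qed
  moreover have "{t\<in>?A. bieval E (m t) (b t) = 0} = ?A" using E_arc by blast
  ultimately obtain f where f: "irreducible f" "f dvd E" and inf: "infinite {t\<in>?A. bieval f (m t) (b t) = 0}"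
    using exists_irreducible_factor[of E ?A m b] infA by auto
  \<comment> \<open>The transfer counts points of tangency rather than parameters; \<open>x\<close>
    is injective on the arc.\<close>
  have inf': "infinite {(x t, y t) | t. x1 t \<noteq> 0 \<and> bieval f (m t) (b t) = 0}"
  proof
    assume fin: "finite {(x t, y t) | t. x1 t \<noteq> 0 \<and> bieval f (m t) (b t) = 0}"
    have "x ` {t\<in>?A. bieval f (m t) (b t) = 0} \<subseteq> fst ` {(x t, y t) | t. x1 t \<noteq> 0 \<and> bieval f (m t) (b t) = 0}"
      using arc by (force simp: image_iff)
    then have "finite (x ` {t\<in>?A. bieval f (m t) (b t) = 0})" using fin finite_subset by blast
    moreover have "inj_on x {t\<in>?A. bieval f (m t) (b t) = 0}" using inj(1) by (rule inj_on_subset) auto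
    ultimately show False using inf finite_imageD by blast
  qed
  have f0: "bieval f (m t) (b t) = 0" if "t \<in> ?A" for t using transfer[OF inf'] arc that by blast
  have f_dvd: "f dvd q" if "T \<subseteq> ?A" "infinite T" "\<And>t. t \<in> T \<Longrightarrow> bieval q (m t) (b t) = 0" for q T
    using irreducible_dvd_of_common_zeros[OF f(1) that(2) inj_on_subset[OF inj(2) that(1)], of b q] f0 that by blast
  have prime: "prime_elem f" using f(1) by (rule irreducible_imp_prime_elem)
  have "\<not> is_unit f" using f(1) by (simp add: irreducible_def)
  then obtain g where E: "E = f ^ multiplicity f E * g" and g: "\<not> f dvd g"
    using multiplicity_decompose'[OF \<open>E \<noteq> 0\<close>, of f] by blast
  define k where "k = multiplicity f E"
  have E: "E = f ^ k * g" using E by (simp add: k_def)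
  have k: "k > 0" using E f(2) g by (cases k) auto
  \<comment> \<open>By degree, divisibility would mean \<open>f_b = 0\<close>. Then \<open>f\<close>
    would be a polynomial in the slope alone with infinitely many roots, as \<open>m\<close> is
    injective on the arc.\<close>
  have "\<not> f dvd pderiv f"
  proof
    assume dvd: "f dvd pderiv f"
    have "pderiv f = 0"
    proof (rule ccontr)
      assume n: "pderiv f \<noteq> 0"
      from dvd_imp_degree_le[OF dvd n] n show False by (simp add: degree_pderiv pderiv_eq_0_iff)
    qed
    then obtain p where p: "f = [:p:]" by (metis degree_eq_zeroE pderiv_eq_0_iff)
    with f(1) have "p \<noteq> 0" by (auto simp: irreducible_def)
    have "m ` ?A \<subseteq> {u. poly p u = 0}" using f0 by (auto simp: p)
    then have "finite (m ` ?A)" using poly_roots_finite[OF \<open>p \<noteq> 0\<close>] finite_subset by blast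
    then show False using inj(2) infA finite_imageD by blast
  qed
  with g prime have "\<not> f dvd pderiv f * g" using prime_elem_dvd_multD by blast
  \<comment> \<open>Near \<open>t0\<close> the factor \<open>f_b\<close> is nonzero, which makes
    \<open>H\<close> nonzero as well; \<open>g \<noteq> 0\<close> at \<open>t0\<close> will make the
    constant \<open>K\<close> nonzero.\<close>
  then obtain t0 where t0: "t0 \<in> ?A" "bieval (pderiv f * g) (m t0) (b t0) \<noteq> 0"
    using f_dvd[OF order_refl infA, of "pderiv f * g"] by blast
  have "isCont (\<lambda>t. bieval (pderiv f) (m t) (b t)) t0" using arc[OF t0(1)] isCont_bieval by blast
  then have "((\<lambda>t. bieval (pderiv f) (m t) (b t)) \<longlongrightarrow> bieval (pderiv f) (m t0) (b t0)) (nhds t0)"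
    using isCont_def tendsto_nhds_iff by blast
  then have "\<forall>\<^sub>F t in nhds t0. bieval (pderiv f) (m t) (b t) \<noteq> 0"
    by (rule tendsto_imp_eventually_ne) (use t0 in auto)
  moreover have "\<forall>\<^sub>F t in nhds t0. t \<in> ?A" using t0 by (intro eventually_nhds_in_open) auto
  ultimately have "\<forall>\<^sub>F t in nhds t0. bieval (pderiv f) (m t) (b t) \<noteq> 0 \<and> t \<in> ?A" by (rule eventually_conj)
  then obtain d where d: "d > 0" and dA: "\<And>t. t \<in> {t0 - d<..<t0 + d} \<Longrightarrow>
      bieval (pderiv f) (m t) (b t) \<noteq> 0 \<and> t \<in> ?A"
    by (rule eventually_nhds_interval) blast
  let ?B = "{t0 - d<..<t0 + d}"
  have B: "t \<in> ?A" "bieval (pderiv f) (m t) (b t) \<noteq> 0" if "t \<in> ?B" for t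
    using dA[OF that] by auto
  have first: "bieval (dfst f) (m t) (b t) = x t * bieval (pderiv f) (m t) (b t)" if t: "t \<in> ?A" for t
  proof (rule dual_first_order)
    have "\<forall>\<^sub>F s in nhds t. s \<in> ?A" using t by (intro eventually_nhds_in_open) auto
    then show "\<forall>\<^sub>F s in nhds t. bieval f (m s) (b s) = 0" by eventually_elim (rule f0)
  qed (use arc[OF t] in auto)
  have second: "bieval (ddir (x t) (ddir (x t) f)) (m t) (b t) \<noteq> 0" if t: "t \<in> ?B" for t
  proof -
    have "\<forall>\<^sub>F s in nhds t. s \<in> ?A" using B(1)[OF t] by (intro eventually_nhds_in_open) auto
    then have "\<forall>\<^sub>F s in nhds t. bieval (dfst f) (m s) (b s) = x s * bieval (pderiv f) (m s) (b s)"
      by eventually_elim (rule first)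
    from dual_second_order[OF this] show ?thesis using arc[OF B(1)[OF t]] B(2)[OF t] by auto
  qed
  \<comment> \<open>With \<open>w\<close>, \<open>v\<close> the second and third derivative of
    \<open>f\<close> along the pencil and \<open>G\<close>, \<open>G1\<close> the value and
    derivative of \<open>g\<close>, the third order relation reads
    \<open>3 G1 / G + k v / w = 6 (N - k) m / (1 + m^2)\<close> where \<open>G \<noteq> 0\<close>.
    Since \<open>H = w f_b^2\<close> has directional derivative \<open>v f_b^2\<close>, this is the
    vanishing of the logarithmic derivative of \<open>A\<close>.\<close>
  define A where "A t = bieval (g ^ 3 * hess f ^ k) (m t) (b t) * (1 + (m t)\<^sup>2) ^ (3 * k) / (1 + (m t)\<^sup>2) ^ (3 * N)" for t
  have dA0: "(A has_real_derivative 0) (at t)" if t: "t \<in> ?B" for t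
  proof -
    note tA = B(1)[OF t]
    have x1: "x1 t \<noteq> 0" and r: "reflection_invariant e N (m t) (x t) (y t)" using arc[OF tA] by auto
    have r: "reflection_invariant (f ^ k * g) N (m t) (x t) (y t)"
      using reflection_invariant_diff[OF r, of K0] by (simp add: E[symmetric] E_def)
    define P where "P = 1 + (m t)\<^sup>2"
    have P: "P \<noteq> 0" using one_plus_square_pos[of "m t"] by (simp add: P_def)
    define w where "w = bieval (ddir (x t) (ddir (x t) f)) (m t) (b t)"
    define v where "v = bieval (ddir (x t) (ddir (x t) (ddir (x t) f))) (m t) (b t)"
    define fb where "fb = bieval (pderiv f) (m t) (b t)"
    define G where "G = bieval g (m t) (b t)"
    define G1 where "G1 = bieval (ddir (x t) g) (m t) (b t)"
    define H where "H = bieval (hess f) (m t) (b t)"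
    have w: "w \<noteq> 0" using second[OF t] by (simp add: w_def)
    have fb: "fb \<noteq> 0" using B(2)[OF t] by (simp add: fb_def)
    have rel: "P * (real k * v * G + 3 * w * G1) = 6 * (real N - real k) * m t * w * G"
      unfolding P_def v_def w_def G_def G1_def
      by (rule reflection_invariant_third_order[OF r])
         (use f0[OF tA] first[OF tA] second[OF t] in \<open>auto simp: b_def bieval_ddir\<close>)
    have H: "H = w * fb\<^sup>2" unfolding H_def w_def fb_def by (rule bieval_hess[OF first[OF tA]])
    have H1: "bieval (ddir (x t) (hess f)) (m t) (b t) = v * fb\<^sup>2"
      unfolding v_def fb_def by (rule bieval_ddir_hess[OF first[OF tA]])
    have Hnz: "H \<noteq> 0" using H w fb by simp
    have dg: "((\<lambda>t. bieval (g ^ 3) (m t) (b t)) has_real_derivative 3 * G\<^sup>2 * (m1 t * G1)) (at t)"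
      using DERIV_power[OF DERIV_bieval_dual[OF x1, of g], of 3] by (simp add: G_def G1_def algebra_simps)
    have dh: "((\<lambda>t. bieval (hess f ^ k) (m t) (b t)) has_real_derivative real k * H ^ k / H * (m1 t * (v * fb\<^sup>2))) (at t)"
      using DERIV_power[OF DERIV_bieval_dual[OF x1, of "hess f"], of k] Hnz k H1
      by (cases k) (simp_all add: H_def field_simps)
    have dP: "((\<lambda>s. (1 + (m s)\<^sup>2) ^ n) has_real_derivative 2 * real n * m t * m1 t * P ^ n / P) (at t)" for n
      unfolding P_def by (rule DERIV_unit_power[OF x1])
    have Pn: "(1 + (m t)\<^sup>2) ^ (3 * N) \<noteq> 0" using P by (simp add: P_def)
    have key: "(3 * G\<^sup>2 * (m1 t * G1) * H ^ k + real k * H ^ k / H * (m1 t * (v * fb\<^sup>2)) * G ^ 3) * P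
       + (G ^ 3 * H ^ k) * (6 * real k * m t * m1 t) - (G ^ 3 * H ^ k) * (6 * real N * m t * m1 t) = 0"
    proof -
      have L: "real k * H ^ k / H * (m1 t * (v * fb\<^sup>2)) * G ^ 3 = m1 t * G\<^sup>2 * H ^ k * (real k * v * G) / w"
        using w fb by (simp add: H field_simps power3_eq_cube power2_eq_square)
      have "(3 * G\<^sup>2 * (m1 t * G1) * H ^ k + real k * H ^ k / H * (m1 t * (v * fb\<^sup>2)) * G ^ 3) * P =
          m1 t * G\<^sup>2 * H ^ k * (P * (real k * v * G + 3 * w * G1)) / w"
        unfolding L using w by (simp add: field_simps)
      also have "\<dots> = m1 t * G\<^sup>2 * H ^ k * (6 * (real N - real k) * m t * G)"
        unfolding rel using w by simp
      finally show ?thesis by (simp add: algebra_simps power3_eq_cube power2_eq_square)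
    qed
    let ?num = "G ^ 3 * H ^ k"
    let ?dnum = "3 * G\<^sup>2 * (m1 t * G1) * H ^ k + real k * H ^ k / H * (m1 t * (v * fb\<^sup>2)) * G ^ 3"
    have "(A has_real_derivative
       ((?dnum * P ^ (3 * k) + 2 * real (3 * k) * m t * m1 t * P ^ (3 * k) / P * ?num) * P ^ (3 * N) -
        ?num * P ^ (3 * k) * (2 * real (3 * N) * m t * m1 t * P ^ (3 * N) / P)) / (P ^ (3 * N) * P ^ (3 * N))) (at t)"
      unfolding A_def[abs_def]
      by (rule DERIV_cong[OF DERIV_divide[OF DERIV_mult[OF _ dP] dP Pn]], simp, rule DERIV_mult[OF dg dh, simplified])
         (simp add: G_def H_def P_def)
    moreover have "(?dnum * P ^ (3 * k) + 2 * real (3 * k) * m t * m1 t * P ^ (3 * k) / P * ?num) * P ^ (3 * N) -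
        ?num * P ^ (3 * k) * (2 * real (3 * N) * m t * m1 t * P ^ (3 * N) / P) =
        (?dnum * P + ?num * (6 * real k * m t * m1 t) - ?num * (6 * real N * m t * m1 t)) * (P ^ (3 * k) * P ^ (3 * N) / P)"
      using P by (simp add: field_simps)
    ultimately show ?thesis unfolding key by simp
  qed
  have t0B: "t0 \<in> ?B" using d by simp
  define K where "K = A t0"
  have AK: "A t = K" if "t \<in> ?B" for t
    unfolding K_def using DERIV_isconst3[of "t0 - d" "t0 + d" t t0 A] dA0 that t0B d by force
  have "K \<noteq> 0"
    using bieval_hess[OF first[OF t0(1)]] second[OF t0B] t0(2) one_plus_square_pos[of "m t0"]
    by (simp add: K_def A_def)
  \<comment> \<open>Constancy of \<open>A\<close> with denominators cleared. As a multiple of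
    \<open>f\<close>, \<open>I\<close> vanishes at all real zeros of \<open>f\<close> and not only
    along the arc.\<close>
  define I where "I = g ^ 3 * hess f ^ k * unit_poly ^ (3 * k) - [:[:K:]:] * unit_poly ^ (3 * N)"
  have "f dvd I"
  proof (rule f_dvd[of ?B])
    fix t assume t: "t \<in> ?B"
    have "(1 + (m t)\<^sup>2) ^ (3 * N) \<noteq> 0" using one_plus_square_pos[of "m t"] by simp
    then show "bieval I (m t) (b t) = 0" using AK[OF t] by (simp add: I_def A_def field_simps)
  qed (use B(1) d in auto)
  have "bieval (hess f) u v \<noteq> 0" if "bieval f u v = 0" for u v
  proof
    assume h: "bieval (hess f) u v = 0"
    obtain J where "I = f * J" using \<open>f dvd I\<close> by blast
    then have "bieval I u v = 0" using that by simp
    \<comment> \<open>Since \<open>k > 0\<close>, a zero of \<open>H\<close> kills the first product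
      of \<open>I\<close>; what is left has no real zero.\<close>
    then have "K * (1 + u\<^sup>2) ^ (3 * N) = 0" using h k by (simp add: I_def power_0_left)
    with \<open>K \<noteq> 0\<close> one_plus_square_pos[of u] show False by simp
  qed
  with inf' show ?thesis by blast
qed

end

section \<open>Regularity of the ovals and local coincidence of common tangents\<close>

lemma continuous_bieval: "isCont (\<lambda>z. bieval p (fst z) (snd z)) (w :: real \<times> real)"
proof (induction p)
  case (pCons c p)
  have "isCont (\<lambda>z. poly c (fst z)) w"
    by (induction c) (auto intro!: continuous_intros)
  then show ?case using pCons by (auto intro!: continuous_intros)
qed simp

context plane_curve
begin

text \<open>Where \<open>m1 \<noteq> 0\<close> the first order relation follows from
  \<open>f = 0\<close>; such parameters are dense by \<open>bent\<close>, and continuity gives it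
  everywhere. Then \<open>H = w f_b^2\<close>, with \<open>w\<close> the second derivative along the
  pencil, forces \<open>f_b \<noteq> 0\<close>, and the second order identity excludes
  inflections.\<close>

lemma dual_regular:
  assumes zero: "\<And>t. x1 t \<noteq> 0 \<Longrightarrow> bieval f (m t) (b t) = 0"
    and nd: "\<And>u v. bieval f u v = 0 \<Longrightarrow> bieval (hess f) u v \<noteq> 0"
    and bent: "\<And>t. x1 t \<noteq> 0 \<Longrightarrow> \<exists>\<^sub>F s in nhds t. m1 s \<noteq> 0"
    and t: "x1 t \<noteq> 0"
  shows "bieval (dfst f) (m t) (b t) = x t * bieval (pderiv f) (m t) (b t)"
    and "bieval (pderiv f) (m t) (b t) \<noteq> 0" and "m1 t \<noteq> 0"
proof -
  have first: "bieval (dfst f) (m t) (b t) = x t * bieval (pderiv f) (m t) (b t)" if t: "x1 t \<noteq> 0" for t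
  proof (rule ccontr)
    assume ne: "bieval (dfst f) (m t) (b t) \<noteq> x t * bieval (pderiv f) (m t) (b t)"
    define h where "h s = bieval (dfst f) (m s) (b s) - x s * bieval (pderiv f) (m s) (b s)" for s
    have "isCont h t" unfolding h_def[abs_def]
      by (intro continuous_intros isCont_bieval t DERIV_isCont[OF DERIV_x])
    then have "(h \<longlongrightarrow> h t) (nhds t)" using isCont_def tendsto_nhds_iff by blast
    then have "\<forall>\<^sub>F s in nhds t. h s \<noteq> 0"
      by (rule tendsto_imp_eventually_ne) (use ne in \<open>simp add: h_def\<close>)
    then have "\<forall>\<^sub>F s in nhds t. m1 s = 0"
      using eventually_x1[OF t]
    proof eventually_elim
      case (elim s)
      show ?case
      proof (rule ccontr)
        assume "m1 s \<noteq> 0"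
        moreover have "\<forall>\<^sub>F r in nhds s. bieval f (m r) (b r) = 0"
          using eventually_x1[OF elim(2)] by eventually_elim (rule zero)
        ultimately have "h s = 0" using dual_first_order[of f s] elim(2) by (simp add: h_def)
        with elim show False by simp
      qed
    qed
    with bent[OF t] show False by (simp add: frequently_def)
  qed
  show 1: "bieval (dfst f) (m t) (b t) = x t * bieval (pderiv f) (m t) (b t)" by (rule first[OF t])
  show 2: "bieval (pderiv f) (m t) (b t) \<noteq> 0"
    using bieval_hess[OF 1] nd[OF zero[OF t]] by auto
  have "\<forall>\<^sub>F s in nhds t. bieval (dfst f) (m s) (b s) = x s * bieval (pderiv f) (m s) (b s)"
    using eventually_x1[OF t] by eventually_elim (rule first)
  from dual_second_order[OF this t] 2 t show "m1 t \<noteq> 0" by auto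
qed

end

text \<open>A straight piece would put infinitely many points of \<open>Z\<close> on one line, hence
  all of \<open>Z\<close>, contradicting the curvature of the reference curve at
  \<open>t0\<close>.\<close>

lemma curve_not_locally_straight:
  assumes Z: "zariski_irreducible Z"
    and c: "plane_curve x y x1 y1 x2 y2" "\<And>s. (x s, y s) \<in> Z" "plane_curve.m1 x1 y1 x2 y2 t0 \<noteq> 0"
    and p: "plane_curve px py px1 py1 px2 py2" "\<And>s. (px s, py s) \<in> Z" and t: "px1 t \<noteq> 0"
  shows "\<exists>\<^sub>F s in nhds t. plane_curve.m1 px1 py1 px2 py2 s \<noteq> 0"
proof (rule ccontr)
  interpret c: plane_curve x y x1 y1 x2 y2 by fact
  interpret p: plane_curve px py px1 py1 px2 py2 by fact
  assume "\<not> (\<exists>\<^sub>F s in nhds t. p.m1 s \<noteq> 0)"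
  then have "\<forall>\<^sub>F s in nhds t. p.m1 s = 0" by (simp add: frequently_def)
  with p.eventually_x1[OF t] have "\<forall>\<^sub>F s in nhds t. px1 s \<noteq> 0 \<and> p.m1 s = 0" by (rule eventually_conj)
  then obtain d where d: "d > 0" and D: "\<And>s. s \<in> {t - d<..<t + d} \<Longrightarrow> px1 s \<noteq> 0 \<and> p.m1 s = 0"
    by (rule eventually_nhds_interval) blast
  let ?B = "{t - d<..<t + d}"
  have B: "px1 s \<noteq> 0" "p.m1 s = 0" if "s \<in> ?B" for s using D[OF that] by auto
  have lt: "t - d < t + d" and tB: "t \<in> ?B" using d by auto
  have m: "p.m s = p.m t" and b: "p.b s = p.b t" if "s \<in> ?B" for s
    using DERIV_isconst3[OF lt that tB, of p.m] DERIV_isconst3[OF lt that tB, of p.b]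
      p.DERIV_m p.DERIV_b B by force+
  define Q where "Q = [:[:- p.b t, - p.m t:], 1:]"
  have Q: "bieval Q u v = v - p.m t * u - p.b t" for u v by (simp add: Q_def)
  have "inj_on px ?B" by (rule inj_on_DERIV_nonzero[OF p.DERIV_x B(1)])
  then have "inj_on (\<lambda>s. (px s, py s)) ?B" by (auto simp: inj_on_def)
  then have "infinite ((\<lambda>s. (px s, py s)) ` ?B)" using lt finite_imageD infinite_Ioo by blast
  moreover have "(\<lambda>s. (px s, py s)) ` ?B \<subseteq> {z\<in>Z. bieval Q (fst z) (snd z) = 0}"
  proof (clarsimp simp: p(2))
    fix s assume "t - d < s" "s < t + d"
    then show "bieval Q (px s) (py s) = 0" using m[of s] b[of s] by (simp add: Q p.b_def)
  qed
  ultimately have "infinite {z\<in>Z. bieval Q (fst z) (snd z) = 0}" using finite_subset by blast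
  then have "\<forall>z\<in>Z. bieval Q (fst z) (snd z) = 0" using Z unfolding zariski_irreducible_def by blast
  then have y: "y s = p.m t * x s + p.b t" for s using c(2)[of s] by (auto simp: Q)
  have y1: "y1 s = p.m t * x1 s" for s
  proof (rule DERIV_unique[OF c.DERIV_y])
    show "(y has_real_derivative p.m t * x1 s) (at s)"
      unfolding y[abs_def] by (auto intro!: derivative_eq_intros c.DERIV_x)
  qed
  have y2: "y2 s = p.m t * x2 s" for s
  proof (rule DERIV_unique[OF c.DERIV_y1])
    show "(y1 has_real_derivative p.m t * x2 s) (at s)"
      unfolding y1[abs_def] by (auto intro!: derivative_eq_intros c.DERIV_x1)
  qed
  show False using c(3) by (simp add: c.m1_def y1 y2)
qed

text \<open>The uniqueness half of the implicit function theorem: near the point, \<open>f\<close>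
  is injective in its second variable by Rolle.\<close>

lemma zero_unique_in_second_variable:
  assumes "bieval (pderiv f) u v \<noteq> 0"
  obtains d where "d > 0" and "\<And>u' v1 v2. \<lbrakk>\<bar>u' - u\<bar> < d; \<bar>v1 - v\<bar> < d; \<bar>v2 - v\<bar> < d;
     bieval f u' v1 = 0; bieval f u' v2 = (0::real)\<rbrakk> \<Longrightarrow> v1 = v2"
proof -
  have "((\<lambda>z. bieval (pderiv f) (fst z) (snd z)) \<longlongrightarrow> bieval (pderiv f) (fst (u, v)) (snd (u, v))) (at (u, v))"
    using continuous_bieval[where p = "pderiv f" and w = "(u, v)"] unfolding isCont_def .
  then have "\<forall>\<^sub>F z in at (u, v). bieval (pderiv f) (fst z) (snd z) \<noteq> 0"
    by (rule tendsto_imp_eventually_ne) (use assms in simp)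
  then have "\<forall>\<^sub>F z in nhds (u, v). bieval (pderiv f) (fst z) (snd z) \<noteq> 0"
    using assms by (simp add: eventually_nhds_conv_at)
  then obtain e where e: "e > 0" and E: "\<And>z. dist z (u, v) < e \<Longrightarrow> bieval (pderiv f) (fst z) (snd z) \<noteq> 0"
    by (auto simp: eventually_nhds_metric)
  have E': "bieval (pderiv f) u' v' \<noteq> 0" if "\<bar>u' - u\<bar> < e / 2" "\<bar>v' - v\<bar> < e / 2" for u' v'
  proof -
    have "dist (u', v') (u, v) \<le> \<bar>u' - u\<bar> + \<bar>v' - v\<bar>"
      using sqrt_sum_squares_le_sum_abs[of "u' - u" "v' - v"] by (simp add: dist_Pair_Pair dist_real_def)
    then show ?thesis using E[of "(u', v')"] that by simp
  qed
  have "v1 = v2" if h: "\<bar>u' - u\<bar> < e / 2" "\<bar>v1 - v\<bar> < e / 2" "\<bar>v2 - v\<bar> < e / 2"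
     "bieval f u' v1 = 0" "bieval f u' v2 = 0" for u' v1 v2
  proof -
    have d: "((\<lambda>v. bieval f u' v) has_real_derivative bieval (pderiv f) u' s) (at s)" for s
      using DERIV_bieval[OF DERIV_const[of u'] DERIV_ident, of f] by simp
    have "inj_on (bieval f u') {v - e/2<..<v + e/2}"
    proof (rule inj_on_DERIV_nonzero[OF d])
      fix s assume "s \<in> {v - e/2<..<v + e/2}"
      then have "\<bar>s - v\<bar> < e / 2" unfolding abs_less_iff by auto
      then show "bieval (pderiv f) u' s \<noteq> 0" by (rule E'[OF h(1)])
    qed
    moreover have "v1 \<in> {v - e/2<..<v + e/2}" "v2 \<in> {v - e/2<..<v + e/2}"
      using h(2,3) unfolding abs_less_iff by auto
    ultimately show ?thesis using h(4,5) inj_onD[of "bieval f u'" "{v - e/2<..<v + e/2}" v1 v2] by simp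
  qed
  with e show thesis by (intro that[of "e / 2"]) auto
qed

text \<open>The billiard arc serves only to produce \<open>f\<close>. The two ovals then enter
  through their dual arcs, both contained in \<open>f = 0\<close>, which near the common line is a
  graph over the slope.\<close>

theorem common_tangent_local:
  assumes Z: "zariski_irreducible Z"
    and c: "plane_curve x y x1 y1 x2 y2" "\<And>s. (x s, y s) \<in> Z" and a: "a < a'"
    and arc: "\<And>t. t \<in> {a<..<a'} \<Longrightarrow> x1 t \<noteq> 0 \<and> plane_curve.m1 x1 y1 x2 y2 t \<noteq> 0 \<and>
       reflection_invariant e N (plane_curve.m x1 y1 t) (x t) (y t)"
    and nonconst: "\<And>K. \<exists>u v. bieval e u v \<noteq> K * (1 + u\<^sup>2) ^ N"
    and p: "plane_curve px py px1 py1 px2 py2" "\<And>s. (px s, py s) \<in> Z"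
    and q: "plane_curve qx qy qx1 qy1 qx2 qy2" "\<And>s. (qx s, qy s) \<in> Z"
    and t: "px1 t \<noteq> 0" and u: "qx1 u \<noteq> 0"
    and m: "plane_curve.m px1 py1 t = plane_curve.m qx1 qy1 u"
    and b: "plane_curve.b px py px1 py1 t = plane_curve.b qx qy qx1 qy1 u"
  shows "px t = qx u" "py t = qy u"
    and "\<forall>\<^sub>F s in nhds t. \<exists>r. px1 s \<noteq> 0 \<and> qx1 r \<noteq> 0 \<and>
      plane_curve.m px1 py1 s = plane_curve.m qx1 qy1 r \<and>
      plane_curve.b px py px1 py1 s = plane_curve.b qx qy qx1 qy1 r"
proof -
  interpret c: plane_curve x y x1 y1 x2 y2 by fact
  interpret p: plane_curve px py px1 py1 px2 py2 by fact
  interpret q: plane_curve qx qy qx1 qy1 qx2 qy2 by fact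
  have infZ: "infinite (fst ` Z)"
  proof
    assume fin: "finite (fst ` Z)"
    have "inj_on x {a<..<a'}" by (rule inj_on_DERIV_nonzero[OF c.DERIV_x]) (use arc in auto)
    moreover have "x ` {a<..<a'} \<subseteq> fst ` Z" using c(2) by force
    ultimately show False using fin finite_subset finite_imageD infinite_Ioo[OF a] by metis
  qed
  obtain f where inf: "infinite {(x t, y t) | t. x1 t \<noteq> 0 \<and> bieval f (c.m t) (c.b t) = 0}"
    and nd: "\<And>u v. bieval f u v = 0 \<Longrightarrow> bieval (hess f) u v \<noteq> 0"
  proof -
    have "\<exists>f. infinite {(x t, y t) | t. x1 t \<noteq> 0 \<and> bieval f (c.m t) (c.b t) = 0} \<and>
       (\<forall>u v. bieval f u v = 0 \<longrightarrow> bieval (hess f) u v \<noteq> 0)"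
    proof (rule c.dual_nondegenerate[OF a arc nonconst])
      fix f t assume "infinite {(x t, y t) | t. x1 t \<noteq> 0 \<and> bieval f (c.m t) (c.b t) = 0}" "x1 t \<noteq> 0"
      then show "bieval f (c.m t) (c.b t) = 0" by (rule tangent_relation_transfer[OF Z infZ c _ c])
    qed
    then show thesis using that by blast
  qed
  have curved: "c.m1 ((a + a') / 2) \<noteq> 0" using arc[of "(a + a') / 2"] a by simp
  note zp = tangent_relation_transfer[OF Z infZ c inf p]
  note zq = tangent_relation_transfer[OF Z infZ c inf q]
  note bp = curve_not_locally_straight[OF Z c curved p]
  note bq = curve_not_locally_straight[OF Z c curved q]
  have rp: "bieval (dfst f) (p.m s) (p.b s) = px s * bieval (pderiv f) (p.m s) (p.b s)"
     "bieval (pderiv f) (p.m s) (p.b s) \<noteq> 0" "p.m1 s \<noteq> 0" if s: "px1 s \<noteq> 0" for s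
    using p.dual_regular[where f = f, OF _ _ _ s] zp nd bp by blast+
  have rq: "bieval (dfst f) (q.m s) (q.b s) = qx s * bieval (pderiv f) (q.m s) (q.b s)"
     "bieval (pderiv f) (q.m s) (q.b s) \<noteq> 0" "q.m1 s \<noteq> 0" if s: "qx1 s \<noteq> 0" for s
    using q.dual_regular[where f = f, OF _ _ _ s] zq nd bq by blast+
  \<comment> \<open>Duality recovers the abscissa of tangency from the line alone, as
    \<open>f_m / f_b\<close>.\<close>
  show xx: "px t = qx u" using rp(1,2)[OF t] rq(1)[OF u] m b by simp
  show "py t = qy u" using b xx m by (simp add: p.b_def q.b_def)
  obtain d where d: "d > 0" and unique: "\<And>u' v1 v2. \<lbrakk>\<bar>u' - p.m t\<bar> < d; \<bar>v1 - p.b t\<bar> < d; \<bar>v2 - p.b t\<bar> < d;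
     bieval f u' v1 = 0; bieval f u' v2 = 0\<rbrakk> \<Longrightarrow> v1 = v2"
    by (rule zero_unique_in_second_variable[OF rp(2)[OF t]]) blast
  have near: "\<forall>\<^sub>F s in nhds t. \<bar>p.m s - p.m t\<bar> < d \<and> \<bar>p.b s - p.b t\<bar> < d"
  proof (rule eventually_conj)
    have "(p.m \<longlongrightarrow> p.m t) (nhds t)" "(p.b \<longlongrightarrow> p.b t) (nhds t)"
      using DERIV_isCont[OF p.DERIV_m[OF t]] DERIV_isCont[OF p.DERIV_b[OF t]] isCont_def tendsto_nhds_iff by blast+
    then show "\<forall>\<^sub>F s in nhds t. \<bar>p.m s - p.m t\<bar> < d" "\<forall>\<^sub>F s in nhds t. \<bar>p.b s - p.b t\<bar> < d"
      using d by (auto dest!: tendstoD simp: dist_real_def)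
  qed
  have "\<forall>\<^sub>F s in nhds u. \<bar>q.b s - q.b u\<bar> < d"
  proof -
    have "(q.b \<longlongrightarrow> q.b u) (nhds u)"
      using DERIV_isCont[OF q.DERIV_b[OF u]] isCont_def tendsto_nhds_iff by blast
    then show ?thesis using d by (auto dest!: tendstoD simp: dist_real_def)
  qed
  then have "\<forall>\<^sub>F s in nhds u. qx1 s \<noteq> 0 \<and> \<bar>q.b s - q.b u\<bar> < d"
    using q.eventually_x1[OF u] by eventually_elim simp
  then obtain r where r: "r > 0" and R: "\<And>s. s \<in> {u - r<..<u + r} \<Longrightarrow> qx1 s \<noteq> 0 \<and> \<bar>q.b s - q.b u\<bar> < d"
    by (rule eventually_nhds_interval) blast
  let ?B = "{u - r<..<u + r}"
  have B: "qx1 s \<noteq> 0" "\<bar>q.b s - q.b u\<bar> < d" if "s \<in> ?B" for s using R[OF that] by auto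
  \<comment> \<open>Without inflections the slope is an open map on the second oval, so every slope
    near the common one is attained there close to \<open>u\<close>; equality of the intercepts then
    follows from uniqueness.\<close>
  have "inj_on q.m ?B" by (rule inj_on_DERIV_nonzero[OF q.DERIV_m]) (use B(1) rq(3) in auto)
  moreover have "continuous_on ?B q.m"
    using B(1) by (intro continuous_at_imp_continuous_on ballI DERIV_isCont[OF q.DERIV_m])
  ultimately have "open (q.m ` ?B)" by (intro invariance_of_domain) auto
  moreover have "p.m t \<in> q.m ` ?B" using m r by auto
  ultimately have "\<forall>\<^sub>F w in nhds (p.m t). w \<in> q.m ` ?B" by (rule eventually_nhds_in_open)
  moreover have "filterlim p.m (nhds (p.m t)) (nhds t)"
    using DERIV_isCont[OF p.DERIV_m[OF t]] isCont_def tendsto_nhds_iff by blast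
  ultimately have "\<forall>\<^sub>F s in nhds t. p.m s \<in> q.m ` ?B" by (rule eventually_compose_filterlim)
  with near p.eventually_x1[OF t]
  show "\<forall>\<^sub>F s in nhds t. \<exists>r. px1 s \<noteq> 0 \<and> qx1 r \<noteq> 0 \<and> p.m s = q.m r \<and> p.b s = q.b r"
  proof eventually_elim
    case (elim s)
    then obtain w where w: "w \<in> ?B" "p.m s = q.m w" by auto
    have "p.b s = q.b w"
      by (rule unique[of "p.m s"]) (use elim w zp[of s] zq[OF B(1)[OF w(1)]] B(2)[OF w(1)] b in auto)
    with elim w B(1) show ?case by blast
  qed
qed

section \<open>The two sides of a smooth closed curve\<close>

lemma inside_linear_iso:
  fixes f :: "'a::euclidean_space \<Rightarrow> 'b::euclidean_space"
  assumes f: "linear f" and g: "linear g" and gf: "\<And>x. g (f x) = x" and fg: "\<And>y. f (g y) = y"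
  shows "inside (f ` S) = f ` inside S" "outside (f ` S) = f ` outside S"
proof -
  have inj: "inj f" by (metis gf injI)
  have im: "- f ` S = f ` (- S)"
  proof -
    have "surj f" using fg by (metis surjI)
    with inj show ?thesis by (simp add: bij_image_Compl_eq bij_def)
  qed
  have "homeomorphism (- S) (- f ` S) f g"
    unfolding homeomorphism_def im
    using f g by (auto simp: gf fg image_image intro!: linear_continuous_on linear_conv_bounded_linear[THEN iffD1])
  then have cc: "connected_component_set (- f ` S) (f x) = f ` connected_component_set (- S) x" if "x \<notin> S" for x
    using that by (intro connected_component_set_homeomorphism) auto
  have bd: "bounded (f ` T) \<longleftrightarrow> bounded T" for T
  proof
    assume "bounded (f ` T)"
    then have "bounded (g ` f ` T)" using g bounded_linear_image[of "f ` T" g] by (simp add: linear_conv_bounded_linear)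
    then show "bounded T" by (simp add: image_image gf)
  next
    assume "bounded T"
    then show "bounded (f ` T)" using f bounded_linear_image[of T f] by (simp add: linear_conv_bounded_linear)
  qed
  have mem: "f x \<in> f ` S \<longleftrightarrow> x \<in> S" for x S using inj by (simp add: inj_image_mem_iff)
  have "f x \<in> inside (f ` S) \<longleftrightarrow> x \<in> inside S" for x
    unfolding inside_def using cc[of x] bd mem by auto
  then show 1: "inside (f ` S) = f ` inside S"
    by (metis (no_types, lifting) fg image_iff mem subsetI subset_antisym)
  have "outside (f ` S) = - (f ` S \<union> f ` inside S)" unfolding 1[symmetric] by (rule outside_inside)
  also have "\<dots> = f ` outside S"
    unfolding outside_inside[of S] image_Un[symmetric] using inj fg by (metis bij_image_Compl_eq bijI surjI)
  finally show "outside (f ` S) = f ` outside S" .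
qed

text \<open>The Jordan curve theorem for \<open>complex\<close>, moved along the linear isomorphism
  with \<open>real^2\<close>.\<close>

lemma Jordan_real2:
  fixes \<gamma> :: "real \<Rightarrow> real^2"
  assumes "simple_path \<gamma>" "pathfinish \<gamma> = pathstart \<gamma>"
  shows "connected (inside (path_image \<gamma>))" "open (inside (path_image \<gamma>))"
    "path_image \<gamma> \<subseteq> closure (inside (path_image \<gamma>))" "path_image \<gamma> \<subseteq> closure (outside (path_image \<gamma>))"
proof -
  define f :: "real^2 \<Rightarrow> complex" where "f q = Complex (q $ 1) (q $ 2)" for q
  define g :: "complex \<Rightarrow> real^2" where "g z = vector [Re z, Im z]" for z
  have lin: "linear f" "linear g"
    by (auto simp: f_def g_def complex_eq_iff vec_eq_iff forall_2 intro!: linearI)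
  have gf: "g (f x) = x" and fg: "f (g y) = y" for x y
    by (auto simp: f_def g_def complex_eq_iff vec_eq_iff forall_2)
  have inj: "inj f" by (metis gf injI)
  have sp: "simple_path (f \<circ> \<gamma>)" using assms(1) lin(1) inj by (simp add: simple_path_linear_image_eq)
  have "pathfinish (f \<circ> \<gamma>) = pathstart (f \<circ> \<gamma>)"
    using assms(2) by (simp add: pathfinish_compose pathstart_compose)
  note J = Jordan_inside_outside[OF sp this]
  have pim: "path_image (f \<circ> \<gamma>) = f ` path_image \<gamma>" by (rule path_image_compose)
  note io = inside_linear_iso[OF lin gf fg, of "path_image \<gamma>"]
  have cl: "closure (f ` S) = f ` closure S" for S
    using closure_injective_linear_image[OF lin(1) inj] by simp
  have "connected (g ` f ` inside (path_image \<gamma>))"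
    by (rule connected_linear_image[OF lin(2)]) (use J in \<open>simp add: pim io\<close>)
  then show "connected (inside (path_image \<gamma>))" by (simp add: image_image gf)
  show "open (inside (path_image \<gamma>))"
    by (simp add: assms(1) closed_simple_path_image open_inside)
  have "f ` path_image \<gamma> \<subseteq> closure (f ` inside (path_image \<gamma>))"
    using J unfolding pim io by (auto simp: frontier_def)
  then show "path_image \<gamma> \<subseteq> closure (inside (path_image \<gamma>))"
    unfolding cl using inj by (simp add: inj_image_subset_iff)
  have "f ` path_image \<gamma> \<subseteq> closure (f ` outside (path_image \<gamma>))"
    using J unfolding pim io by (auto simp: frontier_def)
  then show "path_image \<gamma> \<subseteq> closure (outside (path_image \<gamma>))"
    unfolding cl using inj by (simp add: inj_image_subset_iff)
qed

section \<open>Cones about the normal of a smooth curve\<close>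

lemma smooth_simple_closed_curveE:
  assumes "smooth_simple_closed_curve \<gamma>"
  obtains D1 D2 where "\<And>t. (\<gamma> has_vector_derivative D1 t) (at t)" "\<And>t. (D1 has_vector_derivative D2 t) (at t)"
    "\<And>t. D1 t \<noteq> 0" "\<And>t. vector_derivative \<gamma> (at t) = D1 t" "\<And>t. isCont D2 t"
proof -
  obtain D where D: "D 0 = \<gamma>" "\<And>k t. (D k has_vector_derivative D (Suc k) t) (at t)"
    using assms by (auto simp: smooth_simple_closed_curve_def smooth_curve_def)
  have "vector_derivative \<gamma> (at t) = D 1 t" for t
    using D(2)[of 0 t] by (simp add: D(1) vector_derivative_at)
  moreover have "isCont (D 2) t" for t by (rule has_vector_derivative_continuous[OF D(2)])
  ultimately show thesis using D(2)[of 0] D(2)[of 1] assms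
    by (intro that[of "D 1" "D 2"]) (auto simp: D(1) smooth_simple_closed_curve_def numeral_2_eq_2)
qed

lemma orthonormal_frame_norm:
  fixes w \<tau> :: "real^2"
  assumes "norm \<tau> = 1"
  shows "(w \<bullet> \<tau>)\<^sup>2 + (w \<bullet> vector [- \<tau> $ 2, \<tau> $ 1])\<^sup>2 = (norm w)\<^sup>2"
proof -
  have "(\<tau> $ 1)\<^sup>2 + (\<tau> $ 2)\<^sup>2 = 1"
    using assms power2_norm_eq_inner[of \<tau>] by (simp add: inner_vec_def sum_2 power2_eq_square)
  moreover have "(w \<bullet> \<tau>)\<^sup>2 + (w \<bullet> vector [- \<tau> $ 2, \<tau> $ 1])\<^sup>2 = ((w $ 1)\<^sup>2 + (w $ 2)\<^sup>2) * ((\<tau> $ 1)\<^sup>2 + (\<tau> $ 2)\<^sup>2)"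
    by (simp add: inner_vec_def sum_2 power2_eq_square algebra_simps)
  ultimately show ?thesis
    unfolding power2_norm_eq_inner by (simp add: inner_vec_def sum_2 power2_eq_square)
qed

text \<open>The rest of the curve is compact and misses \<open>\<gamma> t0\<close>, because an
  interior parameter of a simple path is not repeated; so it keeps a positive distance.\<close>

lemma simple_closed_curve_near_point:
  fixes \<gamma> :: "real \<Rightarrow> real^2"
  assumes sp: "simple_path \<gamma>" and t0: "0 < t0" "t0 < 1" and d: "d > 0"
  obtains r where "r > 0" "\<And>p. \<lbrakk>p \<in> path_image \<gamma>; norm (p - \<gamma> t0) < r\<rbrakk> \<Longrightarrow> \<exists>t. \<bar>t - t0\<bar> < d \<and> p = \<gamma> t"
proof -
  let ?K = "\<gamma> ` ({0..1} - {t0 - d<..<t0 + d})"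
  have "continuous_on {0..1} \<gamma>" using sp by (simp add: simple_path_def path_def)
  then have "compact ?K"
    by (intro compact_continuous_image compact_diff) (auto intro: continuous_on_subset)
  then have "open (- ?K)" by (simp add: compact_imp_closed open_Compl)
  moreover have "\<gamma> t0 \<notin> ?K"
  proof
    assume "\<gamma> t0 \<in> ?K"
    then obtain t where "t \<in> {0..1}" "t \<notin> {t0 - d<..<t0 + d}" "\<gamma> t0 = \<gamma> t" by auto
    then have "t = t0" using sp t0 by (force simp: simple_path_def loop_free_def)
    with \<open>t \<notin> {t0 - d<..<t0 + d}\<close> d show False by simp
  qed
  ultimately obtain r where r: "r > 0" "ball (\<gamma> t0) r \<subseteq> - ?K"
    by (metis ComplI open_contains_ball)
  show thesis
  proof (rule that[OF r(1)])
    fix p assume p: "p \<in> path_image \<gamma>" "norm (p - \<gamma> t0) < r"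
    then obtain t where t: "t \<in> {0..1}" "p = \<gamma> t" by (auto simp: path_image_def)
    have "p \<notin> ?K" using r(2) p(2) by (auto simp: dist_norm norm_minus_commute subset_iff)
    with t have "t \<in> {t0 - d<..<t0 + d}" by auto
    then have "\<bar>t - t0\<bar> < d" by (simp add: abs_less_iff)
    with t show "\<exists>t. \<bar>t - t0\<bar> < d \<and> p = \<gamma> t" by blast
  qed
qed

text \<open>First order: the normal displacement is negligible against the tangential one, so the
  curve stays in arbitrarily thin cones about its tangent. Second: the tangential coordinate is
  strictly increasing in the parameter, so the curve is locally a graph over its tangent. Closeness
  of points is turned into closeness of parameters by
  \<open>simple_closed_curve_near_point\<close>.\<close>

lemma curve_local_graph:
  fixes \<gamma> D1 D2 :: "real \<Rightarrow> real^2"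
  assumes sp: "simple_path \<gamma>" and t0: "0 < t0" "t0 < 1"
    and D1: "\<And>t. (\<gamma> has_vector_derivative D1 t) (at t)" and D2: "\<And>t. (D1 has_vector_derivative D2 t) (at t)"
    and tau: "D1 t0 \<bullet> \<tau> > 0" and nu: "D1 t0 \<bullet> \<nu> = 0"
  shows "\<And>\<epsilon>. \<epsilon> > 0 \<Longrightarrow> \<exists>r>0. \<forall>p\<in>path_image \<gamma>. norm (p - \<gamma> t0) < r \<longrightarrow>
      \<bar>(p - \<gamma> t0) \<bullet> \<nu>\<bar> \<le> \<epsilon> * \<bar>(p - \<gamma> t0) \<bullet> \<tau>\<bar>"
    and "\<exists>r>0. \<forall>p\<in>path_image \<gamma>. \<forall>p'\<in>path_image \<gamma>. norm (p - \<gamma> t0) < r \<longrightarrow> norm (p' - \<gamma> t0) < r \<longrightarrow>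
      p \<bullet> \<tau> = p' \<bullet> \<tau> \<longrightarrow> p = p'"
proof -
  have dw: "((\<lambda>t. (\<gamma> t - \<gamma> t0) \<bullet> w) has_real_derivative D1 t \<bullet> w) (at t)" for w t
    using bounded_linear.has_vector_derivative[OF bounded_linear_inner_left D1, of w t]
    by (simp add: has_real_derivative_iff_has_vector_derivative inner_diff_left has_vector_derivative_diff_const)
  show "\<exists>r>0. \<forall>p\<in>path_image \<gamma>. norm (p - \<gamma> t0) < r \<longrightarrow>
      \<bar>(p - \<gamma> t0) \<bullet> \<nu>\<bar> \<le> \<epsilon> * \<bar>(p - \<gamma> t0) \<bullet> \<tau>\<bar>" if e: "\<epsilon> > 0" for \<epsilon>
  proof -
    let ?f = "\<lambda>w t. (\<gamma> t - \<gamma> t0) \<bullet> w / (t - t0)"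
    have lim: "(?f w \<longlongrightarrow> D1 t0 \<bullet> w) (at t0)" for w
      using dw[of w t0] by (simp add: has_field_derivative_iff)
    have "((\<lambda>t. \<epsilon> * \<bar>?f \<tau> t\<bar> - \<bar>?f \<nu> t\<bar>) \<longlongrightarrow> \<epsilon> * \<bar>D1 t0 \<bullet> \<tau>\<bar> - \<bar>D1 t0 \<bullet> \<nu>\<bar>) (at t0)"
      by (intro tendsto_intros lim)
    then have "\<forall>\<^sub>F t in at t0. \<epsilon> * \<bar>?f \<tau> t\<bar> - \<bar>?f \<nu> t\<bar> > 0"
      by (rule order_tendstoD(1)) (use tau nu e in simp)
    then obtain d where d: "d > 0" and dd: "\<And>t. t \<noteq> t0 \<Longrightarrow> dist t t0 < d \<Longrightarrow> \<epsilon> * \<bar>?f \<tau> t\<bar> - \<bar>?f \<nu> t\<bar> > 0"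
      by (auto simp: eventually_at)
    have le: "\<bar>(\<gamma> t - \<gamma> t0) \<bullet> \<nu>\<bar> \<le> \<epsilon> * \<bar>(\<gamma> t - \<gamma> t0) \<bullet> \<tau>\<bar>" if "\<bar>t - t0\<bar> < d" for t
    proof (cases "t = t0")
      case False
      then have "\<bar>?f \<nu> t\<bar> * \<bar>t - t0\<bar> \<le> \<epsilon> * \<bar>?f \<tau> t\<bar> * \<bar>t - t0\<bar>"
        using dd[of t] that by (intro mult_right_mono) (auto simp: dist_real_def)
      with False show ?thesis by (simp add: abs_divide)
    qed simp
    obtain r where "r > 0" "\<And>p. \<lbrakk>p \<in> path_image \<gamma>; norm (p - \<gamma> t0) < r\<rbrakk> \<Longrightarrow> \<exists>t. \<bar>t - t0\<bar> < d \<and> p = \<gamma> t"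
      by (rule simple_closed_curve_near_point[OF sp t0 d]) blast
    with le show ?thesis by (intro exI[of _ r]) auto
  qed
  have "isCont (\<lambda>t. D1 t \<bullet> \<tau>) t0"
    using has_vector_derivative_continuous[OF D2] by (intro continuous_intros)
  then have "((\<lambda>t. D1 t \<bullet> \<tau>) \<longlongrightarrow> D1 t0 \<bullet> \<tau>) (at t0)" by (simp add: isCont_def)
  then have "\<forall>\<^sub>F t in at t0. D1 t \<bullet> \<tau> > 0" using tau by (rule order_tendstoD(1))
  then have "\<forall>\<^sub>F t in nhds t0. D1 t \<bullet> \<tau> > 0" using tau by (simp add: eventually_nhds_conv_at)
  then obtain d where d: "d > 0" and dd: "\<And>t. dist t t0 < d \<Longrightarrow> D1 t \<bullet> \<tau> > 0"
    by (auto simp: eventually_nhds_metric)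
  have mono: "(\<gamma> s - \<gamma> t0) \<bullet> \<tau> < (\<gamma> t - \<gamma> t0) \<bullet> \<tau>" if st: "\<bar>s - t0\<bar> < d" "\<bar>t - t0\<bar> < d" "s < t" for s t
  proof (rule DERIV_pos_imp_increasing[OF st(3)])
    fix x assume "s \<le> x" "x \<le> t"
    with st have "dist x t0 < d" by (auto simp: dist_real_def)
    with dw[of \<tau> x] dd show "\<exists>y. DERIV (\<lambda>t. (\<gamma> t - \<gamma> t0) \<bullet> \<tau>) x :> y \<and> 0 < y" by blast
  qed
  have inj: "s = t" if "\<bar>s - t0\<bar> < d" "\<bar>t - t0\<bar> < d" "\<gamma> s \<bullet> \<tau> = \<gamma> t \<bullet> \<tau>" for s t
    using mono[OF that(1,2)] mono[OF that(2,1)] that(3) by (cases s t rule: linorder_cases) (auto simp: inner_diff_left)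
  obtain r where "r > 0" and r: "\<And>p. \<lbrakk>p \<in> path_image \<gamma>; norm (p - \<gamma> t0) < r\<rbrakk> \<Longrightarrow> \<exists>t. \<bar>t - t0\<bar> < d \<and> p = \<gamma> t"
    by (rule simple_closed_curve_near_point[OF sp t0 d]) blast
  then show "\<exists>r>0. \<forall>p\<in>path_image \<gamma>. \<forall>p'\<in>path_image \<gamma>. norm (p - \<gamma> t0) < r \<longrightarrow> norm (p' - \<gamma> t0) < r \<longrightarrow>
      p \<bullet> \<tau> = p' \<bullet> \<tau> \<longrightarrow> p = p'"
    using inj by (intro exI[of _ r]) metis
qed

lemma connected_subset_side:
  assumes R: "R = inside P \<or> R = outside P" and K: "connected K" "K \<inter> P = {}" "p \<in> K" "p \<in> R"
  shows "K \<subseteq> R"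
proof
  fix x assume "x \<in> K"
  with K have "connected_component (- P) p x" unfolding connected_component_def by blast
  with R K(4) show "x \<in> R" using inside_same_component[of P p x] outside_same_component[of P p x] by auto
qed

text \<open>The Jordan theorem says only that both sides accumulate at the point. The local graph
  improves this: each side contains one of the two cones about the normal, and not the same one,
  since the sides are disjoint. Every transversal direction eventually enters one of these
  sides.\<close>

theorem smooth_curve_two_sided:
  assumes \<gamma>: "smooth_simple_closed_curve \<gamma>" and t0: "0 < t0" "t0 < 1"
  obtains n where "norm n = 1" "n \<bullet> vector_derivative \<gamma> (at t0) = 0"
    and "\<And>v. v \<bullet> n < 0 \<Longrightarrow> \<forall>\<^sub>F s in at_right 0. \<gamma> t0 + s *\<^sub>R v \<in> inside (path_image \<gamma>)"
    and "\<And>v. v \<bullet> n > 0 \<Longrightarrow> \<forall>\<^sub>F s in at_right 0. \<gamma> t0 + s *\<^sub>R v \<in> outside (path_image \<gamma>)"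
proof (rule smooth_simple_closed_curveE[OF \<gamma>])
  fix D1 D2
  assume D1: "\<And>t. (\<gamma> has_vector_derivative D1 t) (at t)" and D2: "\<And>t. (D1 has_vector_derivative D2 t) (at t)"
    and nz: "\<And>t. D1 t \<noteq> 0" and vd: "\<And>t. vector_derivative \<gamma> (at t) = D1 t"
  have sp: "simple_path \<gamma>" and per: "\<And>t. \<gamma> (t + 1) = \<gamma> t"
    using \<gamma> by (auto simp: smooth_simple_closed_curve_def)
  have "pathfinish \<gamma> = pathstart \<gamma>" using per[of 0] by (simp add: pathfinish_def pathstart_def)
  note J = Jordan_real2[OF sp this]
  let ?P = "path_image \<gamma>"
  define q where "q = \<gamma> t0"
  define \<tau> where "\<tau> = D1 t0 /\<^sub>R norm (D1 t0)"
  define \<nu> :: "real^2" where "\<nu> = vector [- \<tau> $ 2, \<tau> $ 1]"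
  have tau: "norm \<tau> = 1" using nz by (simp add: \<tau>_def)
  have tn: "\<tau> \<bullet> \<nu> = 0" by (simp add: \<nu>_def inner_vec_def sum_2)
  have nu: "norm \<nu> = 1"
    using tau by (simp add: \<nu>_def norm_eq_sqrt_inner inner_vec_def sum_2 add.commute)
  have nn: "\<nu> \<bullet> \<nu> = 1" "\<tau> \<bullet> \<tau> = 1" using nu tau by (simp_all add: norm_eq_1)
  have D1t: "D1 t0 = norm (D1 t0) *\<^sub>R \<tau>" using nz by (simp add: \<tau>_def)
  have "D1 t0 \<bullet> \<tau> > 0" "D1 t0 \<bullet> \<nu> = 0" using nz nn tn by (subst D1t, simp)+
  note graph = curve_local_graph[OF sp t0 D1 D2 this, folded q_def]
  have norm2: "(norm w)\<^sup>2 = (w \<bullet> \<tau>)\<^sup>2 + (w \<bullet> \<nu>)\<^sup>2" for w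
    using orthonormal_frame_norm[OF tau, of w] by (simp add: \<nu>_def)
  have qP: "q \<in> ?P" using t0 by (auto simp: q_def path_image_def)

  \<comment> \<open>The sign \<open>\<sigma>\<close> selects the side of the tangent; a larger
    \<open>\<epsilon>\<close> makes the cone narrower about the normal.\<close>
  define cone where "cone \<sigma> \<epsilon> r = {p. \<epsilon> * \<bar>(p - q) \<bullet> \<tau>\<bar> < \<sigma> * ((p - q) \<bullet> \<nu>) \<and> norm (p - q) < r}" for \<sigma> \<epsilon> r :: real
  have conn: "connected (cone \<sigma> \<epsilon> r)" if "\<epsilon> > 0" for \<sigma> \<epsilon> r
  proof -
    have k: "\<epsilon> * \<bar>A\<bar> < \<sigma> * B \<longleftrightarrow> \<sigma> * B - \<epsilon> * A > 0 \<and> \<sigma> * B + \<epsilon> * A > 0" for A B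
      using that abs_less_iff[of "\<epsilon> * A" "\<sigma> * B"] by (auto simp: abs_mult)
    have "cone \<sigma> \<epsilon> r = {p. (\<sigma> *\<^sub>R \<nu> - \<epsilon> *\<^sub>R \<tau>) \<bullet> p > (\<sigma> *\<^sub>R \<nu> - \<epsilon> *\<^sub>R \<tau>) \<bullet> q} \<inter>
        {p. (\<sigma> *\<^sub>R \<nu> + \<epsilon> *\<^sub>R \<tau>) \<bullet> p > (\<sigma> *\<^sub>R \<nu> + \<epsilon> *\<^sub>R \<tau>) \<bullet> q} \<inter> ball q r"
      unfolding cone_def k
      by (auto simp: inner_diff_left inner_diff_right inner_add_left inner_commute
          dist_norm norm_minus_commute algebra_simps)
    moreover have "convex \<dots>" by (intro convex_Int convex_halfspace_gt convex_ball)
    ultimately show ?thesis by (simp add: convex_connected)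
  qed
  have avoid: "cone \<sigma> \<epsilon> r \<inter> ?P = {}"
    if "\<epsilon> > 0" "\<bar>\<sigma>\<bar> = 1" "\<forall>p\<in>?P. norm (p - q) < r \<longrightarrow> \<bar>(p - q) \<bullet> \<nu>\<bar> \<le> \<epsilon> * \<bar>(p - q) \<bullet> \<tau>\<bar>" for \<sigma> \<epsilon> r
  proof -
    have sh: "\<sigma> * h \<le> \<bar>h\<bar>" for h :: real
      using abs_ge_self[of "\<sigma> * h"] that(2) by (simp add: abs_mult)
    have False if "p \<in> cone \<sigma> \<epsilon> r" "p \<in> ?P" for p
      using that sh[of "(p - q) \<bullet> \<nu>"] \<open>\<forall>p\<in>?P. _\<close>[rule_format, of p] by (simp add: cone_def)
    then show ?thesis by blast
  qed
  have axis: "q + (\<sigma> * h) *\<^sub>R \<nu> \<in> cone \<sigma> \<epsilon> r" if "\<bar>\<sigma>\<bar> = 1" "0 < h" "h < r" for \<sigma> \<epsilon> r h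
  proof -
    have "\<sigma> * \<sigma> = 1" using that(1) by (metis abs_mult_self mult_1)
    then have e: "\<sigma> * ((q + (\<sigma> * h) *\<^sub>R \<nu> - q) \<bullet> \<nu>) = h" using nn by (simp flip: mult.assoc)
    show ?thesis unfolding cone_def mem_Collect_eq e
      using that nu tn by (simp add: inner_commute abs_mult)
  qed
  text \<open>Thin cones about the normal lie in the same side as wide ones.\<close>
  have spread: "\<forall>\<^sub>F s in at_right 0. q + s *\<^sub>R v \<in> R"
    if R: "R = inside ?P \<or> R = outside ?P" and sig: "\<bar>\<sigma>\<bar> = 1" and e: "\<epsilon> > 0" "r > 0"
      and sub: "cone \<sigma> \<epsilon> r \<subseteq> R" and v: "\<sigma> * (v \<bullet> \<nu>) > 0" for R \<sigma> \<epsilon> r v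
  proof -
    \<comment> \<open>Less than the ratio of normal to tangential component of \<open>v\<close>, so
      that \<open>v\<close> points into the cone for \<open>\<eta>\<close>; the summand
      \<open>1\<close> covers \<open>v\<close> along the normal. That cone meets the given one on
      the normal, hence lies on the same side.\<close>
    define \<eta> where "\<eta> = \<sigma> * (v \<bullet> \<nu>) / (2 * (\<bar>v \<bullet> \<tau>\<bar> + 1))"
    have eta: "\<eta> > 0" using v by (simp add: \<eta>_def)
    have etav: "\<eta> * \<bar>v \<bullet> \<tau>\<bar> < \<sigma> * (v \<bullet> \<nu>)"
    proof -
      have "\<eta> * \<bar>v \<bullet> \<tau>\<bar> = \<sigma> * (v \<bullet> \<nu>) * (\<bar>v \<bullet> \<tau>\<bar> / (2 * (\<bar>v \<bullet> \<tau>\<bar> + 1)))" by (simp add: \<eta>_def)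
      also have "\<dots> < \<sigma> * (v \<bullet> \<nu>) * 1"
        by (rule mult_strict_left_mono) (use v in \<open>auto simp: divide_less_eq\<close>)
      finally show ?thesis by simp
    qed
    obtain r' where r': "r' > 0" "\<forall>p\<in>?P. norm (p - q) < r' \<longrightarrow> \<bar>(p - q) \<bullet> \<nu>\<bar> \<le> \<eta> * \<bar>(p - q) \<bullet> \<tau>\<bar>"
      using graph(1)[OF eta] by blast
    have "min r r' / 2 < r" "min r r' / 2 < r'" "min r r' / 2 > 0" using e r'(1) by auto
    then obtain h where h: "0 < h" "h < r" "h < r'" by blast
    have "q + (\<sigma> * h) *\<^sub>R \<nu> \<in> R" using axis[OF sig h(1,2)] sub by blast
    moreover have "q + (\<sigma> * h) *\<^sub>R \<nu> \<in> cone \<sigma> \<eta> r'" using axis[OF sig h(1,3)] by blast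
    ultimately have sub': "cone \<sigma> \<eta> r' \<subseteq> R"
      using connected_subset_side[OF R conn[OF eta, of \<sigma> r'] avoid[OF eta sig r'(2)]] by blast
    have "((\<lambda>s. s * norm v) \<longlongrightarrow> 0 * norm v) (at_right 0)" by (intro tendsto_intros)
    then have "\<forall>\<^sub>F s in at_right 0. s * norm v < r'" using r'(1) by (intro order_tendstoD(2)) auto
    then show ?thesis using eventually_at_right_less[of 0]
    proof eventually_elim
      case (elim s)
      have "s * (\<eta> * \<bar>v \<bullet> \<tau>\<bar>) < s * (\<sigma> * (v \<bullet> \<nu>))" using etav elim by simp
      then have "q + s *\<^sub>R v \<in> cone \<sigma> \<eta> r'"
        using elim by (simp add: cone_def abs_mult mult_ac)
      then show ?case using sub' by blast
    qed
  qed
  obtain r1 where r1: "r1 > 0" "\<forall>p\<in>?P. norm (p - q) < r1 \<longrightarrow> \<bar>(p - q) \<bullet> \<nu>\<bar> \<le> 1 * \<bar>(p - q) \<bullet> \<tau>\<bar>"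
    using graph(1)[of 1] by auto
  obtain r2 where r2: "r2 > 0" "\<forall>p\<in>?P. \<forall>p'\<in>?P. norm (p - q) < r2 \<longrightarrow> norm (p' - q) < r2 \<longrightarrow>
      p \<bullet> \<tau> = p' \<bullet> \<tau> \<longrightarrow> p = p'" using graph(2) by blast
  define r where "r = min r1 r2"
  have r: "r > 0" "\<forall>p\<in>?P. norm (p - q) < r \<longrightarrow> \<bar>(p - q) \<bullet> \<nu>\<bar> \<le> 1 * \<bar>(p - q) \<bullet> \<tau>\<bar>"
      "\<And>p p'. \<lbrakk>p \<in> ?P; p' \<in> ?P; norm (p - q) < r; norm (p' - q) < r; p \<bullet> \<tau> = p' \<bullet> \<tau>\<rbrakk> \<Longrightarrow> p = p'"
    using r1 r2 by (auto simp: r_def)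
  text \<open>A point near \<open>q\<close> off the curve is joined to one of the two cones by a vertical segment.\<close>
  have meets: "\<exists>\<sigma>\<in>{1, -1}. cone \<sigma> 1 r \<subseteq> R"
    if R: "R = inside ?P \<or> R = outside ?P" and cl: "q \<in> closure R" for R
  proof -
    \<comment> \<open>A quarter of the radius leaves room for a vertical shift by up to
      \<open>3 * (r / 4)\<close> inside the ball of radius \<open>r\<close>.\<close>
    have "r / 4 > 0" using r by simp
    then obtain p where p: "p \<in> R" "dist p q < r / 4" using cl closure_approachable by metis
    then have pP: "p \<notin> ?P" using R by (metis IntI empty_iff inside_no_overlap outside_no_overlap)
    define a where "a = (p - q) \<bullet> \<tau>"
    define h where "h = (p - q) \<bullet> \<nu>"
    have nw: "(norm (p - q))\<^sup>2 = a\<^sup>2 + h\<^sup>2" by (simp add: norm2 a_def h_def)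
    have pr: "norm (p - q) < r / 4" using p by (simp add: dist_norm)
    have ah: "\<bar>a\<bar> < r / 4" "\<bar>h\<bar> < r / 4"
      using Cauchy_Schwarz_ineq2[of "p - q" \<tau>] Cauchy_Schwarz_ineq2[of "p - q" \<nu>] pr tau nu by (auto simp: a_def h_def)
    have near: "norm (p + s *\<^sub>R \<nu> - q) < r" if "\<bar>s\<bar> \<le> 3 * (r / 4)" for s
    proof -
      have "norm (p + s *\<^sub>R \<nu> - q) \<le> norm (p - q) + norm (s *\<^sub>R \<nu>)"
        using norm_triangle_ineq[of "p - q" "s *\<^sub>R \<nu>"] by (simp add: algebra_simps)
      with that pr nu show ?thesis by simp
    qed
    have coord: "(p + s *\<^sub>R \<nu> - q) \<bullet> \<tau> = a" "(p + s *\<^sub>R \<nu> - q) \<bullet> \<nu> = h + s" for s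
      using tn nn by (auto simp: a_def h_def inner_diff_left inner_add_left inner_diff_right inner_add_right inner_commute)
    have same: "cone \<sigma> 1 r \<subseteq> R" if sig: "\<bar>\<sigma>\<bar> = 1" and l: "0 \<le> l" "l \<le> 3 * (r / 4)" "\<bar>a\<bar> < \<sigma> * h + l"
        and off: "\<forall>s\<in>{0..l}. p + (\<sigma> * s) *\<^sub>R \<nu> \<notin> ?P" for \<sigma> l
    proof -
      let ?S = "(\<lambda>s. p + (\<sigma> * s) *\<^sub>R \<nu>) ` {0..l}"
      have ss: "\<sigma> * \<sigma> = 1" using sig by (metis abs_mult_self mult_1)
      have "connected ?S" by (intro connected_continuous_image continuous_intros) auto
      moreover have "p + (\<sigma> * l) *\<^sub>R \<nu> \<in> cone \<sigma> 1 r"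
        using l near[of "\<sigma> * l"] sig ss by (simp add: cone_def coord abs_mult distrib_left flip: mult.assoc)
      moreover have "p + (\<sigma> * l) *\<^sub>R \<nu> \<in> ?S" using l by auto
      ultimately have "connected (?S \<union> cone \<sigma> 1 r)"
        using conn[of 1 \<sigma> r] by (intro connected_Un) auto
      moreover have "(?S \<union> cone \<sigma> 1 r) \<inter> ?P = {}" using off avoid[OF _ sig r(2)] by auto
      moreover have "p \<in> ?S" using l by (auto intro!: image_eqI[of _ _ 0])
      ultimately show ?thesis using connected_subset_side[OF R, of "?S \<union> cone \<sigma> 1 r" p] p(1) by blast
    qed
    show ?thesis
    proof (cases "\<bar>h\<bar> \<le> \<bar>a\<bar>")
      case False
      then have "\<bar>a\<bar> < 1 * h + 0 \<or> \<bar>a\<bar> < -1 * h + 0" by auto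
      then show ?thesis using same[of 1 0] same[of "-1" 0] pP r(1) by auto
    next
      case True
      have a0: "a \<noteq> 0"
      proof
        assume "a = 0"
        with True nw have "p = q" by simp
        with pP qP show False by simp
      qed
      \<comment> \<open>Since \<open>\<bar>h\<bar> \<le> \<bar>a\<bar>\<close>, a shift by
        \<open>3 * \<bar>a\<bar>\<close> up or down ends in a cone. The graph meets the vertical
        line of \<open>p\<close> at most once near \<open>q\<close>, and not in \<open>p\<close>, so
        one of the two shifts avoids the curve.\<close>
      let ?l = "3 * \<bar>a\<bar>"
      have "(\<forall>s\<in>{0..?l}. p + (1 * s) *\<^sub>R \<nu> \<notin> ?P) \<or> (\<forall>s\<in>{0..?l}. p + (-1 * s) *\<^sub>R \<nu> \<notin> ?P)"
      proof (rule ccontr)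
        assume "\<not> ?thesis"
        then obtain s s' where s: "s \<in> {0..?l}" "p + s *\<^sub>R \<nu> \<in> ?P" "s' \<in> {0..?l}" "p + (- s') *\<^sub>R \<nu> \<in> ?P" by auto
        have "p + s *\<^sub>R \<nu> = p + (- s') *\<^sub>R \<nu>"
        proof (rule r(3)[OF s(2,4)])
          show "norm (p + s *\<^sub>R \<nu> - q) < r" "norm (p + (- s') *\<^sub>R \<nu> - q) < r"
            using near[of s] near[of "- s'"] s ah by auto
          show "(p + s *\<^sub>R \<nu>) \<bullet> \<tau> = (p + (- s') *\<^sub>R \<nu>) \<bullet> \<tau>"
            using tn by (simp add: inner_add_left inner_add_right inner_diff_right inner_diff_left inner_commute)
        qed
        then have "(s + s') *\<^sub>R \<nu> = 0" by (simp add: algebra_simps)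
        then have "s + s' = 0" using nu by auto
        with s have "s = 0" by auto
        with s pP show False by simp
      qed
      moreover have "\<bar>a\<bar> < 1 * h + ?l" "\<bar>a\<bar> < - 1 * h + ?l" using True a0 by auto
      ultimately show ?thesis using same[of 1 ?l] same[of "-1" ?l] ah by auto
    qed
  qed
  obtain \<sigma> where s: "\<sigma> \<in> {1, -1}" "cone \<sigma> 1 r \<subseteq> inside ?P" using meets[of "inside ?P"] J(3) qP by blast
  obtain \<sigma>' where s': "\<sigma>' \<in> {1, -1}" "cone \<sigma>' 1 r \<subseteq> outside ?P" using meets[of "outside ?P"] J(4) qP by blast
  have "\<sigma> \<noteq> \<sigma>'"
  proof
    assume "\<sigma> = \<sigma>'"
    moreover have "q + (\<sigma> * (r / 2)) *\<^sub>R \<nu> \<in> cone \<sigma> 1 r" using s r by (intro axis) auto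
    ultimately show False using s s' inside_Int_outside by blast
  qed
  with s(1) s'(1) have neg: "\<sigma>' = - \<sigma>" by auto
  have sig: "\<bar>\<sigma>\<bar> = 1" "\<bar>\<sigma>'\<bar> = 1" using s s' by auto
  show thesis
  proof (rule that[of "\<sigma>' *\<^sub>R \<nu>"])
    show "norm (\<sigma>' *\<^sub>R \<nu>) = 1" using sig nu by simp
    show "\<sigma>' *\<^sub>R \<nu> \<bullet> vector_derivative \<gamma> (at t0) = 0"
      using tn by (subst vd, subst D1t) (simp add: inner_commute)
    show "\<forall>\<^sub>F s in at_right 0. \<gamma> t0 + s *\<^sub>R v \<in> inside ?P" if "v \<bullet> (\<sigma>' *\<^sub>R \<nu>) < 0" for v
      using spread[OF _ sig(1) _ r(1) s(2), of v] that by (simp add: neg q_def)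
    show "\<forall>\<^sub>F s in at_right 0. \<gamma> t0 + s *\<^sub>R v \<in> outside ?P" if "v \<bullet> (\<sigma>' *\<^sub>R \<nu>) > 0" for v
      using spread[OF _ sig(2) _ r(1) s'(2), of v] that by (simp add: q_def)
  qed
qed

section \<open>Polynomial integrals\<close>

lemma lagrange_interpolation:
  fixes p :: "real poly" and z :: "nat \<Rightarrow> real"
  assumes deg: "degree p \<le> n" and inj: "inj_on z {..n}"
  shows "poly p x = (\<Sum>k\<le>n. poly p (z k) * (\<Prod>l\<in>{..n} - {k}. (x - z l) / (z k - z l)))"
proof -
  define Q where "Q k = (\<Prod>l\<in>{..n} - {k}. smult (1 / (z k - z l)) [:- z l, 1:])" for k
  define q where "q = (\<Sum>k\<le>n. smult (poly p (z k)) (Q k))"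
  have Qx: "poly (Q k) x = (\<Prod>l\<in>{..n} - {k}. (x - z l) / (z k - z l))" for k x
    by (simp add: Q_def poly_prod diff_divide_distrib)
  have Qz: "poly (Q k) (z m) = (if k = m then 1 else 0)" if km: "k \<le> n" "m \<le> n" for k m
  proof (cases "k = m")
    case True
    have "z m - z l \<noteq> 0" if "l \<in> {..n} - {m}" for l using that inj km by (auto simp: inj_on_def)
    then show ?thesis using True by (auto simp: Qx intro!: prod.neutral)
  next
    case False
    then show ?thesis using km by (auto simp: Qx intro!: prod_zero)
  qed
  have "degree (Q k) \<le> n" if "k \<le> n" for k
  proof -
    have "degree (Q k) \<le> (\<Sum>l\<in>{..n} - {k}. degree (smult (1 / (z k - z l)) [:- z l, 1:]))"
      unfolding Q_def using degree_prod_sum_le[of "{..n} - {k}" "\<lambda>l. smult (1 / (z k - z l)) [:- z l, 1:]"]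
      by (simp add: comp_def)
    also have "\<dots> \<le> (\<Sum>l\<in>{..n} - {k}. 1)" by (rule sum_mono) auto
    also have "\<dots> = n" using that by simp
    finally show ?thesis .
  qed
  then have degq: "degree q \<le> n" unfolding q_def
    by (intro degree_sum_le) (auto intro: order_trans[OF degree_smult_le])
  have "p = q"
  proof (rule poly_eqI_degree)
    show "poly p x = poly q x" if "x \<in> z ` {..n}" for x
      using that by (auto simp: q_def poly_sum Qz if_distrib sum.delta cong: if_cong)
    show "degree p < card (z ` {..n})" "degree q < card (z ` {..n})"
      using deg degq by (simp_all add: card_image[OF inj])
  qed
  then have "poly p x = poly q x" by simp
  then show ?thesis by (simp add: q_def poly_sum Qx)
qed

text \<open>
  A function of lines that is polynomial of bounded degree on every pencil is polynomial: on the
  pencil through \<open>(x0, c)\<close> it is interpolated by its values on the lines to finitely many points of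
  the line \<open>x = x0 + r/2\<close>, and there it is polynomial in \<open>c\<close>.
\<close>

lemma box_polynomial:
  fixes P :: "real \<Rightarrow> real \<Rightarrow> real poly"
  assumes r: "r > 0"
    and deg: "\<And>x y. \<bar>x - x0\<bar> < r \<Longrightarrow> \<bar>y - y0\<bar> < r \<Longrightarrow> degree (P x y) \<le> n"
    and line: "\<And>x y x' y' \<mu>. \<lbrakk>\<bar>x - x0\<bar> < r; \<bar>y - y0\<bar> < r; \<bar>x' - x0\<bar> < r; \<bar>y' - y0\<bar> < r;
        y' - y = \<mu> * (x' - x)\<rbrakk> \<Longrightarrow> poly (P x y) \<mu> = poly (P x' y') \<mu>"
  shows "\<exists>e. \<forall>x y \<mu>. \<bar>x - x0\<bar> < r \<longrightarrow> \<bar>y - y0\<bar> < r \<longrightarrow> poly (P x y) \<mu> = bieval e \<mu> (y - \<mu> * x)"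
proof -
  define h where "h = r / 2"
  \<comment> \<open>Distinct nodes, all less than \<open>h < r\<close> away from
    \<open>y0\<close>.\<close>
  define Y where "Y k = y0 + real k / real (n + 1) * h" for k
  have h: "h > 0" "h < r" using r by (auto simp: h_def)
  have Y: "\<bar>Y k - y0\<bar> < r" if "k \<le> n" for k
  proof -
    have "real k / real (n + 1) * h \<le> 1 * h" using that h by (intro mult_right_mono) auto
    then show ?thesis using h by (simp add: Y_def abs_mult)
  qed
  have Yinj: "Y k \<noteq> Y l" if "k \<noteq> l" for k l
    using that h by (simp add: Y_def)
  \<comment> \<open>The slope from \<open>(x0, c)\<close> to the node \<open>(x0 + h, Y k)\<close>
    is \<open>(Y k - c) / h\<close>. It is affine in \<open>c\<close>, and the difference of two
    such slopes does not depend on \<open>c\<close>; this makes the interpolation formula polynomial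
    in \<open>c\<close> too.\<close>
  define L where "L z = (\<Sum>k\<le>n. poly (P (x0 + h) (Y k)) ((Y k - snd z) * (1 / h)) *
     (\<Prod>l\<in>{..n} - {k}. (fst z - (Y l - snd z) * (1 / h)) * (h / (Y k - Y l))))" for z
  have base: "poly (P x0 c) \<mu> = L (\<mu>, c)" if c: "\<bar>c - y0\<bar> < r" for c \<mu>
  proof -
    define z where "z k = (Y k - c) * (1 / h)" for k
    have zd: "z k - z l = (Y k - Y l) / h" for k l using h by (simp add: z_def diff_divide_distrib)
    have "inj_on z {..n}"
    proof (rule inj_onI)
      fix k l assume "z k = z l"
      then have "Y k = Y l" using zd[of k l] h by simp
      then show "k = l" using Yinj by blast
    qed
    moreover have "degree (P x0 c) \<le> n" using deg[of x0 c] c r by simp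
    ultimately have "poly (P x0 c) \<mu> = (\<Sum>k\<le>n. poly (P x0 c) (z k) * (\<Prod>l\<in>{..n} - {k}. (\<mu> - z l) / (z k - z l)))"
      by (intro lagrange_interpolation)
    also have "\<dots> = L (\<mu>, c)" unfolding L_def
    proof (rule sum.cong[OF refl])
      fix k assume k: "k \<in> {..n}"
      have "poly (P x0 c) (z k) = poly (P (x0 + h) (Y k)) (z k)"
        using c k h r Y by (intro line) (auto simp: z_def)
      then show "poly (P x0 c) (z k) * (\<Prod>l\<in>{..n} - {k}. (\<mu> - z l) / (z k - z l)) =
          poly (P (x0 + h) (Y k)) ((Y k - snd (\<mu>, c)) * (1 / h)) *
          (\<Prod>l\<in>{..n} - {k}. (fst (\<mu>, c) - (Y l - snd (\<mu>, c)) * (1 / h)) * (h / (Y k - Y l)))"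
        by (simp add: zd) (simp add: z_def)
    qed
    finally show ?thesis .
  qed
  have "L \<in> bipolys" unfolding L_def[abs_def]
    by (intro subalg_sum subalg_mult subalg_poly subalg_prod subalg_diff subalg_const subalg_bipolys bipolys_fst bipolys_snd)
  then obtain E where E: "\<And>\<mu> c. L (\<mu>, c) = bieval E \<mu> c" by (rule bipolysE) blast
  have "(\<lambda>z. bieval E (fst z) (snd z + fst z * x0)) \<in> bipolys"
    by (intro subalg_bieval subalg_add subalg_mult subalg_const subalg_bipolys bipolys_fst bipolys_snd)
  then obtain e where e: "\<And>\<mu> b. bieval e \<mu> b = bieval E \<mu> (b + \<mu> * x0)" by (rule bipolysE) auto
  have "poly (P x y) \<mu> = bieval e \<mu> (y - \<mu> * x)" if xy: "\<bar>x - x0\<bar> < r" "\<bar>y - y0\<bar> < r" for x y \<mu>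
  proof -
    obtain W where W: "\<And>d. poly W d = bieval e (0 + d) (y - x * d)"
      using line_polynomial[where p = e and u = 0 and v = y and x = x] by metis
    \<comment> \<open>For slopes in \<open>(0, M)\<close> the line through \<open>(x, y)\<close>
      still meets \<open>x = x0\<close> inside the box, where the formula is known; agreement on an
      interval of slopes extends to all slopes.\<close>
    define M where "M = (r - \<bar>y - y0\<bar>) / (\<bar>x - x0\<bar> + 1)"
    have M: "M > 0" using xy by (simp add: M_def)
    have "poly (P x y) \<nu> = poly W \<nu>" if \<nu>: "\<nu> \<in> {0<..<M}" for \<nu>
    proof -
      have "\<nu> * (\<bar>x - x0\<bar> + 1) < r - \<bar>y - y0\<bar>" using \<nu> by (simp add: M_def pos_less_divide_eq)
      moreover have "\<nu> * \<bar>x - x0\<bar> \<le> \<nu> * (\<bar>x - x0\<bar> + 1)" using \<nu> by (intro mult_left_mono) auto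
      moreover have "\<bar>\<nu> * (x0 - x)\<bar> = \<nu> * \<bar>x - x0\<bar>" using \<nu> by (simp add: abs_mult abs_minus_commute)
      ultimately have c: "\<bar>y + \<nu> * (x0 - x) - y0\<bar> < r" using abs_triangle_ineq[of "y - y0" "\<nu> * (x0 - x)"] by (simp add: algebra_simps)
      have "poly (P x y) \<nu> = poly (P x0 (y + \<nu> * (x0 - x))) \<nu>"
        using xy c r by (intro line) auto
      also have "\<dots> = bieval e \<nu> (y - \<nu> * x)" unfolding base[OF c] E e by (simp add: algebra_simps)
      finally show ?thesis by (simp add: W mult.commute)
    qed
    then have "{0<..<M} \<subseteq> {\<nu>. poly (P x y - W) \<nu> = 0}" by auto
    then have "P x y - W = 0" using M infinite_Ioo finite_subset poly_roots_finite by metis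
    then show ?thesis using W[of \<mu>] by (simp add: mult.commute)
  qed
  then show ?thesis by blast
qed

lemma frame_inner:
  fixes v w :: "real^2"
  assumes "i \<noteq> j"
  shows "v \<bullet> w = v $ i * w $ i + v $ j * w $ j"
proof -
  have "i = 1 \<and> j = 2 \<or> i = 2 \<and> j = 1" using assms exhaust_2[of i] exhaust_2[of j] by auto
  then show ?thesis by (auto simp: inner_vec_def sum_2)
qed

lemma frame_eqI:
  fixes v w :: "real^2"
  assumes "i \<noteq> j" "v $ i = w $ i" "v $ j = w $ j"
  shows "v = w"
proof -
  have "i = 1 \<and> j = 2 \<or> i = 2 \<and> j = 1" using assms exhaust_2[of i] exhaust_2[of j] by auto
  then show ?thesis using assms by (auto simp: vec_eq_iff forall_2)
qed

lemma frame_norm: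
  fixes v :: "real^2"
  assumes "i \<noteq> j"
  shows "(norm v)\<^sup>2 = (v $ i)\<^sup>2 + (v $ j)\<^sup>2"
  unfolding power2_norm_eq_inner frame_inner[OF assms] by (simp add: power2_eq_square)

text \<open>Each point has a ball with its own polynomial. On overlapping balls these agree, since
  any ball meets an open set of lines; the assignment is thus locally constant, and constant by
  connectedness. Convexity of the domain is replaced by this continuation.\<close>

lemma line_function_polynomial:
  fixes \<Omega> :: "(real^2) set" and p :: "real^2 \<Rightarrow> real poly"
  assumes ij: "i \<noteq> j" and \<Omega>: "open \<Omega>" "connected \<Omega>"
    and deg: "\<And>q. q \<in> \<Omega> \<Longrightarrow> degree (p q) \<le> n"
    and line: "\<And>q q' \<mu>. \<lbrakk>closed_segment q q' \<subseteq> \<Omega>; q' $ j - q $ j = \<mu> * (q' $ i - q $ i)\<rbrakk> \<Longrightarrow>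
       poly (p q) \<mu> = poly (p q') \<mu>"
  shows "\<exists>e. \<forall>q\<in>\<Omega>. \<forall>\<mu>. poly (p q) \<mu> = bieval e \<mu> (q $ j - \<mu> * q $ i)"
proof -
  define good where "good e q \<longleftrightarrow> (\<exists>r>0. ball q r \<subseteq> \<Omega> \<and> (\<forall>q'\<in>ball q r. \<forall>\<mu>. poly (p q') \<mu> = bieval e \<mu> (q' $ j - \<mu> * q' $ i)))"
    for e q
  have ex: "\<exists>e. good e q" if q: "q \<in> \<Omega>" for q
  proof -
    obtain \<rho> where \<rho>: "\<rho> > 0" "ball q \<rho> \<subseteq> \<Omega>" using \<Omega>(1) q open_contains_ball by blast
    define pt :: "real \<Rightarrow> real \<Rightarrow> real^2" where "pt x y = (\<chi> k. if k = i then x else y)" for x y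
    have pt: "pt x y $ i = x" "pt x y $ j = y" for x y using ij by (auto simp: pt_def)
    have ptq: "pt (w $ i) (w $ j) = w" for w by (rule frame_eqI[OF ij]) (simp_all add: pt)
    have box: "pt x y \<in> ball q \<rho>" if "\<bar>x - q $ i\<bar> < \<rho> / 2" "\<bar>y - q $ j\<bar> < \<rho> / 2" for x y
    proof -
      have "norm (pt x y - q) = sqrt ((x - q $ i)\<^sup>2 + (y - q $ j)\<^sup>2)"
        using frame_norm[OF ij, of "pt x y - q"] by (simp add: pt real_sqrt_unique)
      also have "\<dots> \<le> \<bar>x - q $ i\<bar> + \<bar>y - q $ j\<bar>" by (rule sqrt_sum_squares_le_sum_abs)
      finally show ?thesis using that by (simp add: dist_norm norm_minus_commute)
    qed
    have "\<exists>e. \<forall>x y \<mu>. \<bar>x - q $ i\<bar> < \<rho> / 2 \<longrightarrow> \<bar>y - q $ j\<bar> < \<rho> / 2 \<longrightarrow>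
        poly (p (pt x y)) \<mu> = bieval e \<mu> (y - \<mu> * x)"
    proof (rule box_polynomial)
      show "\<rho> / 2 > 0" using \<rho> by simp
      show "degree (p (pt x y)) \<le> n" if "\<bar>x - q $ i\<bar> < \<rho> / 2" "\<bar>y - q $ j\<bar> < \<rho> / 2" for x y
        using deg box[OF that] \<rho> by blast
      show "poly (p (pt x y)) \<mu> = poly (p (pt x' y')) \<mu>"
        if "\<bar>x - q $ i\<bar> < \<rho> / 2" "\<bar>y - q $ j\<bar> < \<rho> / 2" "\<bar>x' - q $ i\<bar> < \<rho> / 2" "\<bar>y' - q $ j\<bar> < \<rho> / 2"
          "y' - y = \<mu> * (x' - x)" for x y x' y' \<mu>
      proof (rule line)
        show "closed_segment (pt x y) (pt x' y') \<subseteq> \<Omega>"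
          using closed_segment_subset[OF box[OF that(1,2)] box[OF that(3,4)]] \<rho> by blast
      qed (use that pt in simp)
    qed
    then obtain e where e: "\<And>x y \<mu>. \<bar>x - q $ i\<bar> < \<rho> / 2 \<Longrightarrow> \<bar>y - q $ j\<bar> < \<rho> / 2 \<Longrightarrow>
        poly (p (pt x y)) \<mu> = bieval e \<mu> (y - \<mu> * x)" by blast
    have "poly (p w) \<mu> = bieval e \<mu> (w $ j - \<mu> * w $ i)" if "w \<in> ball q (\<rho> / 2)" for w \<mu>
    proof -
      have "\<bar>w $ k - q $ k\<bar> < \<rho> / 2" for k
        using component_le_norm_cart[of "w - q" k] that by (simp add: dist_norm norm_minus_commute)
      then show ?thesis using e[of "w $ i" "w $ j" \<mu>] by (simp add: ptq)
    qed
    then show ?thesis unfolding good_def using \<rho> by (intro exI[of _ e] exI[of _ "\<rho> / 2"]) auto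
  qed
  \<comment> \<open>The lines \<open>(\<mu>, b)\<close> with small positive \<open>\<mu>\<close> and
    \<open>b\<close> just above \<open>q $ j\<close> meet the ball on the vertical through
    \<open>q\<close>; the bound \<open>M\<close> keeps the shift \<open>\<mu> * q $ i\<close> below
    \<open>r / 2\<close>.\<close>
  have uniq: "e = e'"
    if r0: "r > 0" and agree: "\<And>w \<mu>. w \<in> ball q r \<Longrightarrow> bieval e \<mu> (w $ j - \<mu> * w $ i) = bieval e' \<mu> (w $ j - \<mu> * w $ i)"
    for e e' :: "real poly poly" and q :: "real^2" and r
  proof -
    define M where "M = r / (2 * (\<bar>q $ i\<bar> + 1))"
    have M: "M > 0" using that(1) by (simp add: M_def)
    have zero: "bieval (e - e') \<mu> b = 0" if b: "b \<in> {q $ j<..<q $ j + r / 2}" and \<mu>: "\<mu> \<in> {0<..<M}" for b \<mu>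
    proof -
      define w where "w = q + (b + \<mu> * q $ i - q $ j) *\<^sub>R axis j 1"
      have w: "w $ i = q $ i" "w $ j = b + \<mu> * q $ i" using ij by (simp_all add: w_def axis_def)
      have "\<bar>\<mu> * q $ i\<bar> < r / 2"
      proof -
        have "\<mu> * \<bar>q $ i\<bar> \<le> \<mu> * (\<bar>q $ i\<bar> + 1)" using \<mu> by (intro mult_left_mono) auto
        also have "\<dots> < r / 2" using \<mu> by (simp add: M_def pos_less_divide_eq algebra_simps)
        finally show ?thesis using \<mu> by (simp add: abs_mult)
      qed
      then have "\<bar>b + \<mu> * q $ i - q $ j\<bar> < r" using b by auto
      then have "w \<in> ball q r" by (simp add: w_def dist_norm)
      then show ?thesis using agree[of w \<mu>] by (simp add: w)
    qed
    have "e - e' = 0"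
    proof (rule bieval_eq_0_imp)
      show "infinite {q $ j<..<q $ j + r / 2}" using that(1) by simp
      fix b assume "b \<in> {q $ j<..<q $ j + r / 2}"
      then have "{0<..<M} \<subseteq> {\<mu>. bieval (e - e') \<mu> b = 0}" using zero by blast
      then show "infinite {\<mu>. bieval (e - e') \<mu> b = 0}" using M infinite_Ioo finite_subset by metis
    qed
    then show ?thesis by simp
  qed
  define \<epsilon> where "\<epsilon> q = (SOME e. good e q)" for q
  have good: "good (\<epsilon> q) q" if "q \<in> \<Omega>" for q unfolding \<epsilon>_def using ex[OF that] by (rule someI_ex)
  have "\<epsilon> constant_on \<Omega>"
  proof (rule locally_constant_imp_constant[OF \<Omega>(2)])
    fix q assume q: "q \<in> \<Omega>"
    obtain r where r: "r > 0" "ball q r \<subseteq> \<Omega>"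
      and R: "\<And>w \<mu>. w \<in> ball q r \<Longrightarrow> poly (p w) \<mu> = bieval (\<epsilon> q) \<mu> (w $ j - \<mu> * w $ i)"
      using good[OF q] unfolding good_def by blast
    have const: "\<epsilon> w = \<epsilon> q" if w: "w \<in> ball q r" for w
    proof -
      have "w \<in> \<Omega>" using w r by blast
      then obtain s where s: "s > 0" and S: "\<And>z \<mu>. z \<in> ball w s \<Longrightarrow> poly (p z) \<mu> = bieval (\<epsilon> w) \<mu> (z $ j - \<mu> * z $ i)"
        using good[of w] unfolding good_def by blast
      obtain t where t: "t > 0" "ball w t \<subseteq> ball q r" by (rule openE[OF open_ball w]) blast
      show ?thesis
      proof (rule uniq[of "min s t" w])
        fix z \<mu> assume "z \<in> ball w (min s t)"
        then have "z \<in> ball w s" "z \<in> ball q r" using t by auto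
        then show "bieval (\<epsilon> w) \<mu> (z $ j - \<mu> * z $ i) = bieval (\<epsilon> q) \<mu> (z $ j - \<mu> * z $ i)"
          using S R by metis
      qed (use s t in simp)
    qed
    show "\<exists>T. openin (top_of_set \<Omega>) T \<and> q \<in> T \<and> (\<forall>w\<in>T. \<epsilon> w = \<epsilon> q)"
    proof (intro exI conjI ballI)
      show "openin (top_of_set \<Omega>) (ball q r)" by (rule open_subset[OF r(2) open_ball])
      show "q \<in> ball q r" using r(1) by simp
    qed (rule const)
  qed
  then obtain e where e: "\<And>q. q \<in> \<Omega> \<Longrightarrow> \<epsilon> q = e" by (auto simp: constant_on_def)
  have "poly (p q) \<mu> = bieval e \<mu> (q $ j - \<mu> * q $ i)" if "q \<in> \<Omega>" for q \<mu>
    using good[OF that] centre_in_ball[of q] unfolding good_def e[OF that] by blast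
  then show ?thesis by blast
qed

section \<open>Orbits, their reversal and the symmetrized integral\<close>

lemma billiard_flow_line:
  assumes "0 \<le> s" "\<And>r. r \<in> {0<..<s} \<Longrightarrow> q + r *\<^sub>R v \<in> billiard_domain \<gamma>"
  shows "billiard_flow \<gamma> s (q, v) (q + s *\<^sub>R v, v)"
  using billiard_flow.move[OF billiard_flow.start[of \<gamma> "(q, v)"] assms(1)] assms(2) by simp

lemma billiard_flow_reflection:
  assumes n: "outward_unit_normal \<gamma> q n" "v \<bullet> n > 0" and s: "0 < s"
    and dom: "\<And>r. r \<in> {0<..s} \<Longrightarrow> q - r *\<^sub>R v \<in> billiard_domain \<gamma>"
      "\<And>r. r \<in> {0<..s} \<Longrightarrow> q + r *\<^sub>R (v - (2 * (v \<bullet> n)) *\<^sub>R n) \<in> billiard_domain \<gamma>"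
  shows "billiard_flow \<gamma> (s + s) (q - s *\<^sub>R v, v)
     (q + s *\<^sub>R (v - (2 * (v \<bullet> n)) *\<^sub>R n), v - (2 * (v \<bullet> n)) *\<^sub>R n)"
proof -
  have "billiard_flow \<gamma> s (q - s *\<^sub>R v, v) (q - s *\<^sub>R v + s *\<^sub>R v, v)"
  proof (rule billiard_flow_line)
    fix r assume "r \<in> {0<..<s}"
    then have "q - (s - r) *\<^sub>R v \<in> billiard_domain \<gamma>" by (intro dom) auto
    then show "q - s *\<^sub>R v + r *\<^sub>R v \<in> billiard_domain \<gamma>" by (simp add: algebra_simps)
  qed (use s in simp)
  then have "billiard_flow \<gamma> s (q - s *\<^sub>R v, v) (q, v - (2 * (v \<bullet> n)) *\<^sub>R n)"
    using billiard_flow.reflect[OF _ n] by simp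
  then show ?thesis using s dom(2) by (intro billiard_flow.move) auto
qed

text \<open>Used with a sum or a squared difference for \<open>G\<close>. Both are symmetric, so the
  value depends on the line of motion and not on its orientation.\<close>

definition symmetrized :: "(real \<Rightarrow> real \<Rightarrow> real) \<Rightarrow> (real^2 \<Rightarrow> real^2 \<Rightarrow> real) \<Rightarrow> real^2 \<Rightarrow> real^2 \<Rightarrow> real" where
  "symmetrized G \<Phi> q v = G (\<Phi> q v) (\<Phi> q (- v))"

definition flow_invariant :: "(real \<Rightarrow> real^2) \<Rightarrow> (real^2 \<Rightarrow> real^2 \<Rightarrow> real) \<Rightarrow> bool" where
  "flow_invariant \<gamma> \<Phi> \<longleftrightarrow> (\<forall>t q v q' v'. q \<in> billiard_domain \<gamma> \<longrightarrow> q' \<in> billiard_domain \<gamma> \<longrightarrow> norm v = 1 \<longrightarrow>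
             billiard_flow \<gamma> t (q, v) (q', v') \<longrightarrow> \<Phi> q' v' = \<Phi> q v)"

text \<open>The flow runs in positive time only. The value at \<open>- v\<close> is therefore
  compared by running the segment backwards from its other end.\<close>

lemma symmetrized_line:
  assumes \<Phi>: "flow_invariant \<gamma> \<Phi>" and s: "0 \<le> s" and v: "norm v = 1"
    and dom: "\<And>r. r \<in> {0..s} \<Longrightarrow> q + r *\<^sub>R v \<in> billiard_domain \<gamma>"
  shows "symmetrized G \<Phi> (q + s *\<^sub>R v) v = symmetrized G \<Phi> q v"
proof -
  have q: "q \<in> billiard_domain \<gamma>" "q + s *\<^sub>R v \<in> billiard_domain \<gamma>" using dom[of 0] dom[of s] s by auto
  have "billiard_flow \<gamma> s (q, v) (q + s *\<^sub>R v, v)" using dom by (intro billiard_flow_line s) auto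
  then have 1: "\<Phi> (q + s *\<^sub>R v) v = \<Phi> q v" using \<Phi> q v unfolding flow_invariant_def by blast
  have "billiard_flow \<gamma> s (q + s *\<^sub>R v, - v) (q + s *\<^sub>R v + s *\<^sub>R (- v), - v)"
  proof (rule billiard_flow_line[OF s])
    fix r assume "r \<in> {0<..<s}"
    then have "q + (s - r) *\<^sub>R v \<in> billiard_domain \<gamma>" by (intro dom) auto
    then show "q + s *\<^sub>R v + r *\<^sub>R - v \<in> billiard_domain \<gamma>" by (simp add: algebra_simps)
  qed
  then have "billiard_flow \<gamma> s (q + s *\<^sub>R v, - v) (q, - v)" by simp
  then have "\<Phi> q (- v) = \<Phi> (q + s *\<^sub>R v) (- v)"
    using \<Phi> q v norm_minus_cancel[of v] unfolding flow_invariant_def by metis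
  with 1 show ?thesis by (simp add: symmetrized_def)
qed

text \<open>The reversed orbit arrives with \<open>- v'\<close>, has the same positive normal
  component, and leaves with \<open>- v\<close>; so both orientations are preserved by one
  reflection.\<close>

lemma symmetrized_reflection:
  assumes \<Phi>: "flow_invariant \<gamma> \<Phi>" and v: "norm v = 1"
    and n: "outward_unit_normal \<gamma> q n" "v \<bullet> n > 0" and s: "0 < s"
    and v': "v' = v - (2 * (v \<bullet> n)) *\<^sub>R n"
    and dom: "\<And>r. r \<in> {0<..s} \<Longrightarrow> q - r *\<^sub>R v \<in> billiard_domain \<gamma>"
      "\<And>r. r \<in> {0<..s} \<Longrightarrow> q + r *\<^sub>R v' \<in> billiard_domain \<gamma>"
  shows "symmetrized G \<Phi> (q + s *\<^sub>R v') v' = symmetrized G \<Phi> (q - s *\<^sub>R v) v"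
proof -
  have nn: "n \<bullet> n = 1" using n(1) by (simp add: outward_unit_normal_def norm_eq_1)
  have ends: "q - s *\<^sub>R v \<in> billiard_domain \<gamma>" "q + s *\<^sub>R v' \<in> billiard_domain \<gamma>"
    using dom s by auto
  have "v' \<bullet> v' = v \<bullet> v"
    using nn by (simp add: v' inner_diff_left inner_diff_right inner_commute algebra_simps)
  then have nv': "norm (- v') = 1" using v by (simp add: norm_eq_sqrt_inner)
  have vn: "(- v') \<bullet> n = v \<bullet> n" using nn by (simp add: v' inner_diff_left)
  have returns: "- v' - (2 * ((- v') \<bullet> n)) *\<^sub>R n = - v" unfolding vn by (simp add: v')
  have "billiard_flow \<gamma> (s + s) (q - s *\<^sub>R v, v) (q + s *\<^sub>R v', v')"
    unfolding v' by (rule billiard_flow_reflection[OF n s dom(1) dom(2)[unfolded v']])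
  then have 1: "\<Phi> (q + s *\<^sub>R v') v' = \<Phi> (q - s *\<^sub>R v) v"
    using \<Phi> ends v unfolding flow_invariant_def by blast
  have "billiard_flow \<gamma> (s + s) (q - s *\<^sub>R (- v'), - v')
     (q + s *\<^sub>R (- v' - (2 * ((- v') \<bullet> n)) *\<^sub>R n), - v' - (2 * ((- v') \<bullet> n)) *\<^sub>R n)"
  proof (rule billiard_flow_reflection[OF n(1) _ s])
    show "- v' \<bullet> n > 0" using n(2) vn by simp
    show "q - r *\<^sub>R - v' \<in> billiard_domain \<gamma>" if "r \<in> {0<..s}" for r using dom(2)[OF that] by simp
    show "q + r *\<^sub>R (- v' - (2 * (- v' \<bullet> n)) *\<^sub>R n) \<in> billiard_domain \<gamma>" if "r \<in> {0<..s}" for r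
      unfolding returns using dom(1)[OF that] by simp
  qed
  then have "billiard_flow \<gamma> (s + s) (q + s *\<^sub>R v', - v') (q - s *\<^sub>R v, - v)"
    unfolding returns by simp
  then have "\<Phi> (q - s *\<^sub>R v) (- v) = \<Phi> (q + s *\<^sub>R v') (- v')"
    using \<Phi> ends nv' unfolding flow_invariant_def by blast
  with 1 show ?thesis by (simp add: symmetrized_def)
qed

text \<open>For a unit vector of slope \<open>\<mu>\<close> one has
  \<open>v_i^2 (1 + \<mu>^2) = 1\<close>, so \<open>v_i^k v_j^l\<close> equals
  \<open>\<mu>^l (1 + \<mu>^2)^(- (k + l) div 2)\<close>, with one factor \<open>v_i\<close> left
  over when \<open>k + l\<close> is odd. The exponent \<open>2 M\<close> clears all denominators,
  and \<open>M + 2 (2 M)\<close> bounds the degree.\<close>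

lemma parity_polynomial:
  fixes a :: "nat \<Rightarrow> nat \<Rightarrow> real" and \<Phi> :: "real^2 \<Rightarrow> real"
  assumes ij: "i \<noteq> j" and \<Phi>: "\<And>v. \<Phi> v = (\<Sum>k\<le>M. \<Sum>l\<le>M. a k l * (v $ i) ^ k * (v $ j) ^ l)"
  shows "\<exists>p. degree p \<le> 5 * M \<and> (\<forall>v. norm v = 1 \<longrightarrow> v $ i \<noteq> 0 \<longrightarrow>
      (\<Phi> v + \<Phi> (- v)) * (1 + (v $ j / v $ i)\<^sup>2) ^ (2 * M) = poly p (v $ j / v $ i))"
    and "\<exists>p. degree p \<le> 5 * M \<and> (\<forall>v. norm v = 1 \<longrightarrow> v $ i \<noteq> 0 \<longrightarrow>
      (\<Phi> v - \<Phi> (- v)) * (1 + (v $ j / v $ i)\<^sup>2) ^ (2 * M) = v $ i * poly p (v $ j / v $ i))"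
proof -
  define t where "t b k l = (if even (k + l) = b then smult (2 * a k l) (monom 1 l * [:1, 0, 1:] ^ (2 * M - (k + l) div 2)) else 0)"
    for b k l
  define p where "p b = (\<Sum>k\<le>M. \<Sum>l\<le>M. t b k l)" for b
  have deg: "degree (p b) \<le> 5 * M" for b
    unfolding p_def
  proof (intro degree_sum_le finite_atMost)
    fix k l assume "k \<in> {..M}" "l \<in> {..M}"
    have "degree ([:1, 0, 1:] ^ (2 * M - (k + l) div 2) :: real poly) \<le> 2 * (2 * M - (k + l) div 2)"
      using degree_power_le[of "[:1, 0, 1 :: real:]" "2 * M - (k + l) div 2"] by simp
    then have "degree (monom 1 l * [:1, 0, 1:] ^ (2 * M - (k + l) div 2) :: real poly) \<le> l + 2 * (2 * M - (k + l) div 2)"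
      using degree_mult_le[of "monom 1 l :: real poly" "[:1, 0, 1:] ^ (2 * M - (k + l) div 2)"]
      by (simp add: degree_monom_eq)
    also have "\<dots> \<le> 5 * M" using \<open>l \<in> {..M}\<close> by auto
    finally show "degree (t b k l) \<le> 5 * M"
      unfolding t_def using degree_smult_le order_trans by (auto intro: order_trans[OF degree_smult_le])
  qed
  have core: "v $ i ^ k * v $ j ^ l * (1 + (v $ j / v $ i)\<^sup>2) ^ (2 * M) =
      (if even (k + l) then 1 else v $ i) * ((v $ j / v $ i) ^ l * (1 + (v $ j / v $ i)\<^sup>2) ^ (2 * M - (k + l) div 2))"
    if v: "norm v = 1" "v $ i \<noteq> 0" and kl: "k \<le> M" "l \<le> M" for v :: "real^2" and k l
  proof -
    define \<mu> where "\<mu> = v $ j / v $ i"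
    have vj: "v $ j = \<mu> * v $ i" using v by (simp add: \<mu>_def)
    have "(v $ i)\<^sup>2 + (v $ j)\<^sup>2 = 1" using frame_norm[OF ij, of v] v by simp
    then have one: "(v $ i)\<^sup>2 * (1 + \<mu>\<^sup>2) = 1" by (simp add: vj power_mult_distrib algebra_simps)
    have "v $ i ^ k * v $ j ^ l = \<mu> ^ l * v $ i ^ (k + l)" by (simp add: vj power_mult_distrib power_add)
    also have "v $ i ^ (k + l) = (if even (k + l) then 1 else v $ i) * ((v $ i)\<^sup>2) ^ ((k + l) div 2)"
    proof -
      have "k + l = (k + l) mod 2 + 2 * ((k + l) div 2)" by simp
      then have "v $ i ^ (k + l) = v $ i ^ ((k + l) mod 2) * ((v $ i)\<^sup>2) ^ ((k + l) div 2)"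
        by (metis power_add power_mult)
      then show ?thesis by (simp add: even_iff_mod_2_eq_zero odd_iff_mod_2_eq_one)
    qed
    finally have e: "v $ i ^ k * v $ j ^ l = \<mu> ^ l * ((if even (k + l) then 1 else v $ i) * ((v $ i)\<^sup>2) ^ ((k + l) div 2))" .
    have T: "(1 + \<mu>\<^sup>2) ^ (2 * M) = (1 + \<mu>\<^sup>2) ^ ((k + l) div 2) * (1 + \<mu>\<^sup>2) ^ (2 * M - (k + l) div 2)"
      using kl by (subst power_add[symmetric]) (rule arg_cong[of _ _ "\<lambda>n. (1 + \<mu>\<^sup>2) ^ n"], auto)
    have S: "((v $ i)\<^sup>2) ^ ((k + l) div 2) * (1 + \<mu>\<^sup>2) ^ ((k + l) div 2) = 1"
      using one by (simp flip: power_mult_distrib)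
    have comb: "m * (c * s) * (A * U) = c * (m * U)" if "s * A = 1" for m c s A U :: real
    proof -
      have "m * (c * s) * (A * U) = c * (m * U) * (s * A)" by (simp add: mult_ac)
      with that show ?thesis by simp
    qed
    have "\<mu> ^ l * (c * ((v $ i)\<^sup>2) ^ ((k + l) div 2)) * (1 + \<mu>\<^sup>2) ^ (2 * M) =
        c * (\<mu> ^ l * (1 + \<mu>\<^sup>2) ^ (2 * M - (k + l) div 2))" for c
      unfolding T by (rule comb[OF S])
    then show ?thesis unfolding e \<mu>_def[symmetric] .
  qed
  have pv: "(if b then 1 else v $ i) * poly (p b) (v $ j / v $ i) =
      (\<Phi> v + (if b then 1 else - 1) * \<Phi> (- v)) * (1 + (v $ j / v $ i)\<^sup>2) ^ (2 * M)"
    if v: "norm v = 1" "v $ i \<noteq> 0" for v b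
  proof -
    have "(\<Phi> v + (if b then 1 else - 1) * \<Phi> (- v)) * (1 + (v $ j / v $ i)\<^sup>2) ^ (2 * M) =
       (\<Sum>k\<le>M. \<Sum>l\<le>M. a k l * (1 + (if b then 1 else - 1) * (-1) ^ (k + l)) *
          (v $ i ^ k * v $ j ^ l * (1 + (v $ j / v $ i)\<^sup>2) ^ (2 * M)))"
    proof -
      note m = power_minus[of "v $ i"] power_minus[of "v $ j"]
      show ?thesis unfolding \<Phi> sum_distrib_left sum_distrib_right sum.distrib[symmetric]
        by (intro sum.cong refl) (simp add: m power_add algebra_simps)
    qed
    also have "\<dots> = (\<Sum>k\<le>M. \<Sum>l\<le>M. (if b then 1 else v $ i) * poly (t b k l) (v $ j / v $ i))"
    proof (intro sum.cong refl)
      fix k l assume kl: "k \<in> {..M}" "l \<in> {..M}"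
      define E where "E = even (k + l)"
      have pw: "(-1 :: real) ^ (k + l) = (if E then 1 else - 1)" by (simp add: E_def)
      have q: "poly [:1, 0, 1:] x = 1 + x\<^sup>2" for x :: real by (simp add: power2_eq_square)
      show "a k l * (1 + (if b then 1 else - 1) * (-1) ^ (k + l)) *
          (v $ i ^ k * v $ j ^ l * (1 + (v $ j / v $ i)\<^sup>2) ^ (2 * M)) =
          (if b then 1 else v $ i) * poly (t b k l) (v $ j / v $ i)"
        unfolding core[OF v kl[unfolded atMost_iff]] t_def E_def[symmetric] pw
        by (cases b; cases E) (simp_all add: q poly_monom del: poly_pCons)
    qed
    finally show ?thesis by (simp add: p_def poly_sum sum_distrib_left)
  qed
  show "\<exists>p. degree p \<le> 5 * M \<and> (\<forall>v. norm v = 1 \<longrightarrow> v $ i \<noteq> 0 \<longrightarrow>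
      (\<Phi> v + \<Phi> (- v)) * (1 + (v $ j / v $ i)\<^sup>2) ^ (2 * M) = poly p (v $ j / v $ i))"
    using deg pv[of _ True] by (intro exI[of _ "p True"]) auto
  show "\<exists>p. degree p \<le> 5 * M \<and> (\<forall>v. norm v = 1 \<longrightarrow> v $ i \<noteq> 0 \<longrightarrow>
      (\<Phi> v - \<Phi> (- v)) * (1 + (v $ j / v $ i)\<^sup>2) ^ (2 * M) = v $ i * poly p (v $ j / v $ i))"
    using deg pv[of _ False] by (intro exI[of _ "p False"]) auto
qed

lemma symmetrized_polynomial:
  assumes ij: "i \<noteq> j"
    and \<Phi>: "\<And>q v. q \<in> \<Omega> \<Longrightarrow> \<Phi> q v = (\<Sum>k\<le>M. \<Sum>l\<le>M. a k l q * (v $ i) ^ k * (v $ j) ^ l)"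
    and G: "G = (\<lambda>x y. x + y) \<or> G = (\<lambda>x y. (x - y)\<^sup>2)"
  shows "\<exists>N n. \<forall>q\<in>\<Omega>. \<exists>p. degree p \<le> n \<and> (\<forall>v. norm v = 1 \<longrightarrow> v $ i \<noteq> 0 \<longrightarrow>
      symmetrized G \<Phi> q v * (1 + (v $ j / v $ i)\<^sup>2) ^ N = poly p (v $ j / v $ i))"
  using G
proof
  assume G: "G = (\<lambda>x y. x + y)"
  show ?thesis
    using parity_polynomial(1)[OF ij \<Phi>] unfolding symmetrized_def G by blast
next
  assume G: "G = (\<lambda>x y. (x - y)\<^sup>2)"
  \<comment> \<open>Squaring the odd part doubles the exponent and leaves \<open>v_i^2\<close>; one
    more factor \<open>1 + \<mu>^2\<close> cancels it.\<close>
  have "\<exists>p. degree p \<le> 10 * M \<and> (\<forall>v. norm v = 1 \<longrightarrow> v $ i \<noteq> 0 \<longrightarrow>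
      symmetrized G \<Phi> q v * (1 + (v $ j / v $ i)\<^sup>2) ^ (4 * M + 1) = poly p (v $ j / v $ i))" if q: "q \<in> \<Omega>" for q
  proof -
    obtain p where p: "degree p \<le> 5 * M" "\<And>v. norm v = 1 \<Longrightarrow> v $ i \<noteq> 0 \<Longrightarrow>
      (\<Phi> q v - \<Phi> q (- v)) * (1 + (v $ j / v $ i)\<^sup>2) ^ (2 * M) = v $ i * poly p (v $ j / v $ i)"
      using parity_polynomial(2)[OF ij \<Phi>[OF q]] by blast
    have "symmetrized G \<Phi> q v * (1 + (v $ j / v $ i)\<^sup>2) ^ (4 * M + 1) = poly (p\<^sup>2) (v $ j / v $ i)"
      if v: "norm v = 1" "v $ i \<noteq> 0" for v
    proof -
      have "(v $ i)\<^sup>2 + (v $ j)\<^sup>2 = 1" using frame_norm[OF ij, of v] v by simp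
      then have one: "(v $ i)\<^sup>2 * (1 + (v $ j / v $ i)\<^sup>2) = 1" using v by (simp add: power_divide distrib_left)
      have "symmetrized G \<Phi> q v * (1 + (v $ j / v $ i)\<^sup>2) ^ (4 * M + 1) =
         ((\<Phi> q v - \<Phi> q (- v)) * (1 + (v $ j / v $ i)\<^sup>2) ^ (2 * M))\<^sup>2 * (1 + (v $ j / v $ i)\<^sup>2)"
        by (simp add: symmetrized_def G power_mult_distrib flip: power_mult)
      also have "\<dots> = ((v $ i)\<^sup>2 * (1 + (v $ j / v $ i)\<^sup>2)) * (poly p (v $ j / v $ i))\<^sup>2"
        unfolding p(2)[OF v] by (simp add: power_mult_distrib)
      finally show ?thesis unfolding one by simp
    qed
    moreover have "degree (p\<^sup>2) \<le> 10 * M" using p(1) degree_power_le[of p 2] by linarith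
    ultimately show ?thesis by blast
  qed
  then show ?thesis by blast
qed

text \<open>If both symmetrizations were constant, the odd part would have constant square. It
  changes sign under a half turn of the unit circle, so it has a zero there and that square is
  \<open>0\<close>; then the integral itself is constant.\<close>

lemma symmetrized_nonconstant:
  assumes cont: "\<And>q. q \<in> \<Omega> \<Longrightarrow> continuous_on UNIV (\<Phi> q)"
    and nonconst: "\<not> (\<exists>c. \<forall>q\<in>\<Omega>. \<forall>v. norm v = 1 \<longrightarrow> \<Phi> q v = c)"
  shows "\<exists>G. (G = (\<lambda>x y. x + y) \<or> G = (\<lambda>x y. (x - y)\<^sup>2)) \<and>
     \<not> (\<exists>c. \<forall>q\<in>\<Omega>. \<forall>v. norm v = 1 \<longrightarrow> symmetrized G \<Phi> q v = c)"
proof (rule ccontr)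
  assume "\<not> ?thesis"
  then have "\<exists>c. \<forall>q\<in>\<Omega>. \<forall>v. norm v = 1 \<longrightarrow> symmetrized G \<Phi> q v = c"
    if "G = (\<lambda>x y. x + y) \<or> G = (\<lambda>x y. (x - y)\<^sup>2)" for G
    using that by blast
  from this[of "\<lambda>x y. x + y"] this[of "\<lambda>x y. (x - y)\<^sup>2"]
  obtain c d where c: "\<And>q v. q \<in> \<Omega> \<Longrightarrow> norm v = 1 \<Longrightarrow> \<Phi> q v + \<Phi> q (- v) = c"
    and d: "\<And>q v. q \<in> \<Omega> \<Longrightarrow> norm v = 1 \<Longrightarrow> (\<Phi> q v - \<Phi> q (- v))\<^sup>2 = d"
    unfolding symmetrized_def by auto
  have "\<Phi> q v = c / 2" if q: "q \<in> \<Omega>" and v: "norm v = 1" for q v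
  proof -
    define u :: "real \<Rightarrow> real^2" where "u \<theta> = (\<chi> k. if k = 1 then cos \<theta> else sin \<theta>)" for \<theta>
    have nu: "norm (u \<theta>) = 1" for \<theta>
      by (simp add: u_def norm_eq_sqrt_inner inner_vec_def sum_2 flip: power2_eq_square)
    have cu: "continuous_on UNIV u"
      unfolding u_def
    proof (intro continuous_on_vec_lambda)
      show "continuous_on UNIV (\<lambda>\<theta>::real. if k = 1 then cos \<theta> else sin \<theta>)" for k :: 2
        by (cases "k = 1") (simp_all add: continuous_on_cos[OF continuous_on_id] continuous_on_sin[OF continuous_on_id])
    qed
    define g where "g \<theta> = \<Phi> q (u \<theta>) - \<Phi> q (- u \<theta>)" for \<theta>
    have "continuous_on UNIV g" unfolding g_def
      by (intro continuous_on_diff continuous_on_compose2[OF cont[OF q]] continuous_on_minus cu) auto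
    then have "continuous_on {0..pi} g" by (rule continuous_on_subset) auto
    moreover have "g pi = - g 0"
    proof -
      have "u pi = - u 0" by (simp add: u_def vec_eq_iff forall_2)
      then show ?thesis by (simp add: g_def)
    qed
    ultimately obtain \<theta> where "g \<theta> = 0"
      using IVT'[of g 0 0 pi] IVT2'[of g pi 0 0] by (cases "g 0 \<le> 0") auto
    then have "d = 0" using d[OF q nu[of \<theta>]] by (simp add: g_def)
    then have "\<Phi> q v = \<Phi> q (- v)" using d[OF q v] by simp
    with c[OF q v] show ?thesis by simp
  qed
  with nonconst show False by blast
qed

theorem billiard_line_polynomial:
  assumes \<gamma>: "smooth_simple_closed_curve \<gamma>" and int: "polynomially_integrable_billiard \<gamma>" and ij: "i \<noteq> j"
  obtains e N where "\<And>K. \<exists>u v. bieval e u v \<noteq> K * (1 + u\<^sup>2) ^ N"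
    and "\<And>t. \<lbrakk>0 < t; t < 1; vector_derivative \<gamma> (at t) $ i \<noteq> 0\<rbrakk> \<Longrightarrow>
       reflection_invariant e N (vector_derivative \<gamma> (at t) $ j / vector_derivative \<gamma> (at t) $ i) (\<gamma> t $ i) (\<gamma> t $ j)"
proof -
  define \<Omega> where "\<Omega> = billiard_domain \<gamma>"
  have sp: "simple_path \<gamma>" and per: "\<And>t. \<gamma> (t + 1) = \<gamma> t"
    using \<gamma> by (auto simp: smooth_simple_closed_curve_def)
  have "pathfinish \<gamma> = pathstart \<gamma>" using per[of 0] by (simp add: pathfinish_def pathstart_def)
  note J = Jordan_real2[OF sp this]
  have \<Omega>: "open \<Omega>" "connected \<Omega>" using J by (auto simp: \<Omega>_def billiard_domain_def)
  obtain \<Phi> where poly: "polynomial_in_velocity \<Omega> \<Phi>"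
    and nonconst: "\<not> (\<exists>c. \<forall>q\<in>\<Omega>. \<forall>v. norm v = 1 \<longrightarrow> \<Phi> q v = c)"
    and inv: "flow_invariant \<gamma> \<Phi>"
    using int unfolding polynomially_integrable_billiard_def flow_invariant_def \<Omega>_def by blast
  obtain M a where a: "\<And>q v. q \<in> \<Omega> \<Longrightarrow> \<Phi> q v = (\<Sum>k\<le>M. \<Sum>l\<le>M. a k l q * (v $ 1) ^ k * (v $ 2) ^ l)"
    using poly unfolding polynomial_in_velocity_def by blast
  have cont: "continuous_on UNIV (\<Phi> q)" if "q \<in> \<Omega>" for q
    unfolding a[OF that, abs_def] by (intro continuous_intros)
  obtain G where G: "G = (\<lambda>x y. x + y) \<or> G = (\<lambda>x y. (x - y)\<^sup>2)"
    and nc: "\<not> (\<exists>c. \<forall>q\<in>\<Omega>. \<forall>v. norm v = 1 \<longrightarrow> symmetrized G \<Phi> q v = c)"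
    using symmetrized_nonconstant[OF cont nonconst] by blast
  define \<Psi> where "\<Psi> = symmetrized G \<Phi>"
  have "i = 1 \<and> j = 2 \<or> i = 2 \<and> j = 1" using ij exhaust_2[of i] exhaust_2[of j] by auto
  then have "\<exists>b. \<forall>q\<in>\<Omega>. \<forall>v. \<Phi> q v = (\<Sum>k\<le>M. \<Sum>l\<le>M. b k l q * (v $ i) ^ k * (v $ j) ^ l)"
  proof
    assume "i = 1 \<and> j = 2"
    with a show ?thesis by blast
  next
    assume "i = 2 \<and> j = 1"
    moreover have "(\<Sum>k\<le>M. \<Sum>l\<le>M. a k l q * (v $ 1) ^ k * (v $ 2) ^ l) =
        (\<Sum>k\<le>M. \<Sum>l\<le>M. a l k q * (v $ 2) ^ k * (v $ 1) ^ l)" for q and v :: "real^2"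
      by (subst sum.swap) (simp add: mult_ac)
    ultimately show ?thesis using a by (intro exI[of _ "\<lambda>k l. a l k"]) simp
  qed
  then obtain b where b: "\<And>q v. q \<in> \<Omega> \<Longrightarrow> \<Phi> q v = (\<Sum>k\<le>M. \<Sum>l\<le>M. b k l q * (v $ i) ^ k * (v $ j) ^ l)" by blast
  have "\<exists>N n. \<forall>q\<in>\<Omega>. \<exists>p. degree p \<le> n \<and> (\<forall>v. norm v = 1 \<longrightarrow> v $ i \<noteq> 0 \<longrightarrow>
      \<Psi> q v * (1 + (v $ j / v $ i)\<^sup>2) ^ N = poly p (v $ j / v $ i))"
    unfolding \<Psi>_def by (rule symmetrized_polynomial[OF ij _ G]) (rule b)
  then obtain N n where "\<forall>q\<in>\<Omega>. \<exists>p. degree p \<le> n \<and> (\<forall>v. norm v = 1 \<longrightarrow> v $ i \<noteq> 0 \<longrightarrow>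
      \<Psi> q v * (1 + (v $ j / v $ i)\<^sup>2) ^ N = poly p (v $ j / v $ i))" by blast
  from bchoice[OF this] obtain p where p0: "\<forall>q\<in>\<Omega>. degree (p q) \<le> n \<and> (\<forall>v. norm v = 1 \<longrightarrow> v $ i \<noteq> 0 \<longrightarrow>
      \<Psi> q v * (1 + (v $ j / v $ i)\<^sup>2) ^ N = poly (p q) (v $ j / v $ i))" ..
  have deg: "\<And>q. q \<in> \<Omega> \<Longrightarrow> degree (p q) \<le> n"
    and p: "\<And>q v. \<lbrakk>q \<in> \<Omega>; norm v = 1; v $ i \<noteq> 0\<rbrakk> \<Longrightarrow>
      \<Psi> q v * (1 + (v $ j / v $ i)\<^sup>2) ^ N = poly (p q) (v $ j / v $ i)"
    using p0 by simp_all
  have line1: "poly (p q) \<mu> = poly (p q') \<mu>"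
    if seg: "closed_segment q q' \<subseteq> \<Omega>" and \<mu>: "q' $ j - q $ j = \<mu> * (q' $ i - q $ i)" and le: "q $ i \<le> q' $ i"
    for q q' \<mu>
  proof -
    \<comment> \<open>The direction \<open>(1, \<mu>)\<close> is scaled to unit length. Ordering the
      endpoints by \<open>i\<close>-coordinate makes the time of travel nonnegative.\<close>
    define L where "L = sqrt (1 + \<mu>\<^sup>2)"
    have L: "L > 0" "L\<^sup>2 = 1 + \<mu>\<^sup>2" using one_plus_square_pos[of \<mu>] by (simp_all add: L_def)
    define v :: "real^2" where "v = (\<chi> k. if k = i then 1 / L else \<mu> / L)"
    have v: "v $ i = 1 / L" "v $ j = \<mu> / L" using ij by (auto simp: v_def)
    have "(norm v)\<^sup>2 = 1" using L one_plus_square_pos[of \<mu>] unfolding frame_norm[OF ij] v power_divide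
      by (simp add: add_divide_distrib[symmetric])
    then have nv: "norm v = 1" by (simp add: power2_eq_1_iff) (metis norm_ge_zero not_one_le_zero neg_0_le_iff_le)
    define s where "s = (q' $ i - q $ i) * L"
    have s: "s \<ge> 0" using le L by (simp add: s_def)
    have q': "q' = q + s *\<^sub>R v"
      by (rule frame_eqI[OF ij]) (use \<mu> L in \<open>simp_all add: v s_def field_simps\<close>)
    have "q + r *\<^sub>R v \<in> billiard_domain \<gamma>" if r: "r \<in> {0..s}" for r
    proof -
      have "q + r *\<^sub>R v \<in> closed_segment q q'"
      proof (cases "s = 0")
        case False
        then have "q + r *\<^sub>R v = (1 - r / s) *\<^sub>R q + (r / s) *\<^sub>R q'"
          unfolding q' by (simp add: algebra_simps)
        then show ?thesis using r False s unfolding closed_segment_def by (auto intro!: exI[of _ "r / s"])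
      qed (use r q' in simp)
      with seg show ?thesis by (auto simp: \<Omega>_def)
    qed
    from symmetrized_line[OF inv s nv this] have "\<Psi> q' v = \<Psi> q v" unfolding \<Psi>_def q' by blast
    moreover have "q \<in> \<Omega>" "q' \<in> \<Omega>" using seg by auto
    moreover have "v $ j / v $ i = \<mu>" "v $ i \<noteq> 0" using L by (simp_all add: v)
    ultimately show ?thesis using p[of q v] p[of q' v] nv by simp
  qed
  have line: "poly (p q) \<mu> = poly (p q') \<mu>"
    if seg: "closed_segment q q' \<subseteq> \<Omega>" and \<mu>: "q' $ j - q $ j = \<mu> * (q' $ i - q $ i)" for q q' \<mu>
  proof (cases "q $ i \<le> q' $ i")
    case False
    then show ?thesis using line1[of q' q \<mu>] seg \<mu> by (simp add: closed_segment_commute algebra_simps)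
  qed (rule line1[OF seg \<mu>])
  have "\<exists>e. \<forall>q\<in>\<Omega>. \<forall>\<mu>. poly (p q) \<mu> = bieval e \<mu> (q $ j - \<mu> * q $ i)"
    by (rule line_function_polynomial[OF ij \<Omega>]) (fact deg, fact line)
  then obtain e where e: "\<And>q \<mu>. q \<in> \<Omega> \<Longrightarrow> poly (p q) \<mu> = bieval e \<mu> (q $ j - \<mu> * q $ i)" by blast
  show thesis
  proof (rule that)
    show "\<exists>u v. bieval e u v \<noteq> K * (1 + u\<^sup>2) ^ N" for K
    proof (rule ccontr)
      assume "\<not> ?thesis"
      then have K: "bieval e u v = K * (1 + u\<^sup>2) ^ N" for u v by blast
      have 1: "\<Psi> q v = K" if "q \<in> \<Omega>" "norm v = 1" "v $ i \<noteq> 0" for q v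
        using p[OF that] one_plus_square_pos[of "v $ j / v $ i"] by (simp add: e[OF that(1)] K)
      have "\<Psi> q v = K" if q: "q \<in> \<Omega>" and v: "norm v = 1" for q v
      proof (cases "v $ i = 0")
        case False
        then show ?thesis using 1 q v by blast
      next
        case True
        then have vj: "(v $ j)\<^sup>2 = 1" using frame_norm[OF ij, of v] v by simp
        \<comment> \<open>Directions without slope are invisible to \<open>e\<close>. This arc of
          unit vectors starts at \<open>v\<close> and has slopes immediately afterwards, so the
          value at \<open>v\<close> follows by continuity.\<close>
        define w :: "real \<Rightarrow> real^2" where "w \<theta> = (\<chi> k. if k = i then sin \<theta> else v $ j * cos \<theta>)" for \<theta>
        have w: "w \<theta> $ i = sin \<theta>" "w \<theta> $ j = v $ j * cos \<theta>" for \<theta> using ij by (auto simp: w_def)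
        have "(norm (w \<theta>))\<^sup>2 = 1" for \<theta> by (simp add: frame_norm[OF ij] w power_mult_distrib vj)
        then have nw: "norm (w \<theta>) = 1" for \<theta> by (metis norm_ge_zero one_power2 power2_eq_imp_eq zero_le_one)
        have "continuous_on UNIV w" unfolding w_def
        proof (intro continuous_on_vec_lambda)
          show "continuous_on UNIV (\<lambda>\<theta>::real. if k = i then sin \<theta> else v $ j * cos \<theta>)" for k
            by (cases "k = i") (simp_all add: continuous_on_mult continuous_on_cos[OF continuous_on_id] continuous_on_sin[OF continuous_on_id])
        qed
        moreover have "continuous_on UNIV (\<Psi> q)"
        proof -
          have c2: "continuous_on UNIV (\<lambda>v. \<Phi> q (- v))"
            by (intro continuous_on_compose2[OF cont[OF q]] continuous_intros) auto
          from G show ?thesis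
            unfolding \<Psi>_def symmetrized_def by (elim disjE) (auto intro!: continuous_intros cont[OF q] c2)
        qed
        ultimately have "continuous_on UNIV (\<lambda>\<theta>. \<Psi> q (w \<theta>))" by (metis continuous_on_compose2 subset_UNIV)
        then have "isCont (\<lambda>\<theta>. \<Psi> q (w \<theta>)) 0" by (simp add: continuous_on_eq_continuous_at)
        then have lim: "((\<lambda>\<theta>. \<Psi> q (w \<theta>)) \<longlongrightarrow> \<Psi> q (w 0)) (at_right 0)"
          unfolding isCont_def by (rule filterlim_mono[OF _ order_refl at_le]) simp
        have "\<forall>\<^sub>F \<theta> in at_right 0. \<Psi> q (w \<theta>) = K"
          unfolding eventually_at_right_field
        proof (intro exI[of _ pi] conjI allI impI)
          fix \<theta> :: real assume "0 < \<theta>" "\<theta> < pi"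
          then have "sin \<theta> \<noteq> 0" using sin_gt_zero[of \<theta>] by simp
          then show "\<Psi> q (w \<theta>) = K" using 1[OF q nw] by (simp add: w)
        qed simp
        then have "((\<lambda>\<theta>. \<Psi> q (w \<theta>)) \<longlongrightarrow> K) (at_right 0)" by (rule tendsto_eventually)
        with lim have "\<Psi> q (w 0) = K" using tendsto_unique trivial_limit_at_right_real by blast
        moreover have "w 0 = v" by (rule frame_eqI[OF ij]) (simp_all add: w True)
        ultimately show ?thesis by simp
      qed
      then have "\<forall>q\<in>\<Omega>. \<forall>v. norm v = 1 \<longrightarrow> symmetrized G \<Phi> q v = K" by (simp add: \<Psi>_def)
      then show False using nc by (metis (no_types))
    qed
    show "reflection_invariant e N (vector_derivative \<gamma> (at t) $ j / vector_derivative \<gamma> (at t) $ i) (\<gamma> t $ i) (\<gamma> t $ j)"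
      if t: "0 < t" "t < 1" and nz: "vector_derivative \<gamma> (at t) $ i \<noteq> 0" for t
    proof -
      define m0 where "m0 = vector_derivative \<gamma> (at t) $ j / vector_derivative \<gamma> (at t) $ i"
      obtain n where n: "norm n = 1" "n \<bullet> vector_derivative \<gamma> (at t) = 0"
        and inside: "\<And>v. v \<bullet> n < 0 \<Longrightarrow> \<forall>\<^sub>F s in at_right 0. \<gamma> t + s *\<^sub>R v \<in> inside (path_image \<gamma>)"
        and outside: "\<And>v. v \<bullet> n > 0 \<Longrightarrow> \<forall>\<^sub>F s in at_right 0. \<gamma> t + s *\<^sub>R v \<in> outside (path_image \<gamma>)"
        by (rule smooth_curve_two_sided[OF \<gamma> t]) blast
      have nn: "n \<bullet> n = 1" using n(1) by (simp add: norm_eq_1)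
      have normal: "outward_unit_normal \<gamma> (\<gamma> t) n"
        unfolding outward_unit_normal_def using n outside[of n] nn by auto
      have ni: "n $ i = - m0 * n $ j"
        using n(2) nz by (simp add: frame_inner[OF ij] m0_def field_simps)
      have nj: "(n $ j)\<^sup>2 * (1 + m0\<^sup>2) = 1"
        using nn by (simp add: frame_inner[OF ij] ni power2_eq_square algebra_simps)
      have "pencil_fun e N m0 (\<gamma> t $ i) (\<gamma> t $ j) (- s) = pencil_fun e N m0 (\<gamma> t $ i) (\<gamma> t $ j) s"
        if s: "\<bar>m0 * s\<bar> < 1" for s
      proof (cases "s = 0")
        case s0: False
        define V where "V s = (\<chi> k. if k = i then 1 - m0 * s else m0 + s)" for s
        have V: "V s $ i = 1 - m0 * s" "V s $ j = m0 + s" for s using ij by (auto simp: V_def)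
        define L where "L = sqrt ((1 + m0\<^sup>2) * (1 + s\<^sup>2))"
        have L2: "L\<^sup>2 = (1 + m0\<^sup>2) * (1 + s\<^sup>2)" and L: "L > 0"
          using one_plus_square_pos[of m0] one_plus_square_pos[of s] by (simp_all add: L_def)
        have nV: "norm (V s) = L" "norm (V (- s)) = L"
        proof -
          have "(norm (V s))\<^sup>2 = L\<^sup>2" "(norm (V (- s)))\<^sup>2 = L\<^sup>2"
            unfolding frame_norm[OF ij] V L2 by (simp_all add: power2_eq_square algebra_simps)
          then show "norm (V s) = L" "norm (V (- s)) = L" using L by (auto intro!: power2_eq_imp_eq)
        qed
        have Vn: "V s \<bullet> n = n $ j * s * (1 + m0\<^sup>2)"
          by (simp add: frame_inner[OF ij] V ni power2_eq_square algebra_simps)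
        have "V s \<bullet> n \<noteq> 0" unfolding Vn using nj s0 by auto
        \<comment> \<open>Normalizes the length and orients \<open>v\<close> outward, so that it is
          the incoming velocity of a collision. Then \<open>- v\<close> and \<open>v'\<close> both
          point inward, and short pieces of both rays lie in the domain.\<close>
        define c where "c = sgn (V s \<bullet> n) / L"
        have c: "c \<noteq> 0" "\<bar>c\<bar> = 1 / L" using \<open>V s \<bullet> n \<noteq> 0\<close> L by (auto simp: c_def abs_sgn_eq sgn_zero_iff)
        define v where "v = c *\<^sub>R V s"
        define v' where "v' = c *\<^sub>R V (- s)"
        have vn: "norm v = 1" "norm v' = 1" using nV c L by (simp_all add: v_def v'_def)
        have pos: "v \<bullet> n > 0"
        proof -
          have "v \<bullet> n = \<bar>V s \<bullet> n\<bar> / L" by (simp add: v_def c_def abs_sgn mult.commute)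
          then show ?thesis using \<open>V s \<bullet> n \<noteq> 0\<close> L by simp
        qed
        have v': "v' = v - (2 * (v \<bullet> n)) *\<^sub>R n"
        proof -
          have "V (- s) = V s - (2 * (V s \<bullet> n)) *\<^sub>R n"
          proof (rule frame_eqI[OF ij])
            have "2 * (V s \<bullet> n) * n $ j = 2 * s * ((n $ j)\<^sup>2 * (1 + m0\<^sup>2))"
              unfolding Vn by (simp add: power2_eq_square algebra_simps)
            then have k: "2 * (V s \<bullet> n) * n $ j = 2 * s" unfolding nj by simp
            then show "V (- s) $ j = (V s - (2 * (V s \<bullet> n)) *\<^sub>R n) $ j" by (simp add: V)
            show "V (- s) $ i = (V s - (2 * (V s \<bullet> n)) *\<^sub>R n) $ i"
              using k by (auto simp: V ni algebra_simps)
          qed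
          then have "v' = c *\<^sub>R (V s - (2 * (V s \<bullet> n)) *\<^sub>R n)" by (simp only: v'_def)
          then show ?thesis by (simp add: v_def scaleR_diff_right mult_ac)
        qed
        have "v' \<bullet> n < 0" using pos nn by (simp add: v' inner_diff_left)
        then have "\<forall>\<^sub>F r in at_right 0. \<gamma> t + r *\<^sub>R v' \<in> \<Omega>" using inside by (simp add: \<Omega>_def billiard_domain_def)
        moreover have "\<forall>\<^sub>F r in at_right 0. \<gamma> t + r *\<^sub>R (- v) \<in> \<Omega>"
          using inside[of "- v"] pos by (simp add: \<Omega>_def billiard_domain_def)
        ultimately have "\<forall>\<^sub>F r in at_right 0. \<gamma> t + r *\<^sub>R v' \<in> \<Omega> \<and> \<gamma> t + r *\<^sub>R (- v) \<in> \<Omega>" by (rule eventually_conj)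
        then obtain d where d: "d > 0" and dom: "\<And>r. 0 < r \<Longrightarrow> r < d \<Longrightarrow> \<gamma> t + r *\<^sub>R v' \<in> \<Omega> \<and> \<gamma> t + r *\<^sub>R (- v) \<in> \<Omega>"
          unfolding eventually_at_right_field by blast
        define r where "r = d / 2"
        have r: "r > 0" "r < d" using d by (auto simp: r_def)
        have eq: "\<Psi> (\<gamma> t + r *\<^sub>R v') v' = \<Psi> (\<gamma> t - r *\<^sub>R v) v"
          unfolding \<Psi>_def
        proof (rule symmetrized_reflection[OF inv vn(1) normal pos r(1) v'])
          fix x assume x: "x \<in> {0<..r}"
          show "\<gamma> t - x *\<^sub>R v \<in> billiard_domain \<gamma>" "\<gamma> t + x *\<^sub>R v' \<in> billiard_domain \<gamma>"
            using dom[of x] x r by (auto simp: \<Omega>_def)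
        qed
        have ends: "\<gamma> t + r *\<^sub>R v' \<in> \<Omega>" "\<gamma> t - r *\<^sub>R v \<in> \<Omega>" using dom[OF r] by simp_all
        \<comment> \<open>The normalizing factor relating \<open>pencil_fun\<close> to the integral
          is the same for \<open>s\<close> and \<open>- s\<close>.\<close>
        have pencil: "pencil_fun e N m0 (\<gamma> t $ i) (\<gamma> t $ j) x = \<Psi> (\<gamma> t + y *\<^sub>R w) w * ((1 + m0\<^sup>2) * (1 + x\<^sup>2)) ^ N"
          if w: "w = c *\<^sub>R V x" "norm w = 1" and q: "\<gamma> t + y *\<^sub>R w \<in> \<Omega>" and x: "\<bar>m0 * x\<bar> < 1" for w x y
        proof -
          have nz: "1 - m0 * x \<noteq> 0" using x by auto
          define \<mu> where "\<mu> = (m0 + x) / (1 - m0 * x)"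
          have wi: "w $ i \<noteq> 0" and wm: "w $ j / w $ i = \<mu>" using w c nz by (simp_all add: V \<mu>_def)
          then have wj: "w $ j = \<mu> * w $ i" by (simp add: field_simps)
          have on_line: "(\<gamma> t + y *\<^sub>R w) $ j - \<mu> * (\<gamma> t + y *\<^sub>R w) $ i = \<gamma> t $ j - \<gamma> t $ i * \<mu>"
            by (simp add: wj algebra_simps)
          have P: "\<Psi> (\<gamma> t + y *\<^sub>R w) w * (1 + \<mu>\<^sup>2) ^ N = bieval e \<mu> (\<gamma> t $ j - \<gamma> t $ i * \<mu>)"
            using p[OF q w(2) wi] unfolding wm e[OF q] on_line .
          note unit_direction_square[OF nz, of N, folded \<mu>_def]
          then show ?thesis unfolding pencil_fun_def \<mu>_def[symmetric] P[symmetric]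
            by (metis mult.assoc mult.commute)
        qed
        have "pencil_fun e N m0 (\<gamma> t $ i) (\<gamma> t $ j) s = \<Psi> (\<gamma> t - r *\<^sub>R v) v * ((1 + m0\<^sup>2) * (1 + s\<^sup>2)) ^ N"
          using pencil[OF v_def vn(1), of "- r"] ends s by simp
        moreover have "pencil_fun e N m0 (\<gamma> t $ i) (\<gamma> t $ j) (- s) = \<Psi> (\<gamma> t + r *\<^sub>R v') v' * ((1 + m0\<^sup>2) * (1 + s\<^sup>2)) ^ N"
          using pencil[OF v'_def vn(2), of r] ends s by simp
        ultimately show ?thesis using eq by simp
      qed simp
      then show ?thesis unfolding m0_def[symmetric] reflection_invariant_def by blast
    qed
  qed
qed

section \<open>Common tangent lines\<close>

lemma plane_curve_components:
  fixes \<gamma> :: "real \<Rightarrow> real^2"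
  assumes "\<And>t. (\<gamma> has_vector_derivative D1 t) (at t)" "\<And>t. (D1 has_vector_derivative D2 t) (at t)"
  shows "plane_curve (\<lambda>t. \<gamma> t $ i) (\<lambda>t. \<gamma> t $ j) (\<lambda>t. D1 t $ i) (\<lambda>t. D1 t $ j) (\<lambda>t. D2 t $ i) (\<lambda>t. D2 t $ j)"
proof -
  have "((\<lambda>t. f t $ k) has_real_derivative f' $ k) (at t)" if "(f has_vector_derivative f') (at t)"
    for f :: "real \<Rightarrow> real^2" and f' k t
    using bounded_linear.has_vector_derivative[OF bounded_linear_vec_nth that]
    by (simp add: has_real_derivative_iff_has_vector_derivative)
  with assms show ?thesis by unfold_locales blast+
qed

context plane_curve
begin

text \<open>Written without division, the constancy of the slope is a closed condition and so
  reaches the endpoints, where \<open>x1\<close> may vanish.\<close>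

lemma slope_constant:
  assumes lu: "l < u" and str: "\<And>t. t \<in> {l<..<u} \<Longrightarrow> x1 t \<noteq> 0 \<and> m1 t = 0"
  obtains \<mu> where "\<And>t. t \<in> {l..u} \<Longrightarrow> y1 t = \<mu> * x1 t"
proof -
  define c where "c = (l + u) / 2"
  have c: "c \<in> {l<..<u}" using lu by (simp add: c_def)
  have "y1 t = m c * x1 t" if t: "t \<in> {l<..<u}" for t
  proof -
    have "m t = m c"
    proof (rule DERIV_isconst3[OF lu t c])
      fix s assume "s \<in> {l<..<u}"
      then show "DERIV m s :> 0" using DERIV_m[of s] str[of s] by simp
    qed
    then show ?thesis using str[OF t] by (simp add: m_def field_simps)
  qed
  then have "{l<..<u} \<subseteq> {t. y1 t = m c * x1 t}" by blast
  moreover have "closed {t. y1 t = m c * x1 t}"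
  proof -
    have "continuous_on UNIV y1" "continuous_on UNIV x1"
      using DERIV_isCont[OF DERIV_y1] DERIV_isCont[OF DERIV_x1] by (auto simp: continuous_on_eq_continuous_at)
    then show ?thesis by (intro closed_Collect_eq continuous_intros)
  qed
  ultimately have "closure {l<..<u} \<subseteq> {t. y1 t = m c * x1 t}" by (rule closure_minimal)
  then show thesis using lu by (intro that[of "m c"]) auto
qed

end

text \<open>By Rolle a closed curve has points with \<open>x1 = 0\<close> and points with
  \<open>y1 = 0\<close>, hence with \<open>x1 \<noteq> 0\<close>. Were all pieces with
  \<open>x1 \<noteq> 0\<close> straight, the constant slope would persist up to the nearest zero of
  \<open>x1\<close>, where the velocity would then vanish altogether. Continuity widens a curved
  point to an arc.\<close>

lemma exists_curved_arc:
  assumes \<gamma>: "smooth_simple_closed_curve \<gamma>" and ij: "i \<noteq> j"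
    and D1: "\<And>t. (\<gamma> has_vector_derivative D1 t) (at t)" and D2: "\<And>t. (D1 has_vector_derivative D2 t) (at t)"
    and nz: "\<And>t. D1 t \<noteq> 0" and cont: "\<And>t. isCont D2 t"
  shows "\<exists>a a'. 0 \<le> a \<and> a < a' \<and> a' \<le> 1 \<and> (\<forall>t\<in>{a<..<a'}. D1 t $ i \<noteq> 0 \<and>
     plane_curve.m1 (\<lambda>t. D1 t $ i) (\<lambda>t. D1 t $ j) (\<lambda>t. D2 t $ i) (\<lambda>t. D2 t $ j) t \<noteq> 0)"
proof -
  interpret plane_curve "\<lambda>t. \<gamma> t $ i" "\<lambda>t. \<gamma> t $ j" "\<lambda>t. D1 t $ i" "\<lambda>t. D1 t $ j" "\<lambda>t. D2 t $ i" "\<lambda>t. D2 t $ j"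
    by (rule plane_curve_components[OF D1 D2])
  have "\<gamma> 0 = \<gamma> 1" using \<gamma> unfolding smooth_simple_closed_curve_def by (metis add_0)
  have rolle: "\<exists>z. 0 < z \<and> z < 1 \<and> D1 z $ k = 0" for k
  proof -
    have d: "((\<lambda>t. \<gamma> t $ k) has_real_derivative D1 t $ k) (at t)" for t
      by (rule plane_curve.DERIV_x[OF plane_curve_components[OF D1 D2]])
    have "\<exists>z. 0 < z \<and> z < 1 \<and> DERIV (\<lambda>t. \<gamma> t $ k) z :> 0"
      using d \<open>\<gamma> 0 = \<gamma> 1\<close>
      by (intro Rolle) (auto intro!: continuous_at_imp_continuous_on DERIV_isCont simp: real_differentiable_def)
    then show ?thesis using DERIV_unique[OF d] by blast
  qed
  have comp: "D1 t $ i \<noteq> 0 \<or> D1 t $ j \<noteq> 0" for t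
    using nz[of t] frame_eqI[OF ij, of "D1 t" 0] by auto
  obtain t1 where t1: "0 < t1" "t1 < 1" "D1 t1 $ i \<noteq> 0" using rolle[of j] comp by blast
  obtain z where z: "0 < z" "z < 1" "D1 z $ i = 0" using rolle[of i] by blast
  have c1: "continuous_on UNIV (\<lambda>t. D1 t $ i)"
    using DERIV_isCont[OF DERIV_x1] by (simp add: continuous_on_eq_continuous_at)
  have zeros: "compact ({l..u} \<inter> {t. D1 t $ i = 0})" for l u
    by (intro compact_Int_closed compact_Icc closed_Collect_eq c1 continuous_intros)
  have "\<exists>t. 0 < t \<and> t < 1 \<and> D1 t $ i \<noteq> 0 \<and> m1 t \<noteq> 0"
  proof (rule ccontr)
    assume "\<not> ?thesis"
    then have flat: "m1 t = 0" if "0 < t" "t < 1" "D1 t $ i \<noteq> 0" for t using that by blast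
    have contra: False
      if lu: "0 < l" "l < u" "u < 1" and x: "\<And>t. t \<in> {l<..<u} \<Longrightarrow> D1 t $ i \<noteq> 0" and w: "w \<in> {l..u}" "D1 w $ i = 0" for l u w
    proof (rule slope_constant[OF lu(2)])
      show "D1 t $ i \<noteq> 0 \<and> m1 t = 0" if "t \<in> {l<..<u}" for t
        using x[OF that] flat[of t] that lu by auto
      fix \<mu> assume \<mu>: "\<And>t. t \<in> {l..u} \<Longrightarrow> D1 t $ j = \<mu> * D1 t $ i"
      show False using \<mu>[OF w(1)] w(2) comp[of w] by simp
    qed
    show False
    proof (cases "t1 < z")
      case True
      then have "z \<in> {t1..z} \<inter> {t. D1 t $ i = 0}" using z by simp
      then have "{t1..z} \<inter> {t. D1 t $ i = 0} \<noteq> {}" by blast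
      then obtain w where w: "w \<in> {t1..z}" "D1 w $ i = 0" and min: "\<And>t. t \<in> {t1..z} \<Longrightarrow> D1 t $ i = 0 \<Longrightarrow> w \<le> t"
        using compact_attains_inf[OF zeros] by blast
      have "w \<noteq> t1" using w t1 by auto
      show False
      proof (rule contra[of t1 w w])
        show "D1 t $ i \<noteq> 0" if "t \<in> {t1<..<w}" for t using min[of t] that w by auto
      qed (use w t1 z \<open>w \<noteq> t1\<close> in auto)
    next
      case False
      then have lt: "z < t1" using z t1 by (cases "z = t1") auto
      then have "z \<in> {z..t1} \<inter> {t. D1 t $ i = 0}" using z by simp
      then have "{z..t1} \<inter> {t. D1 t $ i = 0} \<noteq> {}" by blast
      then obtain w where w: "w \<in> {z..t1}" "D1 w $ i = 0" and max: "\<And>t. t \<in> {z..t1} \<Longrightarrow> D1 t $ i = 0 \<Longrightarrow> t \<le> w"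
        using compact_attains_sup[OF zeros] by blast
      have "w \<noteq> t1" using w t1 by auto
      show False
      proof (rule contra[of w t1 w])
        show "D1 t $ i \<noteq> 0" if "t \<in> {w<..<t1}" for t using max[of t] that w by auto
      qed (use w t1 z \<open>w \<noteq> t1\<close> in auto)
    qed
  qed
  then obtain t where t: "0 < t" "t < 1" "D1 t $ i \<noteq> 0" "m1 t \<noteq> 0" by blast
  have c: "isCont (\<lambda>t. D1 t $ k) s" "isCont (\<lambda>t. D2 t $ k) s" for k s
    using has_vector_derivative_continuous[OF D2[of s]] cont by (auto intro!: continuous_intros)
  have "isCont m1 t" unfolding m1_def[abs_def] using t(3) by (intro continuous_intros c) auto
  then have "(m1 \<longlongrightarrow> m1 t) (nhds t)" using isCont_def tendsto_nhds_iff by blast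
  then have "\<forall>\<^sub>F s in nhds t. m1 s \<noteq> 0" using t(4) by (rule tendsto_imp_eventually_ne)
  moreover have "\<forall>\<^sub>F s in nhds t. s \<in> {0<..<1}" using t by (intro eventually_nhds_in_open) auto
  ultimately have "\<forall>\<^sub>F s in nhds t. D1 s $ i \<noteq> 0 \<and> m1 s \<noteq> 0 \<and> s \<in> {0<..<1}"
    using eventually_x1[OF t(3)] by eventually_elim auto
  then obtain d where "d > 0" and D: "\<And>s. s \<in> {t - d<..<t + d} \<Longrightarrow> D1 s $ i \<noteq> 0 \<and> m1 s \<noteq> 0 \<and> s \<in> {0<..<1}"
    by (rule eventually_nhds_interval) blast
  show ?thesis
  proof (rule exI[of _ t], rule exI[of _ "min 1 (t + d)"], intro conjI ballI)
    fix s assume "s \<in> {t<..<min 1 (t + d)}"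
    then have "s \<in> {t - d<..<t + d}" using \<open>d > 0\<close> by auto
    from D[OF this] show "D1 s $ i \<noteq> 0" "m1 s \<noteq> 0" by auto
  qed (use t \<open>d > 0\<close> in auto)
qed

section \<open>Coincidence of tangent lines and propagation along the ovals\<close>

definition cross :: "real^2 \<Rightarrow> real^2 \<Rightarrow> real" where
  "cross v w = v $ 1 * w $ 2 - v $ 2 * w $ 1"

lemma cross_eq_0_iff:
  assumes "i \<noteq> j"
  shows "cross v w = 0 \<longleftrightarrow> v $ i * w $ j = v $ j * w $ i"
proof -
  have "i = 1 \<and> j = 2 \<or> i = 2 \<and> j = 1" using assms exhaust_2[of i] exhaust_2[of j] by auto
  then show ?thesis by (auto simp: cross_def)
qed

text \<open>For nonzero \<open>v\<close>, \<open>w\<close>: the lines \<open>p + \<real> v\<close> and \<open>q + \<real> w\<close> coincide.\<close>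

definition same_line :: "real^2 \<Rightarrow> real^2 \<Rightarrow> real^2 \<Rightarrow> real^2 \<Rightarrow> bool" where
  "same_line p v q w \<longleftrightarrow> cross v w = 0 \<and> cross v (q - p) = 0"

lemma same_line_frame:
  assumes ij: "i \<noteq> j" and w: "w \<noteq> 0" and v: "v $ i \<noteq> 0"
  shows "same_line p v q w \<longleftrightarrow> w $ i \<noteq> 0 \<and> v $ j / v $ i = w $ j / w $ i \<and>
     p $ j - v $ j / v $ i * p $ i = q $ j - w $ j / w $ i * q $ i"
proof -
  have wi: "w $ i \<noteq> 0" if "cross v w = 0"
  proof
    assume "w $ i = 0"
    with that v have "w $ j = 0" by (simp add: cross_eq_0_iff[OF ij])
    with \<open>w $ i = 0\<close> w frame_eqI[OF ij, of w 0] show False by simp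
  qed
  have slope: "cross v w = 0 \<longleftrightarrow> v $ j / v $ i = w $ j / w $ i" if "w $ i \<noteq> 0"
    using that v by (auto simp: cross_eq_0_iff[OF ij] field_simps)
  have "cross v (q - p) = 0 \<longleftrightarrow> p $ j - v $ j / v $ i * p $ i = q $ j - v $ j / v $ i * q $ i"
    using v by (simp add: cross_eq_0_iff[OF ij] field_simps) (auto simp: algebra_simps)
  with wi slope show ?thesis unfolding same_line_def by metis
qed

lemma periodic_frac:
  fixes f :: "real \<Rightarrow> 'a"
  assumes "\<And>t. f (t + 1) = f t"
  shows "f (frac t) = f t"
proof -
  have nat: "f (t + real n) = f t" for t n
  proof (induction n)
    case (Suc n)
    have "t + real (Suc n) = t + real n + 1" by simp
    then show ?case using assms[of "t + real n"] Suc by (simp only:)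
  qed simp
  show ?thesis
  proof (cases "\<lfloor>t\<rfloor> \<ge> 0")
    case True
    then have "t = frac t + real (nat \<lfloor>t\<rfloor>)" by (simp add: frac_def)
    then show ?thesis using nat[of "frac t" "nat \<lfloor>t\<rfloor>"] by simp
  next
    case False
    then have "frac t = t + real (nat (- \<lfloor>t\<rfloor>))" by (simp add: frac_def)
    then show ?thesis using nat[of t "nat (- \<lfloor>t\<rfloor>)"] by simp
  qed
qed

lemma path_image_periodic:
  fixes f :: "real \<Rightarrow> real^2"
  assumes "\<And>t. f (t + 1) = f t"
  shows "path_image f = range f"
proof
  show "range f \<subseteq> path_image f"
  proof
    fix p assume "p \<in> range f"
    then obtain t where "p = f t" by blast
    then have "p = f (frac t)" using periodic_frac[of f, OF assms] by simp
    then show "p \<in> path_image f" using frac_lt_1[of t] by (auto simp: path_image_def)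
  qed
qed (auto simp: path_image_def)

text \<open>The parameter on \<open>\<beta>\<close> is quantified away in \<open>T\<close>, so the
  two parametrizations are never matched; once \<open>T\<close> is the whole line, the local result
  places every point of \<open>\<alpha>\<close> on \<open>\<beta>\<close>.\<close>

lemma ovals_subset:
  assumes \<gamma>: "smooth_simple_closed_curve \<gamma>" and int: "polynomially_integrable_billiard \<gamma>"
    and C: "irreducible_projective_curve C" and \<gamma>C: "plane_embedding ` path_image \<gamma> \<subseteq> C"
    and \<alpha>: "real_oval C \<alpha>" and \<beta>: "real_oval C \<beta>" and L: "tangent_line \<alpha> L" "tangent_line \<beta> L"
  shows "path_image \<alpha> \<subseteq> path_image \<beta>"
proof -
  have \<alpha>s: "smooth_simple_closed_curve \<alpha>" and \<beta>s: "smooth_simple_closed_curve \<beta>"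
    and \<alpha>C: "plane_embedding ` path_image \<alpha> \<subseteq> C" and \<beta>C: "plane_embedding ` path_image \<beta> \<subseteq> C"
    using \<alpha> \<beta> by (auto simp: real_oval_def)
  obtain G1 G2 where G: "\<And>t. (\<gamma> has_vector_derivative G1 t) (at t)" "\<And>t. (G1 has_vector_derivative G2 t) (at t)"
    "\<And>t. G1 t \<noteq> 0" "\<And>t. vector_derivative \<gamma> (at t) = G1 t" "\<And>t. isCont G2 t"
    by (rule smooth_simple_closed_curveE[OF \<gamma>]) blast
  obtain A1 A2 where A: "\<And>t. (\<alpha> has_vector_derivative A1 t) (at t)" "\<And>t. (A1 has_vector_derivative A2 t) (at t)"
    "\<And>t. A1 t \<noteq> 0" "\<And>t. vector_derivative \<alpha> (at t) = A1 t" "\<And>t. isCont A2 t"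
    by (rule smooth_simple_closed_curveE[OF \<alpha>s]) blast
  obtain B1 B2 where B: "\<And>t. (\<beta> has_vector_derivative B1 t) (at t)" "\<And>t. (B1 has_vector_derivative B2 t) (at t)"
    "\<And>t. B1 t \<noteq> 0" "\<And>t. vector_derivative \<beta> (at t) = B1 t" "\<And>t. isCont B2 t"
    by (rule smooth_simple_closed_curveE[OF \<beta>s]) blast
  have per: "\<And>t. \<gamma> (t + 1) = \<gamma> t" "\<And>t. \<alpha> (t + 1) = \<alpha> t" "\<And>t. \<beta> (t + 1) = \<beta> t"
    using \<gamma> \<alpha>s \<beta>s by (auto simp: smooth_simple_closed_curve_def)
  have inC: "(f s $ i, f s $ j) \<in> real_points C i j"
    if "\<And>t. f (t + 1) = f t" "plane_embedding ` path_image f \<subseteq> C" for f :: "real \<Rightarrow> real^2" and s i j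
    using that(2) unfolding path_image_periodic[of f, OF that(1)] real_points_def by blast
  have B1per: "B1 (t + 1) = B1 t" for t
  proof -
    have "((\<lambda>s. s + 1) has_vector_derivative (1::real)) (at t)"
      unfolding has_real_derivative_iff_has_vector_derivative[symmetric] by (auto intro!: derivative_eq_intros)
    then have "((\<lambda>s. \<beta> (s + 1)) has_vector_derivative B1 (t + 1)) (at t)"
      using vector_diff_chain_at[of "\<lambda>s. s + 1" 1 t \<beta> "B1 (t + 1)"] B(1)[of "t + 1"]
      by (simp add: comp_def)
    then have "(\<beta> has_vector_derivative B1 (t + 1)) (at t)" by (simp add: per)
    then show ?thesis using B(1) vector_derivative_unique_at by blast
  qed
  have step: "\<alpha> t = \<beta> u \<and> (\<forall>\<^sub>F s in nhds t. \<exists>r. same_line (\<alpha> s) (A1 s) (\<beta> r) (B1 r))"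
    if tu: "same_line (\<alpha> t) (A1 t) (\<beta> u) (B1 u)" for t u
  proof -
    \<comment> \<open>An order of coordinates in which the common tangent has a slope. The line
      polynomial and the curved arc of \<open>\<gamma>\<close> are obtained for this order.\<close>
    have "\<exists>i j. i \<noteq> j \<and> A1 t $ i \<noteq> 0"
    proof (rule ccontr)
      assume "\<not> ?thesis"
      then have "A1 t $ 1 = 0" "A1 t $ 2 = 0" by (metis one_neq_zero zero_neq_one exhaust_2 num1_eq_iff zero_neq_numeral vector_2)+
      with A(3)[of t] show False by (simp add: vec_eq_iff forall_2)
    qed
    then obtain i j where ij: "i \<noteq> j" and nz: "A1 t $ i \<noteq> 0" by blast
    have Z: "zariski_irreducible (real_points C i j)" by (rule zariski_irreducible_real_points[OF C ij])
    obtain e N where nonconst: "\<And>K. \<exists>u v. bieval e u v \<noteq> K * (1 + u\<^sup>2) ^ N"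
      and refl: "\<And>t. \<lbrakk>0 < t; t < 1; G1 t $ i \<noteq> 0\<rbrakk> \<Longrightarrow>
       reflection_invariant e N (G1 t $ j / G1 t $ i) (\<gamma> t $ i) (\<gamma> t $ j)"
      by (rule billiard_line_polynomial[OF \<gamma> int ij, unfolded G(4)]) blast
    note cG = plane_curve_components[OF G(1,2), of i j]
    note cA = plane_curve_components[OF A(1,2), of i j]
    note cB = plane_curve_components[OF B(1,2), of i j]
    interpret g: plane_curve "\<lambda>t. \<gamma> t $ i" "\<lambda>t. \<gamma> t $ j" "\<lambda>t. G1 t $ i" "\<lambda>t. G1 t $ j" "\<lambda>t. G2 t $ i" "\<lambda>t. G2 t $ j"
      by (rule cG)
    interpret p: plane_curve "\<lambda>t. \<alpha> t $ i" "\<lambda>t. \<alpha> t $ j" "\<lambda>t. A1 t $ i" "\<lambda>t. A1 t $ j" "\<lambda>t. A2 t $ i" "\<lambda>t. A2 t $ j"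
      by (rule cA)
    interpret q: plane_curve "\<lambda>t. \<beta> t $ i" "\<lambda>t. \<beta> t $ j" "\<lambda>t. B1 t $ i" "\<lambda>t. B1 t $ j" "\<lambda>t. B2 t $ i" "\<lambda>t. B2 t $ j"
      by (rule cB)
    obtain a a' where aa: "0 \<le> a" "a < a'" "a' \<le> 1" and arc: "\<And>t. t \<in> {a<..<a'} \<Longrightarrow> G1 t $ i \<noteq> 0 \<and> g.m1 t \<noteq> 0"
      using exists_curved_arc[OF \<gamma> ij G(1,2,3,5)] by blast
    have arc': "G1 t $ i \<noteq> 0 \<and> g.m1 t \<noteq> 0 \<and> reflection_invariant e N (g.m t) (\<gamma> t $ i) (\<gamma> t $ j)"
      if "t \<in> {a<..<a'}" for t
      using arc[OF that] refl[of t] that aa unfolding g.m_def by auto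
    have fr: "same_line (\<alpha> s) (A1 s) (\<beta> u) (B1 u) \<longleftrightarrow> B1 u $ i \<noteq> 0 \<and> p.m s = q.m u \<and> p.b s = q.b u"
      if "A1 s $ i \<noteq> 0" for s u
      unfolding p.m_def q.m_def p.b_def q.b_def by (rule same_line_frame[OF ij B(3) that])
    have tu': "B1 u $ i \<noteq> 0" "p.m t = q.m u" "p.b t = q.b u" using tu fr[OF nz] by blast+
    note local = common_tangent_local[OF Z cG inC[of \<gamma>, OF per(1) \<gamma>C] aa(2) arc' nonconst
        cA inC[of \<alpha>, OF per(2) \<alpha>C] cB inC[of \<beta>, OF per(3) \<beta>C] nz tu']
    have "\<alpha> t $ i = \<beta> u $ i" by (rule local(1))
    moreover have "\<alpha> t $ j = \<beta> u $ j" by (rule local(2))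
    ultimately have "\<alpha> t = \<beta> u" by (rule frame_eqI[OF ij])
    have "\<forall>\<^sub>F s in nhds t. \<exists>r. A1 s $ i \<noteq> 0 \<and> B1 r $ i \<noteq> 0 \<and> p.m s = q.m r \<and> p.b s = q.b r"
      by (rule local(3))
    then have "\<forall>\<^sub>F s in nhds t. \<exists>r. same_line (\<alpha> s) (A1 s) (\<beta> r) (B1 r)"
      by eventually_elim (use fr in blast)
    with \<open>\<alpha> t = \<beta> u\<close> show ?thesis by blast
  qed
  define T where "T = {t. \<exists>u. same_line (\<alpha> t) (A1 t) (\<beta> u) (B1 u)}"
  have "open T"
  proof (rule openI)
    fix t assume "t \<in> T"
    then have "\<forall>\<^sub>F s in nhds t. s \<in> T" using step unfolding T_def mem_Collect_eq by blast
    then show "\<exists>e>0. ball t e \<subseteq> T"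
      by (auto simp: eventually_nhds_metric subset_iff dist_commute)
  qed
  moreover have "closed T"
  proof -
    define S where "S = {z. cross (A1 (snd z)) (B1 (fst z)) = 0} \<inter> {z. cross (A1 (snd z)) (\<beta> (fst z) - \<alpha> (snd z)) = 0}"
    have cts: "continuous_on UNIV f" if "\<And>t. (f has_vector_derivative f' t) (at t)" for f f' :: "real \<Rightarrow> real^2"
      using has_vector_derivative_continuous[OF that] by (simp add: continuous_on_eq_continuous_at)
    have fst: "continuous_on UNIV (\<lambda>z::real \<times> real. f (fst z))" and snd: "continuous_on UNIV (\<lambda>z::real \<times> real. f (snd z))"
      if "continuous_on UNIV f" for f :: "real \<Rightarrow> real^2"
      by (rule continuous_on_compose2[OF that], rule continuous_on_fst[OF continuous_on_id], rule subset_UNIV)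
         (rule continuous_on_compose2[OF that], rule continuous_on_snd[OF continuous_on_id], rule subset_UNIV)
    note c = snd[OF cts[OF A(1)]] snd[OF cts[OF A(2)]] fst[OF cts[OF B(1)]] fst[OF cts[OF B(2)]]
    have "closed S" unfolding S_def cross_def
      by (intro closed_Int closed_Collect_eq continuous_intros c)
    \<comment> \<open>By periodicity the parameter on \<open>\<beta>\<close> may be taken in a
      compact interval, and projection along a compact factor preserves closed sets.\<close>
    moreover have "T = {t. \<exists>u. u \<in> {0..1} \<and> (u, t) \<in> S}"
    proof (intro set_eqI iffI)
      fix t assume "t \<in> T"
      then obtain u where u: "same_line (\<alpha> t) (A1 t) (\<beta> u) (B1 u)" by (auto simp: T_def)
      have "frac u \<in> {0..1}" using frac_lt_1[of u] by simp
      moreover have "(frac u, t) \<in> S"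
        using u by (simp add: S_def same_line_def periodic_frac[of \<beta>, OF per(3)] periodic_frac[of B1, OF B1per])
      ultimately show "t \<in> {t. \<exists>u. u \<in> {0..1} \<and> (u, t) \<in> S}" by blast
    qed (auto simp: T_def S_def same_line_def)
    ultimately show ?thesis using closed_compact_projection[of "{0..1}" S] by simp
  qed
  moreover have "T \<noteq> {}"
  proof -
    obtain t u where t: "L = range (\<lambda>s. \<alpha> t + s *\<^sub>R A1 t)" and u: "L = range (\<lambda>s. \<beta> u + s *\<^sub>R B1 u)"
      using L unfolding tangent_line_def A(4) B(4) by blast
    \<comment> \<open>Two distinct points of \<open>L\<close> on the tangent of
      \<open>\<beta>\<close> determine both its position and its direction relative to the tangent
      of \<open>\<alpha>\<close>.\<close>
    have "\<beta> u + 0 *\<^sub>R B1 u \<in> L" "\<beta> u + 1 *\<^sub>R B1 u \<in> L" unfolding u by blast+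
    then have "\<exists>s. \<beta> u = \<alpha> t + s *\<^sub>R A1 t" "\<exists>s. \<beta> u + B1 u = \<alpha> t + s *\<^sub>R A1 t" unfolding t by auto
    then obtain s s' where "\<beta> u = \<alpha> t + s *\<^sub>R A1 t" "\<beta> u + B1 u = \<alpha> t + s' *\<^sub>R A1 t" by blast
    then have d: "\<beta> u - \<alpha> t = s *\<^sub>R A1 t" "B1 u = (s' - s) *\<^sub>R A1 t" by (auto simp: algebra_simps)
    have "same_line (\<alpha> t) (A1 t) (\<beta> u) (B1 u)" unfolding same_line_def d by (simp add: cross_def)
    then show ?thesis by (auto simp: T_def)
  qed
  ultimately have "T = UNIV" using clopen by blast
  have "\<alpha> t \<in> range \<beta>" for t
  proof -
    have "t \<in> T" using \<open>T = UNIV\<close> by blast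
    then show ?thesis using step unfolding T_def mem_Collect_eq by blast
  qed
  then show ?thesis
    unfolding path_image_periodic[of \<alpha>, OF per(2)] path_image_periodic[of \<beta>, OF per(3)] by blast
qed

theorem corollary1:
  fixes \<gamma> :: "real \<Rightarrow> real^2" and C :: "complex_projective_plane set"
  assumes "smooth_simple_closed_curve \<gamma>"
    and "polynomially_integrable_billiard \<gamma>"
    and "irreducible_projective_curve C" and "plane_embedding ` path_image \<gamma> \<subseteq> C"
  shows "\<not> (\<exists>\<alpha> \<beta> L. real_oval C \<alpha> \<and> real_oval C \<beta> \<and> path_image \<alpha> \<noteq> path_image \<beta> \<and>
               tangent_line \<alpha> L \<and> tangent_line \<beta> L)"
  \<comment> \<open>The hypotheses on the two ovals are symmetric, so the inclusion holds in both
    directions.\<close>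
  using ovals_subset[OF assms] by blast

end
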